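(* Let $n\ge 1$, $s\in(0,1)$ and $\varepsilon,\delta>0$. Let $u\in C^{s+\varepsilon}_{loc}(\mathbb{R}^n)\cap L^2_s(\mathbb{R}^n)$ be such that $G_u\in C^{2s+\delta}_{loc}(\mathbb{R}^n)\cap L^1_s(\mathbb{R}^n)$ and $(-\Delta)^s G_u\le 0$ in a neighborhood of the origin. Then there exists $R_0>0$ such that the map $$R\mapsto J^s_{ACF}(u,R)=\frac{1}{R^{1+s}}\int_0^R r^s\int_{\mathbb{R}^n\setminus B_r}K^s_r(0,y)\,G_u(y)\,dy\,dr$$ is monotone nondecreasing on $(0,R_0)$.
   Context: $B_r$ denotes the open ball of radius $r$ centered at $0$. $C_{n,s}:=\left(\int_{\mathbb{R}^n}\frac{1-\cos(\zeta_1)}{|\zeta|^{n+2s}}d\zeta\right)^{-1}$. For $1\le p<\infty$, $L^p_s(\mathbb{R}^n):=\{u\in L^1_{loc}(\mathbb{R}^n):\int_{\mathbb{R}^n}\frac{|u(x)|^p}{1+|x|^{n+2s}}dx<\infty\}$. For $\gamma>0$ not an integer, $C^{\gamma}_{loc}$ denotes $C^{k,\gamma-k}_{loc}$ with $k=\lfloor\gamma\rfloor$ (e.g. $C^{2s+\delta}$ means $C^{0,2s+\delta}$ if $2s+\delta<1$ and $C^{1,2s+\delta-1}$ if $2s+\delta>1$). The fractional Laplacian is $(-\Delta)^s u(x):=C_{n,s}\lim_{\epsilon\to0}\int_{\mathbb{R}^n\setminus B_\epsilon(x)}\frac{u(x)-u(y)}{|x-y|^{n+2s}}dy$. For $u:\mathbb{R}^n\to\mathbb{R}$,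 $G_u(y):=C_{n,s}\int_{\mathbb{R}^n}\frac{(u(y)-u(\eta))^2}{|y-\eta|^{n+2s}}d\eta$. With $a_{n,s}:=\Gamma(n/2)\pi^{-n/2-1}\sin(\pi s)$, the fractional Poisson kernel is $K^s_r(0,y):=a_{n,s}\left(\frac{r^2}{|y|^2-r^2}\right)^s\frac{1}{|y|^n}$ for $|y|>r$. *)

theory Defs
  imports "HOL-Analysis.Analysis"
begin

text \<open>The normalising constant C_{n,s}; zeta_1 is the first coordinate (w.r.t. a fixed basis vector).\<close>
definition C_ns :: "'a::euclidean_space itself \<Rightarrow> real \<Rightarrow> real" where
  "C_ns _ s = inverse (LINT \<zeta>|lborel.
      (1 - cos (\<zeta> \<bullet> (SOME b. b \<in> (Basis :: 'a set)))) / norm \<zeta> powr (real DIM('a) + 2 * s))"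

definition Lps :: "real \<Rightarrow> real \<Rightarrow> ('a::euclidean_space \<Rightarrow> real) \<Rightarrow> bool" where
  "Lps p s u \<longleftrightarrow>
     (\<forall>K. compact K \<longrightarrow> set_integrable lborel K u) \<and>
     integrable lborel (\<lambda>x. \<bar>u x\<bar> powr p / (1 + norm x powr (real DIM('a) + 2 * s)))"

text \<open>C^{k,alpha}_loc: k times (Frechet) differentiable, with all partial derivatives of order k
  locally alpha-Hoelder continuous (continuity included, relevant only for alpha = 0).\<close>
primrec holder_loc :: "nat \<Rightarrow> real \<Rightarrow> ('a::euclidean_space \<Rightarrow> real) \<Rightarrow> bool" where
  "holder_loc 0 \<alpha> f \<longleftrightarrow> continuous_on UNIV f \<and>
     (\<forall>K. compact K \<longrightarrow> (\<exists>C. \<forall>x\<in>K. \<forall>y\<in>K. \<bar>f x - f y\<bar> \<le> C * dist x y powr \<alpha>))"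
| "holder_loc (Suc k) \<alpha> f \<longleftrightarrow>
     (\<exists>Df :: 'a \<Rightarrow> 'a \<Rightarrow> real.
        (\<forall>x. (f has_derivative (\<lambda>h. \<Sum>b\<in>Basis. (h \<bullet> b) * Df b x)) (at x)) \<and>
        (\<forall>b\<in>Basis. holder_loc k \<alpha> (Df b)))"

definition C_loc :: "real \<Rightarrow> ('a::euclidean_space \<Rightarrow> real) \<Rightarrow> bool" where
  "C_loc \<gamma> f \<longleftrightarrow> holder_loc (nat \<lfloor>\<gamma>\<rfloor>) (\<gamma> - of_int \<lfloor>\<gamma>\<rfloor>) f"

definition frac_lap :: "real \<Rightarrow> ('a::euclidean_space \<Rightarrow> real) \<Rightarrow> 'a \<Rightarrow> real" where
  "frac_lap s u x = C_ns TYPE('a) s *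
     Lim (at_right 0) (\<lambda>\<epsilon>. LINT y : - ball x \<epsilon> | lborel.
            (u x - u y) / norm (x - y) powr (real DIM('a) + 2 * s))"

definition G_fun :: "real \<Rightarrow> ('a::euclidean_space \<Rightarrow> real) \<Rightarrow> 'a \<Rightarrow> real" where
  "G_fun s u y = C_ns TYPE('a) s *
     (LINT \<eta>|lborel. (u y - u \<eta>)\<^sup>2 / norm (y - \<eta>) powr (real DIM('a) + 2 * s))"

definition a_ns :: "'a::euclidean_space itself \<Rightarrow> real \<Rightarrow> real" where
  "a_ns _ s = Gamma (real DIM('a) / 2) * pi powr (- real DIM('a) / 2 - 1) * sin (pi * s)"

text \<open>Fractional Poisson kernel K^s_r(0,y), for norm y > r.\<close>
definition poisson_kernel :: "real \<Rightarrow> real \<Rightarrow> 'a::euclidean_space \<Rightarrow> real" where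
  "poisson_kernel s r y = a_ns TYPE('a) s * (r\<^sup>2 / ((norm y)\<^sup>2 - r\<^sup>2)) powr s / norm y ^ DIM('a)"

definition J_ACF :: "real \<Rightarrow> ('a::euclidean_space \<Rightarrow> real) \<Rightarrow> real \<Rightarrow> real" where
  "J_ACF s u R = 1 / R powr (1 + s) *
     (LINT r : {0..R} | lborel. r powr s *
        (LINT y : - ball 0 r | lborel. poisson_kernel s r y * G_fun s u y))"

end

theory Submission
  imports Defs
begin

text \<open>Write \<open>v = G_u\<close> and let \<open>P(r)\<close> be the average of \<open>v\<close> against the Poisson kernel of the ball of radius \<open>r\<close>.
  By scaling, \<open>J(R)\<close> is the integral over \<open>0 < t \<le> 1\<close> of \<open>t^s P(R t)\<close>, so it suffices that \<open>P\<close> is nondecreasing near \<open>0\<close>.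
  Test the inequality \<open>(-\<Delta>)^s v \<le> 0\<close> against the torsion function \<open>\<Phi>_R(x) = (R^2 - |x|^2)_+^s\<close>, which increases with \<open>R\<close>:
  the pairing of \<open>\<Phi>_R\<close> with \<open>-(-\<Delta>)^s v\<close> is nondecreasing in \<open>R\<close>, and by duality it equals the pairing of \<open>v\<close>
  with \<open>-(-\<Delta>)^s \<Phi>_R\<close>. The latter function is constant inside the ball, because on every line through a given interior
  point it reduces to a one-dimensional integral that does not depend on the line's position. Outside the ball, integration along
  lines, inversion and slicing show that it is a positive multiple of \<open>R^n k_R - n\<close> times the integral over \<open>0 < r \<le> R\<close> of
  \<open>r^{n-1} k_r\<close>, where \<open>k_r\<close> is the Poisson kernel; testing with \<open>v = 1\<close> shows that the interior constant is the matching one.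
  Hence \<open>M(R) = R^n P(R) - n\<close> times the integral over \<open>0 < r \<le> R\<close> of \<open>r^{n-1} P(r)\<close> is nondecreasing, formally
  \<open>M' = R^n P'\<close>, and therefore so is \<open>P\<close>. The Riesz kernel never appears, so no case distinction on \<open>n > 2 s\<close> is needed.\<close>

section \<open>Lebesgue measure: polar coordinates, isometries and slices\<close>

text \<open>The obstacle is the sphere. The Poisson kernel is singular at |y| = r, a set that moves
  with r, so P is shown to be continuous but is never differentiated; \<open>pavg_mono\<close> turns
  the formal identity M' = R^n P' into an argument that uses only continuity of P and monotonicity
  of M. The bounds on second differences of the torsion function also degenerate at the sphere.
  Their integrability over the ball is recovered from the interior constancy itself: the integral of
  the second difference is known exactly, and its negative part comes only from jumps across the
  sphere. The interior constancy is a symmetry of d\<sigma> / \<sigma>. With \<sigma> the inverse of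
  the position on a line, the torsion function becomes a truncated quadratic in \<sigma>; a shift
  removes the linear coefficient and a dilation the leading one. Spherical integration is replaced
  by averaging over the shell 1 < |\<theta>| < 2, at the price of a factor \<open>ln 2\<close>. Thus
  every identity is one of Lebesgue integrals, and constants are identified by positivity,
  finiteness or a test function instead of being evaluated.\<close>

lemma nn_integral_lborel_affine:
  fixes f :: "'a::euclidean_space \<Rightarrow> ennreal"
  assumes [measurable]: "f \<in> borel_measurable borel" and "c \<noteq> 0"
  shows "(\<integral>\<^sup>+x. f x \<partial>lborel) = ennreal (\<bar>c\<bar> ^ DIM('a)) * (\<integral>\<^sup>+x. f (t + c *\<^sub>R x) \<partial>lborel)"
  by (subst lborel_affine[OF assms(2), of t])
     (simp add: nn_integral_density nn_integral_distr nn_integral_cmult)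

lemma nn_integral_lborel_translate:
  fixes f :: "'a::euclidean_space \<Rightarrow> ennreal"
  assumes "f \<in> borel_measurable borel"
  shows "(\<integral>\<^sup>+x. f (t + x) \<partial>lborel) = (\<integral>\<^sup>+x. f x \<partial>lborel)"
  using nn_integral_lborel_affine[OF assms, of 1 t] by simp

lemma nn_integral_lborel_reflect:
  fixes f :: "'a::euclidean_space \<Rightarrow> ennreal"
  assumes "f \<in> borel_measurable borel"
  shows "(\<integral>\<^sup>+x. f (t - x) \<partial>lborel) = (\<integral>\<^sup>+x. f x \<partial>lborel)"
  using nn_integral_lborel_affine[OF assms, of "-1" t] by simp

text \<open>Polar coordinates with the sphere replaced by the shell 1 < |\<theta>| < 2 and the
  radius measured by d\<tau> / \<tau>. For fixed \<tau> the substitution z = p(\<tau>) \<theta> is a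
  dilation; for fixed z \<noteq> 0 the set of \<tau> with z / p(\<tau>) in the shell has mass
  \<open>ln 2\<close> by \<open>haar\<close>. Tonelli joins the two. The profile p is a parameter so
  that the identity and the inversion are both covered.\<close>

lemma nn_integral_polar:
  fixes F :: "'a::euclidean_space \<Rightarrow> ennreal" and p :: "real \<Rightarrow> real"
  assumes F[measurable]: "F \<in> borel_measurable borel" and p[measurable]: "p \<in> borel_measurable borel"
    and pos: "\<And>\<tau>. 0 < \<tau> \<Longrightarrow> 0 < p \<tau>"
    and haar: "\<And>a. 0 < a \<Longrightarrow>
      (\<integral>\<^sup>+\<tau>. indicator {0<..} \<tau> * ennreal (1 / \<tau>) * indicator {1<..<2} (a / p \<tau>) \<partial>lborel) = ennreal (ln 2)"
  shows "ennreal (ln 2) * (\<integral>\<^sup>+z. F z \<partial>lborel) =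
    (\<integral>\<^sup>+\<theta>. indicator {1<..<2} (norm \<theta>) *
       (\<integral>\<^sup>+\<tau>. indicator {0<..} \<tau> * (ennreal (p \<tau> ^ DIM('a) / \<tau>) * F (p \<tau> *\<^sub>R \<theta>)) \<partial>lborel) \<partial>lborel)"
    (is "_ = ?R")
proof -
  let ?I = "indicator {1<..<2} :: real \<Rightarrow> ennreal" and ?J = "indicator {0<..} :: real \<Rightarrow> ennreal"
  have "?R = (\<integral>\<^sup>+\<theta>. (\<integral>\<^sup>+\<tau>. ?I (norm \<theta>) * (?J \<tau> * (ennreal (p \<tau> ^ DIM('a) / \<tau>) * F (p \<tau> *\<^sub>R \<theta>))) \<partial>lborel) \<partial>lborel)"
    by (intro nn_integral_cong nn_integral_cmult[symmetric]) measurable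
  also have "\<dots> = (\<integral>\<^sup>+\<tau>. (\<integral>\<^sup>+\<theta>. ?I (norm \<theta>) * (?J \<tau> * (ennreal (p \<tau> ^ DIM('a) / \<tau>) * F (p \<tau> *\<^sub>R \<theta>))) \<partial>lborel) \<partial>lborel)"
    by (rule lborel_pair.Fubini'[symmetric]) measurable
  also have "\<dots> = (\<integral>\<^sup>+\<tau>. (\<integral>\<^sup>+z. F z * (?J \<tau> * ennreal (1/\<tau>) * ?I (norm z / p \<tau>)) \<partial>lborel) \<partial>lborel)"
  proof (rule nn_integral_cong)
    fix \<tau> :: real
    show "(\<integral>\<^sup>+\<theta>. ?I (norm \<theta>) * (?J \<tau> * (ennreal (p \<tau> ^ DIM('a) / \<tau>) * F (p \<tau> *\<^sub>R \<theta>))) \<partial>lborel)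
        = (\<integral>\<^sup>+z. F z * (?J \<tau> * ennreal (1/\<tau>) * ?I (norm z / p \<tau>)) \<partial>lborel)"
    proof (cases "0 < \<tau>")
      case True
      note pp = pos[OF True]
      have "(\<integral>\<^sup>+z. F z * (?J \<tau> * ennreal (1/\<tau>) * ?I (norm z / p \<tau>)) \<partial>lborel) =
        ennreal (p \<tau> ^ DIM('a)) * (\<integral>\<^sup>+z. F (p \<tau> *\<^sub>R z) * (?J \<tau> * ennreal (1/\<tau>) * ?I (norm z)) \<partial>lborel)"
        using pp by (subst nn_integral_lborel_affine[where c="p \<tau>" and t=0]) auto
      also have "\<dots> = (\<integral>\<^sup>+z. ennreal (p \<tau> ^ DIM('a)) * (F (p \<tau> *\<^sub>R z) * (?J \<tau> * ennreal (1/\<tau>) * ?I (norm z))) \<partial>lborel)"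
        by (rule nn_integral_cmult[symmetric]) measurable
      also have "\<dots> = (\<integral>\<^sup>+\<theta>. ?I (norm \<theta>) * (?J \<tau> * (ennreal (p \<tau> ^ DIM('a) / \<tau>) * F (p \<tau> *\<^sub>R \<theta>))) \<partial>lborel)"
      proof (rule nn_integral_cong)
        fix z :: 'a
        have "ennreal (p \<tau> ^ DIM('a) / \<tau>) = ennreal (p \<tau> ^ DIM('a)) * ennreal (1/\<tau>)"
          using pp True by (simp flip: ennreal_mult)
        then show "ennreal (p \<tau> ^ DIM('a)) * (F (p \<tau> *\<^sub>R z) * (?J \<tau> * ennreal (1/\<tau>) * ?I (norm z))) =
          ?I (norm z) * (?J \<tau> * (ennreal (p \<tau> ^ DIM('a) / \<tau>) * F (p \<tau> *\<^sub>R z)))"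
          by (simp add: mult_ac)
      qed
      finally show ?thesis by simp
    qed simp
  qed
  also have "\<dots> = (\<integral>\<^sup>+z. (\<integral>\<^sup>+\<tau>. F z * (?J \<tau> * ennreal (1/\<tau>) * ?I (norm z / p \<tau>)) \<partial>lborel) \<partial>lborel)"
    by (rule lborel_pair.Fubini') measurable
  also have "\<dots> = (\<integral>\<^sup>+z. F z * (\<integral>\<^sup>+\<tau>. ?J \<tau> * ennreal (1/\<tau>) * ?I (norm z / p \<tau>) \<partial>lborel) \<partial>lborel)"
    by (intro nn_integral_cong nn_integral_cmult) measurable
  also have "\<dots> = (\<integral>\<^sup>+z. F z * ennreal (ln 2) \<partial>lborel)"
  proof (rule nn_integral_cong_AE)
    have "AE z::'a in lborel. z \<noteq> 0" by (rule AE_lborel_singleton)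
    then show "AE z in lborel. F z * (\<integral>\<^sup>+\<tau>. ?J \<tau> * ennreal (1/\<tau>) * ?I (norm z / p \<tau>) \<partial>lborel) = F z * ennreal (ln 2)"
      by eventually_elim (simp add: haar)
  qed
  also have "\<dots> = ennreal (ln 2) * (\<integral>\<^sup>+z. F z \<partial>lborel)"
    by (simp add: nn_integral_multc mult.commute)
  finally show ?thesis by simp
qed

lemma nn_integral_haar_ln2:
  assumes "0 < (a::real)"
  shows "(\<integral>\<^sup>+\<tau>. ennreal (1 / \<tau>) * indicator {a..2*a} \<tau> \<partial>lborel) = ennreal (ln 2)"
proof -
  have "(\<integral>\<^sup>+\<tau>. ennreal (1 / \<tau>) * indicator {a..2*a} \<tau> \<partial>lborel) = ln (2*a) - ln a"
    using assms by (intro nn_integral_FTC_Icc) (auto intro!: derivative_eq_intros simp: )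
  then show ?thesis using assms by (simp add: ln_mult)
qed

lemma nn_integral_haar_open:
  assumes "0 < (a::real)"
  shows "(\<integral>\<^sup>+\<tau>. indicator {0<..} \<tau> * ennreal (1 / \<tau>) * indicator {a<..<2*a} \<tau> \<partial>lborel) = ennreal (ln 2)"
  unfolding nn_integral_haar_ln2[OF assms, symmetric]
proof (rule nn_integral_cong_AE)
  have "AE z::real in lborel. z \<noteq> a" "AE z::real in lborel. z \<noteq> 2*a" by (rule AE_lborel_singleton)+
  then show "AE x in lborel. indicator {0<..} x * ennreal (1 / x) * indicator {a<..<2 * a} x
    = ennreal (1 / x) * indicator {a..2 * a} x"
    by eventually_elim (use assms in \<open>auto simp: indicator_def\<close>)
qed

lemma nn_integral_polar_direct:
  fixes F :: "'a::euclidean_space \<Rightarrow> ennreal"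
  assumes [measurable]: "F \<in> borel_measurable borel"
  shows "ennreal (ln 2) * (\<integral>\<^sup>+z. F z \<partial>lborel) =
    (\<integral>\<^sup>+\<theta>. indicator {1<..<2} (norm \<theta>) *
       (\<integral>\<^sup>+\<tau>. indicator {0<..} \<tau> * (ennreal (\<tau> ^ DIM('a) / \<tau>) * F (\<tau> *\<^sub>R \<theta>)) \<partial>lborel) \<partial>lborel)"
proof (rule nn_integral_polar)
  fix a :: real assume "0 < a"
  have "(\<integral>\<^sup>+\<tau>. indicator {0<..} \<tau> * ennreal (1 / \<tau>) * indicator {1<..<2} (a / \<tau>) \<partial>lborel) =
    (\<integral>\<^sup>+\<tau>. indicator {0<..} \<tau> * ennreal (1 / \<tau>) * indicator {a/2<..<2*(a/2)} \<tau> \<partial>lborel)"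
    by (intro nn_integral_cong) (auto simp: indicator_def field_simps)
  also have "\<dots> = ennreal (ln 2)"
    by (rule nn_integral_haar_open) (use \<open>0 < a\<close> in simp)
  finally show "(\<integral>\<^sup>+\<tau>. indicator {0<..} \<tau> * ennreal (1 / \<tau>) * indicator {1<..<2} (a / \<tau>) \<partial>lborel) = ennreal (ln 2)" .
qed auto

text \<open>The shell of directions has finite measure, so integrability reduces to a
  one-dimensional bound uniform in the direction.\<close>

lemma nn_integral_polar_finite:
  fixes F :: "'a::euclidean_space \<Rightarrow> ennreal"
  assumes [measurable]: "F \<in> borel_measurable borel" and C: "C < top"
    and bound: "\<And>\<theta>::'a. 1 < norm \<theta> \<Longrightarrow> norm \<theta> < 2 \<Longrightarrow>
      (\<integral>\<^sup>+\<tau>. indicator {0<..} \<tau> * (ennreal (\<tau> ^ DIM('a) / \<tau>) * F (\<tau> *\<^sub>R \<theta>)) \<partial>lborel) \<le> C"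
  shows "(\<integral>\<^sup>+z. F z \<partial>lborel) < top"
proof -
  let ?I = "\<lambda>\<theta>::'a. \<integral>\<^sup>+\<tau>. indicator {0<..} \<tau> * (ennreal (\<tau> ^ DIM('a) / \<tau>) * F (\<tau> *\<^sub>R \<theta>)) \<partial>lborel"
  have "ennreal (ln 2) * (\<integral>\<^sup>+z. F z \<partial>lborel) = (\<integral>\<^sup>+\<theta>. indicator {1<..<2} (norm \<theta>) * ?I \<theta> \<partial>lborel)"
    by (rule nn_integral_polar_direct) measurable
  also have "\<dots> \<le> (\<integral>\<^sup>+(\<theta>::'a). C * indicator (cball 0 2) \<theta> \<partial>lborel)"
  proof (rule nn_integral_mono)
    fix \<theta> :: 'a
    show "indicator {1<..<2} (norm \<theta>) * ?I \<theta> \<le> C * indicator (cball 0 2) \<theta>"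
    proof (cases "1 < norm \<theta> \<and> norm \<theta> < 2")
      case True
      then have "indicator {1<..<2} (norm \<theta>) = (1::ennreal)" "indicator (cball 0 2) \<theta> = (1::ennreal)" by auto
      then show ?thesis using bound[of \<theta>] True by (simp only: mult_1 mult_1_right)
    next
      case False
      then have "indicator {1<..<2} (norm \<theta>) = (0::ennreal)" by (auto simp: indicator_def)
      then show ?thesis by (simp only: mult_zero_left) simp
    qed
  qed
  also have "\<dots> = C * emeasure lborel (cball (0::'a) 2)"
    by (rule nn_integral_cmult_indicator) simp
  also have "\<dots> < top"
    using C emeasure_lborel_cball_finite[of "0::'a" 2] by (auto simp: ennreal_mult_less_top less_top)
  finally show ?thesis by (auto simp: ennreal_mult_less_top)
qed

text \<open>The profile p(\<sigma>) = 1 / \<sigma>. A quadratic in the distance along a ray,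
  multiplied by \<sigma>^2, is again a quadratic in \<sigma>, and infinity is moved to \<sigma> =
  0.\<close>

lemma nn_integral_polar_inverse:
  fixes F :: "'a::euclidean_space \<Rightarrow> ennreal"
  assumes [measurable]: "F \<in> borel_measurable borel"
  shows "ennreal (ln 2) * (\<integral>\<^sup>+z. F z \<partial>lborel) =
    (\<integral>\<^sup>+\<theta>. indicator {1<..<2} (norm \<theta>) *
       (\<integral>\<^sup>+\<sigma>. indicator {0<..} \<sigma> * (ennreal ((1 / \<sigma>) ^ DIM('a) / \<sigma>) * F ((1 / \<sigma>) *\<^sub>R \<theta>)) \<partial>lborel) \<partial>lborel)"
proof (rule nn_integral_polar)
  fix a :: real assume a: "0 < a"
  have "(\<integral>\<^sup>+\<tau>. indicator {0<..} \<tau> * ennreal (1 / \<tau>) * indicator {1<..<2} (a / (1 / \<tau>)) \<partial>lborel) =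
    (\<integral>\<^sup>+\<tau>. indicator {0<..} \<tau> * ennreal (1 / \<tau>) * indicator {1/a<..<2*(1/a)} \<tau> \<partial>lborel)"
    using a by (intro nn_integral_cong) (auto simp: indicator_def field_simps)
  also have "\<dots> = ennreal (ln 2)"
    by (rule nn_integral_haar_open) (use \<open>0 < a\<close> in simp)
  finally show "(\<integral>\<^sup>+\<tau>. indicator {0<..} \<tau> * ennreal (1 / \<tau>) * indicator {1<..<2} (a / (1 / \<tau>)) \<partial>lborel) = ennreal (ln 2)" .
qed auto

text \<open>Integrate \<open>b x * f (T y + x)\<close> over x and y, with b the indicator of the
  unit ball. In one order translation invariance in y leaves the integral of f composed with T; in
  the other, \<open>b (x - T y) = b (T x - y)\<close> leaves the integral of f. Both carry the same
  factor I, the volume of the unit ball, which is positive and finite and can be cancelled.\<close>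

lemma nn_integral_linear_isometry:
  fixes f :: "'a::euclidean_space \<Rightarrow> ennreal" and T :: "'a \<Rightarrow> 'a"
  assumes [measurable]: "f \<in> borel_measurable borel" "T \<in> borel_measurable borel"
    and add: "\<And>x y. T (x + y) = T x + T y" and invol: "\<And>x. T (T x) = x" and iso: "\<And>x. norm (T x) = norm x"
  shows "(\<integral>\<^sup>+x. f (T x) \<partial>lborel) = (\<integral>\<^sup>+x. f x \<partial>lborel)"
proof -
  define b :: "'a \<Rightarrow> ennreal" where "b = indicator (ball 0 1)"
  have [measurable]: "b \<in> borel_measurable borel"
    unfolding b_def by (simp add: borel_measurable_indicator)
  define I where "I = (\<integral>\<^sup>+x. b x \<partial>lborel)"
  have I: "I = emeasure lborel (ball (0::'a) 1)" unfolding I_def b_def by simp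
  have "0 < measure lborel (ball (0::'a) 1)"
    using content_ball_pos[of 1 "0::'a"] by simp
  then have I0: "I \<noteq> 0" unfolding I using measure_eq_emeasure_eq_ennreal[of 0 lborel] 
    by (auto simp: measure_def)
  have I1: "I \<noteq> top" unfolding I using emeasure_lborel_ball_finite[of "0::'a" 1] by auto
  have bs: "b (x - T y) = b (T x - y)" for x y
  proof -
    have "T (x - T y + T y) = T (x - T y) + T (T y)" by (rule add)
    then have "T (x - T y) = T x - y" using invol[of y] by (simp add: algebra_simps)
    then have "norm (x - T y) = norm (T x - y)" using iso[of "x - T y"] by simp
    then show ?thesis by (simp add: b_def indicator_def)
  qed
  have "I * (\<integral>\<^sup>+y. f (T y) \<partial>lborel) = (\<integral>\<^sup>+x. b x * (\<integral>\<^sup>+y. f (T y) \<partial>lborel) \<partial>lborel)"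
    unfolding I_def by (rule nn_integral_multc[symmetric]) measurable
  also have "\<dots> = (\<integral>\<^sup>+x. b x * (\<integral>\<^sup>+y. f (T (T x + y)) \<partial>lborel) \<partial>lborel)"
    by (intro nn_integral_cong arg_cong2[where f="(*)"] refl nn_integral_lborel_translate[symmetric, of "\<lambda>y. f (T y)"]) measurable
  also have "\<dots> = (\<integral>\<^sup>+x. (\<integral>\<^sup>+y. b x * f (T y + x) \<partial>lborel) \<partial>lborel)"
    unfolding add invol by (subst nn_integral_cmult) (simp_all add: add.commute)
  also have "\<dots> = (\<integral>\<^sup>+y. (\<integral>\<^sup>+x. b x * f (T y + x) \<partial>lborel) \<partial>lborel)"
    by (rule lborel_pair.Fubini'[symmetric]) measurable
  also have "\<dots> = (\<integral>\<^sup>+y. (\<integral>\<^sup>+x. b (x - T y) * f x \<partial>lborel) \<partial>lborel)"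
  proof (rule nn_integral_cong)
    fix y
    show "(\<integral>\<^sup>+x. b x * f (T y + x) \<partial>lborel) = (\<integral>\<^sup>+x. b (x - T y) * f x \<partial>lborel)"
      using nn_integral_lborel_translate[of "\<lambda>x. b (x - T y) * f x" "T y"] by simp
  qed
  also have "\<dots> = (\<integral>\<^sup>+x. (\<integral>\<^sup>+y. b (x - T y) * f x \<partial>lborel) \<partial>lborel)"
    by (rule lborel_pair.Fubini') measurable
  also have "\<dots> = (\<integral>\<^sup>+x. I * f x \<partial>lborel)"
  proof (rule nn_integral_cong)
    fix x
    have "(\<integral>\<^sup>+y. b (x - T y) * f x \<partial>lborel) = (\<integral>\<^sup>+y. b (T x - y) * f x \<partial>lborel)" unfolding bs ..
    also have "\<dots> = (\<integral>\<^sup>+y. b (T x - y) \<partial>lborel) * f x" by (rule nn_integral_multc) measurable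
    also have "\<dots> = I * f x" unfolding I_def using nn_integral_lborel_reflect[of b "T x"] by simp
    finally show "(\<integral>\<^sup>+y. b (x - T y) * f x \<partial>lborel) = I * f x" .
  qed
  also have "\<dots> = I * (\<integral>\<^sup>+x. f x \<partial>lborel)" by (rule nn_integral_cmult) measurable
  finally show ?thesis using I0 I1 by (simp add: ennreal_mult_cancel_left)
qed

text \<open>The reflection in the hyperplane orthogonal to e - e' exchanges the two unit vectors and
  preserves norms, so a function of norm and height cannot tell them apart.\<close>

lemma nn_integral_reflection_invariant:
  fixes \<Psi> :: "real \<Rightarrow> real \<Rightarrow> ennreal" and e e' :: "'a::euclidean_space"
  assumes [measurable]: "case_prod \<Psi> \<in> borel_measurable (borel \<Otimes>\<^sub>M borel)"
    and e: "norm e = 1" "norm e' = 1"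
  shows "(\<integral>\<^sup>+x. \<Psi> (norm x) (x \<bullet> e) \<partial>lborel) = (\<integral>\<^sup>+x. \<Psi> (norm x) (x \<bullet> e') \<partial>lborel)"
proof (cases "e = e'")
  case False
  define w where "w = e - e'"
  define T where "T x = x - (2 * (x \<bullet> w) / (w \<bullet> w)) *\<^sub>R w" for x
  have w: "w \<bullet> w \<noteq> 0" using False by (simp add: w_def)
  have ee: "e \<bullet> e = 1" "e' \<bullet> e' = 1" using e by (simp_all add: dot_square_norm)
  have Tn: "norm (T x) = norm x" for x
    unfolding norm_eq T_def using w by (simp add: inner_diff_left inner_diff_right inner_commute field_simps power2_eq_square)
  have Te: "T x \<bullet> e = x \<bullet> e'" for x
  proof -
    have ww: "w \<bullet> w = 2 * (w \<bullet> e)" using ee by (simp add: w_def inner_diff_left inner_diff_right inner_commute)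
    have "(2 * (x \<bullet> w) / (w \<bullet> w)) * (w \<bullet> e) = x \<bullet> w" using w unfolding ww by simp
    then show ?thesis unfolding T_def inner_diff_left inner_scaleR_left by (simp add: w_def inner_diff_right)
  qed
  have "(\<integral>\<^sup>+x. \<Psi> (norm x) (x \<bullet> e) \<partial>lborel) = (\<integral>\<^sup>+x. \<Psi> (norm (T x)) (T x \<bullet> e) \<partial>lborel)"
  proof (rule nn_integral_linear_isometry[symmetric, of "\<lambda>x. \<Psi> (norm x) (x \<bullet> e)"])
    show "T \<in> borel_measurable borel" unfolding T_def by measurable
    show "T (x + y) = T x + T y" for x y unfolding T_def by (simp add: inner_add_left algebra_simps add_divide_distrib)
    show "T (T x) = x" for x unfolding T_def using w by (simp add: inner_diff_left algebra_simps divide_simps)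
    show "norm (T x) = norm x" for x by (rule Tn)
  qed measurable
  then show ?thesis unfolding Tn Te .
qed simp

text \<open>Fubini along lines parallel to e, stated on the whole space: averaging the height
  against g takes the place of a measure on the orthogonal hyperplane. After x is translated by t e,
  the factor g is evaluated at the height minus t, and its integral over t no longer depends on
  x.\<close>

lemma nn_integral_slice:
  fixes F :: "'a::euclidean_space \<Rightarrow> ennreal" and g :: "real \<Rightarrow> ennreal"
  assumes [measurable]: "F \<in> borel_measurable borel" "g \<in> borel_measurable borel" and e: "norm e = 1"
  shows "(\<integral>\<^sup>+t. g t \<partial>lborel) * (\<integral>\<^sup>+x. F x \<partial>lborel) =
    (\<integral>\<^sup>+x. g (x \<bullet> e) * (\<integral>\<^sup>+t. F (x - (x \<bullet> e) *\<^sub>R e + t *\<^sub>R e) \<partial>lborel) \<partial>lborel)" (is "_ = ?R")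
proof -
  have ee: "e \<bullet> e = 1" using e by (simp add: dot_square_norm)
  have "?R = (\<integral>\<^sup>+x. g (x \<bullet> e) * (\<integral>\<^sup>+t. F (x + t *\<^sub>R e) \<partial>lborel) \<partial>lborel)"
  proof (rule nn_integral_cong)
    fix x
    have "(\<integral>\<^sup>+t. F (x - (x \<bullet> e) *\<^sub>R e + t *\<^sub>R e) \<partial>lborel) = (\<integral>\<^sup>+t. F (x + t *\<^sub>R e) \<partial>lborel)"
      using nn_integral_lborel_translate[of "\<lambda>t. F (x + t *\<^sub>R e)" "- (x \<bullet> e)"]
      by (simp add: algebra_simps)
    then show "g (x \<bullet> e) * (\<integral>\<^sup>+t. F (x - (x \<bullet> e) *\<^sub>R e + t *\<^sub>R e) \<partial>lborel) =
      g (x \<bullet> e) * (\<integral>\<^sup>+t. F (x + t *\<^sub>R e) \<partial>lborel)"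
      by simp
  qed
  also have "\<dots> = (\<integral>\<^sup>+x. (\<integral>\<^sup>+t. g (x \<bullet> e) * F (x + t *\<^sub>R e) \<partial>lborel) \<partial>lborel)"
    by (intro nn_integral_cong nn_integral_cmult[symmetric]) measurable
  also have "\<dots> = (\<integral>\<^sup>+t. (\<integral>\<^sup>+x. g (x \<bullet> e) * F (x + t *\<^sub>R e) \<partial>lborel) \<partial>lborel)"
    by (rule lborel_pair.Fubini'[symmetric]) measurable
  also have "\<dots> = (\<integral>\<^sup>+t. (\<integral>\<^sup>+x. g (x \<bullet> e - t) * F x \<partial>lborel) \<partial>lborel)"
  proof (rule nn_integral_cong)
    fix t
    show "(\<integral>\<^sup>+x. g (x \<bullet> e) * F (x + t *\<^sub>R e) \<partial>lborel) = (\<integral>\<^sup>+x. g (x \<bullet> e - t) * F x \<partial>lborel)"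
      using nn_integral_lborel_translate[of "\<lambda>x. g (x \<bullet> e - t) * F x" "t *\<^sub>R e"] ee
      by (simp add: inner_add_left add.commute)
  qed
  also have "\<dots> = (\<integral>\<^sup>+x. (\<integral>\<^sup>+t. g (x \<bullet> e - t) * F x \<partial>lborel) \<partial>lborel)"
    by (rule lborel_pair.Fubini') measurable
  also have "\<dots> = (\<integral>\<^sup>+x. (\<integral>\<^sup>+t. g t \<partial>lborel) * F x \<partial>lborel)"
    by (intro nn_integral_cong) (simp add: nn_integral_multc nn_integral_lborel_reflect)
  also have "\<dots> = (\<integral>\<^sup>+t. g t \<partial>lborel) * (\<integral>\<^sup>+x. F x \<partial>lborel)"
    by (rule nn_integral_cmult) measurable
  finally show ?thesis by simp
qed

section \<open>Truncated powers\<close>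

text \<open>In the library \<open>x powr a\<close> does not vanish for negative \<open>x\<close>, hence the explicit truncation.\<close>

definition tpow :: "real \<Rightarrow> real \<Rightarrow> real" where
  "tpow a X = (if 0 < X then X powr a else 0)"

lemma tpow_measurable [measurable]: "tpow a \<in> borel_measurable borel"
  unfolding tpow_def by measurable

lemma tpow_nonneg [simp]: "0 \<le> tpow a X"
  by (simp add: tpow_def)

lemma tpow_neg: "X \<le> 0 \<Longrightarrow> tpow a X = 0"
  by (simp add: tpow_def)

lemma tpow_pos: "0 < X \<Longrightarrow> tpow a X = X powr a"
  by (simp add: tpow_def)

lemma tpow_cmult: "0 < c \<Longrightarrow> tpow a (c * X) = c powr a * tpow a X"
  by (simp add: tpow_def powr_mult zero_less_mult_iff)

lemma continuous_on_tpow: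
  assumes "0 < s" shows "continuous_on UNIV (tpow s)"
proof -
  have "tpow s = (\<lambda>x. max x 0 powr s)"
    using assms by (auto simp: tpow_def max_def fun_eq_iff)
  moreover have "continuous_on UNIV (\<lambda>x::real. max x 0 powr s)"
    by (intro continuous_on_powr' continuous_intros) (use assms in auto)
  ultimately show ?thesis by simp
qed

lemma tpow_mono: "0 \<le> s \<Longrightarrow> X \<le> Y \<Longrightarrow> tpow s X \<le> tpow s Y"
  by (auto simp: tpow_def intro: powr_mono2)

lemma nn_integral_tpow_FTC:
  assumes s: "0 < s" and AB: "A \<le> B"
  shows "(\<integral>\<^sup>+X. ennreal (s * tpow (s - 1) X) * indicator {A..B} X \<partial>lborel) = ennreal (tpow s B - tpow s A)"
proof (cases "B \<le> 0")
  case True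
  then have "(\<integral>\<^sup>+X. ennreal (s * tpow (s - 1) X) * indicator {A..B} X \<partial>lborel) = (\<integral>\<^sup>+(X::real). 0 \<partial>lborel)"
    by (intro nn_integral_cong) (auto simp: indicator_def tpow_neg)
  then show ?thesis using True AB by (simp add: tpow_neg)
next
  case False
  \<comment> \<open>The integrand vanishes for X \<le> 0, so the antiderivative is used on {A'..B}
    only. For s < 1 it is not differentiable at 0, hence the interior form of the fundamental
    theorem.\<close>
  define A' where "A' = max A 0"
  have A': "0 \<le> A'" "A' \<le> B" using False AB by (auto simp: A'_def)
  have "((\<lambda>X. s * X powr (s-1)) has_integral (B powr s - A' powr s)) {A'..B}"
  proof (rule fundamental_theorem_of_calculus_interior)
    show "continuous_on {A'..B} (\<lambda>X. X powr s)"
      by (intro continuous_on_powr' continuous_intros) (use s A' in auto)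
    show "((\<lambda>X. X powr s) has_vector_derivative s * x powr (s-1)) (at x)" if "x \<in> {A'<..<B}" for x
      using that A' unfolding has_real_derivative_iff_has_vector_derivative[symmetric]
      by (auto intro!: derivative_eq_intros)
  qed (use A' in auto)
  then have "(\<integral>\<^sup>+X. ennreal (s * X powr (s-1)) * indicator {A'..B} X \<partial>lborel) = ennreal (B powr s - A' powr s)"
    by (intro nn_integral_has_integral_lebesgue') (use s in auto)
  also have "(\<integral>\<^sup>+X. ennreal (s * X powr (s-1)) * indicator {A'..B} X \<partial>lborel) =
     (\<integral>\<^sup>+X. ennreal (s * tpow (s - 1) X) * indicator {A..B} X \<partial>lborel)"
    by (intro nn_integral_cong) (auto simp: indicator_def tpow_def A'_def)
  also have "B powr s - A' powr s = tpow s B - tpow s A"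
    using False s by (auto simp: tpow_def A'_def max_def)
  finally show ?thesis .
qed

lemma nn_integral_abs_powr_finite:
  fixes a b c :: real
  assumes "0 < a" "a < 1"
  shows "(\<integral>\<^sup>+u. ennreal (\<bar>u\<bar> powr (-a)) * indicator {-c..c} u \<partial>lborel) < top"
proof -
  let ?f = "\<lambda>u. ennreal (tpow (-a) u) * indicator {0..\<bar>c\<bar>} u"
  have 1: "(\<integral>\<^sup>+u. ?f u \<partial>lborel) < top"
  proof -
    have "ennreal (1 - a) * (\<integral>\<^sup>+u. ?f u \<partial>lborel) = (\<integral>\<^sup>+X. ennreal ((1-a) * tpow ((1-a) - 1) X) * indicator {0..\<bar>c\<bar>} X \<partial>lborel)"
      using assms by (subst nn_integral_cmult[symmetric]) (auto simp: ennreal_mult mult.assoc)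
    also have "\<dots> < top" by (subst nn_integral_tpow_FTC) (use assms in auto)
    finally show ?thesis using assms by (auto simp: ennreal_mult_less_top)
  qed
  have 2: "(\<integral>\<^sup>+u. ?f (0 - u) \<partial>lborel) = (\<integral>\<^sup>+u. ?f u \<partial>lborel)"
    by (rule nn_integral_lborel_reflect) measurable
  have "(\<integral>\<^sup>+u. ennreal (\<bar>u\<bar> powr (-a)) * indicator {-c..c} u \<partial>lborel) \<le> (\<integral>\<^sup>+u. ?f u + ?f (0 - u) \<partial>lborel)"
    by (intro nn_integral_mono) (auto simp: indicator_def tpow_def)
  also have "\<dots> = (\<integral>\<^sup>+u. ?f u \<partial>lborel) + (\<integral>\<^sup>+u. ?f (0 - u) \<partial>lborel)"
    by (rule nn_integral_add) measurable
  finally show ?thesis using 1 2 by (auto intro: le_less_trans)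
qed

text \<open>The factor |z| + 1 of |z|^2 - 1 is at least 1, so along each ray only a power of order
  below one of the distance to the sphere has to be integrated. Both singularities met below are of
  this kind: a = 1 - s for the potential and a = s for the Poisson kernel.\<close>

lemma nn_integral_shell_finite:
  fixes a :: real
  assumes a: "0 < a" "a < 1"
  shows "(\<integral>\<^sup>+(z::'a::euclidean_space). ennreal (\<bar>(norm z)\<^sup>2 - 1\<bar> powr (-a)) * indicator {..<2} (norm z) \<partial>lborel) < top"
    (is "?L < top")
proof -
  let ?F = "\<lambda>z::'a. ennreal (\<bar>(norm z)\<^sup>2 - 1\<bar> powr (-a)) * indicator {..<2} (norm z)"
  let ?I = "indicator {1<..<2} :: real \<Rightarrow> ennreal" and ?J = "indicator {0<..} :: real \<Rightarrow> ennreal"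
  let ?n = "DIM('a)"
  let ?C = "\<integral>\<^sup>+u. ennreal (\<bar>u\<bar> powr (-a)) * indicator {-3..3} u \<partial>lborel"
  have inner: "(\<integral>\<^sup>+\<tau>. ?J \<tau> * (ennreal (\<tau> ^ ?n / \<tau>) * ?F (\<tau> *\<^sub>R \<theta>)) \<partial>lborel) \<le> ennreal (2 ^ ?n) * ?C"
    if t: "1 < norm \<theta>" "norm \<theta> < 2" for \<theta> :: 'a
  proof -
    let ?t = "norm \<theta>"
    have "(\<integral>\<^sup>+\<tau>. ?J \<tau> * (ennreal (\<tau> ^ ?n / \<tau>) * ?F (\<tau> *\<^sub>R \<theta>)) \<partial>lborel) \<le>
      (\<integral>\<^sup>+\<tau>. ennreal (2 ^ ?n) * (ennreal (\<bar>-1 + ?t * \<tau>\<bar> powr (-a)) * indicator {-3..3} (-1 + ?t * \<tau>)) \<partial>lborel)"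
    proof (rule nn_integral_mono)
      fix \<tau> :: real
      show "?J \<tau> * (ennreal (\<tau> ^ ?n / \<tau>) * ?F (\<tau> *\<^sub>R \<theta>)) \<le>
         ennreal (2 ^ ?n) * (ennreal (\<bar>-1 + ?t * \<tau>\<bar> powr (-a)) * indicator {-3..3} (-1 + ?t * \<tau>))"
      proof (cases "0 < \<tau> \<and> \<tau> * ?t < 2")
        case True
        have "\<tau> * 1 \<le> \<tau> * ?t" using True t by (intro mult_left_mono) auto
        then have t2: "\<tau> \<le> 2" using True by linarith
        have "\<tau> ^ ?n / \<tau> = \<tau> ^ (?n - 1)" using True by (simp add: power_diff Suc_leI DIM_positive)
        also have "\<dots> \<le> 2 ^ (?n - 1)" using True t2 by (intro power_mono) auto
        also have "\<dots> \<le> 2 ^ ?n" by (intro power_increasing) auto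
        finally have p: "\<tau> ^ ?n / \<tau> \<le> 2 ^ ?n" .
        have eq: "\<bar>(?t * \<tau>)\<^sup>2 - 1\<bar> = \<bar>-1 + ?t * \<tau>\<bar> * (?t * \<tau> + 1)"
        proof -
          have "(?t * \<tau>)\<^sup>2 - 1 = (-1 + ?t * \<tau>) * (?t * \<tau> + 1)" by (simp add: power2_eq_square algebra_simps)
          then show ?thesis using True by (simp only: abs_mult) simp
        qed
        have "\<bar>-1 + ?t * \<tau>\<bar> * 1 \<le> \<bar>-1 + ?t * \<tau>\<bar> * (?t * \<tau> + 1)"
          using True by (intro mult_left_mono) auto
        then have "\<bar>(?t * \<tau>)\<^sup>2 - 1\<bar> powr (-a) \<le> \<bar>-1 + ?t * \<tau>\<bar> powr (-a)"
          using a eq by (cases "-1 + ?t * \<tau> = 0") (auto intro!: powr_mono2')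
        then have "ennreal (\<tau> ^ ?n / \<tau>) * ennreal (\<bar>(?t * \<tau>)\<^sup>2 - 1\<bar> powr (-a)) \<le> ennreal (2 ^ ?n) * ennreal (\<bar>-1 + ?t * \<tau>\<bar> powr (-a))"
          using p by (intro mult_mono ennreal_leI) auto
        moreover have "0 < \<tau> * ?t" using True t by (intro mult_pos_pos) auto
        ultimately show ?thesis using True by (auto simp: indicator_def mult_ac)
      qed (auto simp: indicator_def)
    qed
    also have "\<dots> = ennreal (2 ^ ?n) * (\<integral>\<^sup>+\<tau>. (ennreal (\<bar>-1 + ?t * \<tau>\<bar> powr (-a)) * indicator {-3..3} (-1 + ?t * \<tau>)) \<partial>lborel)"
      by (rule nn_integral_cmult) measurable
    \<comment> \<open>The factor |\<theta>| \<ge> 1 is inserted as the Jacobian of u = -1 +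
      |\<theta>| \<tau>.\<close>
    also have "\<dots> \<le> ennreal (2 ^ ?n) * (ennreal ?t * (\<integral>\<^sup>+\<tau>. (ennreal (\<bar>-1 + ?t * \<tau>\<bar> powr (-a)) * indicator {-3..3} (-1 + ?t * \<tau>)) \<partial>lborel))"
    proof (rule mult_left_mono)
      have "1 \<le> ennreal ?t" using t by simp
      from mult_right_mono[OF this, of "\<integral>\<^sup>+\<tau>. (ennreal (\<bar>-1 + ?t * \<tau>\<bar> powr (-a)) * indicator {-3..3} (-1 + ?t * \<tau>)) \<partial>lborel"]
      show "(\<integral>\<^sup>+\<tau>. (ennreal (\<bar>-1 + ?t * \<tau>\<bar> powr (-a)) * indicator {-3..3} (-1 + ?t * \<tau>)) \<partial>lborel) \<le>
        ennreal ?t * (\<integral>\<^sup>+\<tau>. (ennreal (\<bar>-1 + ?t * \<tau>\<bar> powr (-a)) * indicator {-3..3} (-1 + ?t * \<tau>)) \<partial>lborel)"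
        by simp
    qed simp
    also have "ennreal ?t * (\<integral>\<^sup>+\<tau>. (ennreal (\<bar>-1 + ?t * \<tau>\<bar> powr (-a)) * indicator {-3..3} (-1 + ?t * \<tau>)) \<partial>lborel) = ?C"
      using t nn_integral_real_affine[of "\<lambda>u. ennreal (\<bar>u\<bar> powr (-a)) * indicator {-3..3} u" ?t "-1"] by (cases "\<theta> = 0") auto
    finally show ?thesis .
  qed
  show ?thesis
  proof (rule nn_integral_polar_finite)
    show "ennreal (2 ^ ?n) * ?C < top"
      using nn_integral_abs_powr_finite[OF a, of 3] by (simp add: ennreal_mult_less_top)
  qed (use inner in auto)
qed

text \<open>Completing the square about p / Q gives the half-width w = sqrt E / Q, and \<sigma> = p
  / Q + w u turns the power into a multiple of the truncated power of 1 - u^2. The weight \<sigma>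
  splits into p / Q and the odd part w u, which contributes nothing. Since \<kappa> > 0, real roots
  have the sign of p; for p \<le> 0 the quadratic is never positive on the positive
  half-line.\<close>

lemma nn_integral_line_exterior:
  fixes Q \<kappa> p a :: real
  assumes Q: "0 < Q" and \<kappa>: "0 < \<kappa>"
  shows "(\<integral>\<^sup>+\<sigma>. indicator {0<..} \<sigma> * ennreal (\<sigma> * tpow a (- Q * \<sigma>\<^sup>2 + 2 * p * \<sigma> - \<kappa>)) \<partial>lborel) =
    ennreal (Q powr (- (a + 2)) * max 0 p * tpow (a + 1/2) (p\<^sup>2 - Q * \<kappa>)) * (\<integral>\<^sup>+u. ennreal (tpow a (1 - u\<^sup>2)) \<partial>lborel)"
    (is "?L = ?R")
proof -
  define E where "E = p\<^sup>2 - Q * \<kappa>"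
  have sq: "- Q * \<sigma>\<^sup>2 + 2 * p * \<sigma> - \<kappa> = E / Q - Q * (\<sigma> - p / Q)\<^sup>2" for \<sigma>
    using Q by (simp add: E_def power2_eq_square field_simps)
  show ?thesis
  proof (cases "0 < p \<and> 0 < E")
    case False
    have "?L = (\<integral>\<^sup>+(\<sigma>::real). 0 \<partial>lborel)"
    proof (rule nn_integral_cong)
      fix \<sigma> :: real
      have "tpow a (- Q * \<sigma>\<^sup>2 + 2 * p * \<sigma> - \<kappa>) = 0" if "0 < \<sigma>"
      proof (rule tpow_neg)
        show "- Q * \<sigma>\<^sup>2 + 2 * p * \<sigma> - \<kappa> \<le> 0"
        proof (cases "0 < p")
          case True
          then have "E / Q \<le> 0" using False Q by (simp add: divide_le_0_iff)
          moreover have "0 \<le> Q * (\<sigma> - p / Q)\<^sup>2" using Q by simp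
          ultimately show ?thesis unfolding sq by linarith
        next
          case False
          then have "p * \<sigma> \<le> 0" using that by (simp add: mult_le_0_iff)
          moreover have "0 \<le> Q * \<sigma>\<^sup>2" using Q by simp
          ultimately show ?thesis using \<kappa> by (simp only: mult_minus_left)
        qed
      qed
      then show "indicator {0<..} \<sigma> * ennreal (\<sigma> * tpow a (- Q * \<sigma>\<^sup>2 + 2 * p * \<sigma> - \<kappa>)) = 0"
        by (auto simp: indicator_def)
    qed
    moreover have "max 0 p * tpow (a + 1/2) E = 0" using False by (auto simp: tpow_neg max_def)
    ultimately show ?thesis by (simp add: E_def[symmetric] mult.assoc)
  next
    case True
    define w where "w = sqrt E / Q"
    have w: "0 < w" using True Q by (simp add: w_def)
    have w2: "Q * w\<^sup>2 = E / Q" using True Q by (simp add: w_def power_divide power2_eq_square)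
    have "sqrt E < p" using True Q \<kappa> by (intro real_less_lsqrt) (auto simp: E_def)
    then have wp: "w < p / Q" using Q by (simp add: w_def divide_strict_right_mono)
    define g where "g u = tpow a (1 - u\<^sup>2)" for u
    have g0: "g u = 0" if "\<not> \<bar>u\<bar> < 1" for u
      unfolding g_def using that by (intro tpow_neg) (simp add: abs_square_less_1 flip: not_less)
    have [measurable]: "g \<in> borel_measurable borel" unfolding g_def by measurable
    have gp: "0 \<le> (p / Q + w * u) * g u" "0 \<le> (p / Q - w * u) * g u" for u
    proof -
      have "0 \<le> p / Q + w * u \<and> 0 \<le> p / Q - w * u" if "\<bar>u\<bar> < 1"
      proof -
        have "\<bar>w * u\<bar> \<le> w" using that w by (simp add: abs_mult mult_left_le)
        then show ?thesis using wp by linarith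
      qed
      then show "0 \<le> (p / Q + w * u) * g u" "0 \<le> (p / Q - w * u) * g u"
        using g0[of u] by (cases "\<bar>u\<bar> < 1"; simp add: g_def)+
    qed
    define X where "X = (\<integral>\<^sup>+u. ennreal ((p / Q + w * u) * g u) \<partial>lborel)"
    have X2: "(\<integral>\<^sup>+u. ennreal ((p / Q - w * u) * g u) \<partial>lborel) = X"
      unfolding X_def using nn_integral_lborel_reflect[of "\<lambda>u::real. ennreal ((p / Q + w * u) * g u)" 0]
      by (simp add: g_def)
    \<comment> \<open>The odd part is cancelled by adding the reflected copy: for general a the
      integral of the power of 1 - u^2 may be infinite, so the two parts cannot be separated by
      subtraction.\<close>
    have "X + X = (\<integral>\<^sup>+u. ennreal ((p / Q + w * u) * g u) + ennreal ((p / Q - w * u) * g u) \<partial>lborel)"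
      by (subst (2) X2[symmetric], subst X_def, subst nn_integral_add) auto
    also have "\<dots> = (\<integral>\<^sup>+u. ennreal (2 * (p / Q)) * ennreal (g u) \<partial>lborel)"
    proof (rule nn_integral_cong)
      fix u
      have "ennreal ((p / Q + w * u) * g u) + ennreal ((p / Q - w * u) * g u) = ennreal ((2 * (p/Q)) * g u)"
        using gp[of u] by (subst ennreal_plus[symmetric]) (auto simp: algebra_simps)
      also have "\<dots> = ennreal (2 * (p / Q)) * ennreal (g u)"
        using True Q by (intro ennreal_mult) (auto simp: g_def)
      finally show "ennreal ((p / Q + w * u) * g u) + ennreal ((p / Q - w * u) * g u) = ennreal (2 * (p / Q)) * ennreal (g u)" .
    qed
    also have "\<dots> = ennreal (2 * (p / Q)) * (\<integral>\<^sup>+u. ennreal (g u) \<partial>lborel)"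
      by (rule nn_integral_cmult) measurable
    also have "ennreal (2 * (p / Q)) = 2 * ennreal (p / Q)"
      using True Q ennreal_mult[of 2 "p / Q"] by simp
    finally have "2 * X = 2 * (ennreal (p / Q) * (\<integral>\<^sup>+u. ennreal (g u) \<partial>lborel))"
      by (simp add: mult_2 distrib_right)
    then have X: "X = ennreal (p / Q) * (\<integral>\<^sup>+u. ennreal (g u) \<partial>lborel)"
      by (simp add: ennreal_mult_cancel_left)
    have "?L = ennreal w * (\<integral>\<^sup>+u. indicator {0<..} (p / Q + w * u) *
        ennreal ((p / Q + w * u) * tpow a (- Q * (p / Q + w * u)\<^sup>2 + 2 * p * (p / Q + w * u) - \<kappa>)) \<partial>lborel)"
      using w by (subst nn_integral_real_affine[where c=w and t="p/Q"]) auto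
    also have "\<dots> = ennreal w * (\<integral>\<^sup>+u. ennreal ((E / Q) powr a) * ennreal ((p / Q + w * u) * g u) \<partial>lborel)"
    proof (rule arg_cong[where f="\<lambda>y. ennreal w * y"], rule nn_integral_cong)
      fix u :: real
      have "- Q * (p / Q + w * u)\<^sup>2 + 2 * p * (p / Q + w * u) - \<kappa> = (E / Q) * (1 - u\<^sup>2)"
      proof -
        have "Q * (p / Q + w * u - p / Q)\<^sup>2 = (Q * w\<^sup>2) * u\<^sup>2" by (simp add: power_mult_distrib)
        then show ?thesis unfolding sq w2 by (simp only: right_diff_distrib mult_1_right)
      qed
      then have "tpow a (- Q * (p / Q + w * u)\<^sup>2 + 2 * p * (p / Q + w * u) - \<kappa>) = (E / Q) powr a * g u"
        using True Q by (simp only: g_def) (rule tpow_cmult, simp)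
      moreover have "0 < p / Q + w * u" if "\<bar>u\<bar> < 1"
      proof -
        have "\<bar>w * u\<bar> \<le> w" using that w by (simp add: abs_mult mult_left_le)
        then show ?thesis using wp by linarith
      qed
      ultimately show "indicator {0<..} (p / Q + w * u) *
        ennreal ((p / Q + w * u) * tpow a (- Q * (p / Q + w * u)\<^sup>2 + 2 * p * (p / Q + w * u) - \<kappa>)) =
        ennreal ((E / Q) powr a) * ennreal ((p / Q + w * u) * g u)"
        using g0[of u] gp[of u]
        by (cases "\<bar>u\<bar> < 1") (simp_all only: ennreal_mult'[OF powr_ge_zero, symmetric]
             indicator_simps greaterThan_iff mult_1 mult_zero_right ennreal_0 mult.left_commute simp_thms)
    qed
    also have "\<dots> = ennreal w * (ennreal ((E / Q) powr a) * X)"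
      unfolding X_def by (subst nn_integral_cmult) auto
    also have "\<dots> = ennreal (w * (E / Q) powr a * (p / Q)) * (\<integral>\<^sup>+u. ennreal (g u) \<partial>lborel)"
    proof -
      have "ennreal (w * (E / Q) powr a * (p / Q)) = ennreal (w * (E / Q) powr a) * ennreal (p / Q)"
        using w True Q by (intro ennreal_mult) auto
      also have "ennreal (w * (E / Q) powr a) = ennreal w * ennreal ((E / Q) powr a)"
        using w by (intro ennreal_mult) auto
      finally show ?thesis unfolding X by (simp only: mult_ac)
    qed
    also have "w * (E / Q) powr a * (p / Q) = Q powr (- (a + 2)) * max 0 p * tpow (a + 1/2) E"
    proof -
      have "sqrt E = E powr (1/2)" using True by (simp add: powr_half_sqrt)
      then have "w * (E / Q) powr a * (p / Q) = p * (E powr (1/2) * E powr a) / (Q powr a * Q\<^sup>2)"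
        using True Q by (simp add: w_def powr_divide power2_eq_square field_simps)
      also have "E powr (1/2) * E powr a = E powr (a + 1/2)" by (simp add: powr_add[symmetric] add.commute)
      also have "Q powr a * Q\<^sup>2 = Q powr (a + 2)" using Q by (simp add: powr_add powr_numeral)
      also have "p * E powr (a + 1/2) / Q powr (a + 2) = Q powr (- (a + 2)) * p * E powr (a + 1/2)"
        unfolding powr_minus[of Q] by (simp only: divide_inverse mult_ac)
      finally show ?thesis using True by (simp only: tpow_pos max_absorb2 less_imp_le)
    qed
    finally show ?thesis by (simp add: E_def g_def)
  qed
qed

section \<open>Exterior potentials of radial powers\<close>

text \<open>For x outside the ball of radius r and a = s this is, up to a constant, minus the
  fractional Laplacian of the torsion function at x; a = s - 1 arises from it by differentiation in
  r. Values in \<open>ennreal\<close> let Tonelli be applied before finiteness is known.\<close>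

definition ext_pot :: "real \<Rightarrow> real \<Rightarrow> real \<Rightarrow> 'a::euclidean_space \<Rightarrow> ennreal" where
  "ext_pot a s r x = (\<integral>\<^sup>+z. ennreal (tpow a (r\<^sup>2 - (norm (x + z))\<^sup>2) * norm z powr - (real DIM('a) + 2 * s)) \<partial>lborel)"

lemma ext_pot_measurable [measurable]: "ext_pot a s r \<in> borel_measurable borel"
  unfolding ext_pot_def by measurable

text \<open>At the exponent s - 1 the powers of \<sigma> produced by polar weight, quadratic and
  kernel combine to \<sigma> itself, the weight for which the line integral is explicit. The factor
  \<open>max 0 (- (x \<bullet> \<theta>))\<close> keeps the rays that point from x back towards the
  side of the origin.\<close>

lemma ext_pot_polar:
  fixes x :: "'a::euclidean_space"
  assumes x: "1 < norm x" and s: "0 < s"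
  defines "Q \<equiv> (norm x)\<^sup>2 - 1"
  shows "ennreal (ln 2) * ext_pot (s - 1) s 1 x =
    ennreal (Q powr (- 1 - s)) * (\<integral>\<^sup>+u. ennreal (tpow (s - 1) (1 - u\<^sup>2)) \<partial>lborel) *
    (\<integral>\<^sup>+(\<theta>::'a). indicator {1<..<2} (norm \<theta>) * ennreal (norm \<theta> powr - (real DIM('a) + 2 * s)) *
        ennreal (max 0 (- (x \<bullet> \<theta>)) * tpow (s - 1/2) ((x \<bullet> \<theta>)\<^sup>2 - Q * (norm \<theta>)\<^sup>2)) \<partial>lborel)"
proof -
  let ?n = "DIM('a)" and ?B = "\<integral>\<^sup>+u. ennreal (tpow (s - 1) (1 - u\<^sup>2)) \<partial>lborel"
  let ?I = "indicator {1<..<2} :: real \<Rightarrow> ennreal" and ?J = "indicator {0<..} :: real \<Rightarrow> ennreal"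
  have Q: "0 < Q" using x unfolding Q_def by (simp add: one_less_power)
  let ?F = "\<lambda>z::'a. ennreal (tpow (s - 1) (1\<^sup>2 - (norm (x + z))\<^sup>2) * norm z powr - (real ?n + 2 * s))"
  have inner: "(\<integral>\<^sup>+\<sigma>. ?J \<sigma> * (ennreal ((1 / \<sigma>) ^ ?n / \<sigma>) * ?F ((1 / \<sigma>) *\<^sub>R \<theta>)) \<partial>lborel) =
    ennreal (norm \<theta> powr - (real ?n + 2 * s)) *
      (ennreal (Q powr (- 1 - s) * max 0 (- (x \<bullet> \<theta>)) * tpow (s - 1/2) ((x \<bullet> \<theta>)\<^sup>2 - Q * (norm \<theta>)\<^sup>2)) * ?B)"
    if t: "1 < norm \<theta>" for \<theta> :: 'a
  proof -
    let ?p = "- (x \<bullet> \<theta>)" and ?\<kappa> = "(norm \<theta>)\<^sup>2"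
    have "(\<integral>\<^sup>+\<sigma>. ?J \<sigma> * (ennreal ((1 / \<sigma>) ^ ?n / \<sigma>) * ?F ((1 / \<sigma>) *\<^sub>R \<theta>)) \<partial>lborel) =
      (\<integral>\<^sup>+\<sigma>. ennreal (norm \<theta> powr - (real ?n + 2 * s)) *
        (?J \<sigma> * ennreal (\<sigma> * tpow (s - 1) (- Q * \<sigma>\<^sup>2 + 2 * ?p * \<sigma> - ?\<kappa>))) \<partial>lborel)"
    proof (rule nn_integral_cong)
      fix \<sigma> :: real
      show "?J \<sigma> * (ennreal ((1 / \<sigma>) ^ ?n / \<sigma>) * ?F ((1 / \<sigma>) *\<^sub>R \<theta>)) = ennreal (norm \<theta> powr - (real ?n + 2 * s)) *
        (?J \<sigma> * ennreal (\<sigma> * tpow (s - 1) (- Q * \<sigma>\<^sup>2 + 2 * ?p * \<sigma> - ?\<kappa>)))"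
      proof (cases "0 < \<sigma>")
        case True
        have nn: "(norm (x + (1 / \<sigma>) *\<^sub>R \<theta>))\<^sup>2 = (norm x)\<^sup>2 + 2 * (x \<bullet> \<theta>) / \<sigma> + ?\<kappa> / \<sigma>\<^sup>2"
          unfolding power2_norm_eq_inner using True
          by (simp add: inner_add_left inner_add_right inner_commute power2_eq_square field_simps)
        define Y where "Y = - Q * \<sigma>\<^sup>2 + 2 * ?p * \<sigma> - ?\<kappa>"
        have eq: "1\<^sup>2 - (norm (x + (1 / \<sigma>) *\<^sub>R \<theta>))\<^sup>2 = (1 / \<sigma>\<^sup>2) * Y"
          unfolding nn Q_def Y_def using True by (simp add: field_simps power2_eq_square)
        have t1: "tpow (s - 1) (1\<^sup>2 - (norm (x + (1 / \<sigma>) *\<^sub>R \<theta>))\<^sup>2) = (1 / \<sigma>\<^sup>2) powr (s - 1) * tpow (s - 1) Y"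
          unfolding eq by (rule tpow_cmult) (use True in simp)
        \<comment> \<open>Exponents of \<sigma>: - n - 1 from the polar weight, - 2 (s - 1) from the
          quadratic, n + 2 s from the kernel; their sum is 1.\<close>
        have "(1 / \<sigma>) ^ ?n / \<sigma> * (1 / \<sigma>\<^sup>2) powr (s - 1) * (1 / \<sigma>) powr - (real ?n + 2 * s) = \<sigma>"
        proof -
          have a: "(1 / \<sigma>) ^ ?n / \<sigma> = \<sigma> powr (- real ?n - 1)"
            using True by (simp add: powr_diff powr_minus powr_realpow power_one_over field_simps)
          have b: "(1 / \<sigma>\<^sup>2) powr (s - 1) = \<sigma> powr (- 2 * (s - 1))"
          proof -
            have "1 / \<sigma>\<^sup>2 = \<sigma> powr (-2)" using True by (simp add: powr_minus powr_numeral divide_inverse)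
            then show ?thesis by (simp add: powr_powr)
          qed
          have c: "(1 / \<sigma>) powr - (real ?n + 2 * s) = \<sigma> powr (real ?n + 2 * s)"
          proof -
            have "1 / \<sigma> = \<sigma> powr (-1)" using True by (simp add: powr_minus divide_inverse)
            then show ?thesis by (simp only: powr_powr) (simp add: add.commute)
          qed
          have "(- real ?n - 1) + (- 2 * (s - 1)) + (real ?n + 2 * s) = 1" by simp
          then show ?thesis unfolding a b c powr_add[symmetric] using True by simp
        qed
        then have "(norm \<theta> powr - (real ?n + 2 * s) * tpow (s - 1) Y) * ((1 / \<sigma>) ^ ?n / \<sigma> * (1 / \<sigma>\<^sup>2) powr (s - 1) * (1 / \<sigma>) powr - (real ?n + 2 * s)) =
          (norm \<theta> powr - (real ?n + 2 * s) * tpow (s - 1) Y) * \<sigma>" by (simp only:)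
        moreover have "norm ((1 / \<sigma>) *\<^sub>R \<theta>) powr - (real ?n + 2 * s) = (1 / \<sigma>) powr - (real ?n + 2 * s) * norm \<theta> powr - (real ?n + 2 * s)"
          using True by (simp add: powr_mult[symmetric])
        ultimately have "(1 / \<sigma>) ^ ?n / \<sigma> * (tpow (s - 1) (1\<^sup>2 - (norm (x + (1 / \<sigma>) *\<^sub>R \<theta>))\<^sup>2) * norm ((1 / \<sigma>) *\<^sub>R \<theta>) powr - (real ?n + 2 * s)) =
          norm \<theta> powr - (real ?n + 2 * s) * (\<sigma> * tpow (s - 1) Y)"
          unfolding t1 by (simp only: mult_ac)
        then have "ennreal ((1 / \<sigma>) ^ ?n / \<sigma>) * ?F ((1 / \<sigma>) *\<^sub>R \<theta>) = ennreal (norm \<theta> powr - (real ?n + 2 * s)) * ennreal (\<sigma> * tpow (s - 1) Y)"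
          using True by (subst (1 2) ennreal_mult'[symmetric]) auto
        then show ?thesis using True unfolding Y_def by simp
      qed simp
    qed
    also have "\<dots> = ennreal (norm \<theta> powr - (real ?n + 2 * s)) *
        (\<integral>\<^sup>+\<sigma>. (?J \<sigma> * ennreal (\<sigma> * tpow (s - 1) (- Q * \<sigma>\<^sup>2 + 2 * ?p * \<sigma> - ?\<kappa>))) \<partial>lborel)"
      by (rule nn_integral_cmult) measurable
    also have "(\<integral>\<^sup>+\<sigma>. (?J \<sigma> * ennreal (\<sigma> * tpow (s - 1) (- Q * \<sigma>\<^sup>2 + 2 * ?p * \<sigma> - ?\<kappa>))) \<partial>lborel) =
      ennreal (Q powr (- (s - 1 + 2)) * max 0 ?p * tpow (s - 1 + 1/2) (?p\<^sup>2 - Q * ?\<kappa>)) * ?B"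
      using t by (intro nn_integral_line_exterior Q) auto
    also have "- (s - 1 + 2) = - 1 - s" by simp
    also have "s - 1 + 1/2 = s - 1/2" by simp
    finally show ?thesis by simp
  qed
  have "ennreal (ln 2) * ext_pot (s - 1) s 1 x = (\<integral>\<^sup>+\<theta>. ?I (norm \<theta>) *
      (\<integral>\<^sup>+\<sigma>. ?J \<sigma> * (ennreal ((1 / \<sigma>) ^ ?n / \<sigma>) * ?F ((1 / \<sigma>) *\<^sub>R \<theta>)) \<partial>lborel) \<partial>lborel)"
    unfolding ext_pot_def by (rule nn_integral_polar_inverse) measurable
  also have "\<dots> = (\<integral>\<^sup>+(\<theta>::'a). (ennreal (Q powr (- 1 - s)) * ?B) * (?I (norm \<theta>) * ennreal (norm \<theta> powr - (real ?n + 2 * s)) *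
      ennreal (max 0 (- (x \<bullet> \<theta>)) * tpow (s - 1/2) ((x \<bullet> \<theta>)\<^sup>2 - Q * (norm \<theta>)\<^sup>2))) \<partial>lborel)"
  proof (rule nn_integral_cong)
    fix \<theta> :: 'a
    let ?T = "max 0 (- (x \<bullet> \<theta>)) * tpow (s - 1/2) ((x \<bullet> \<theta>)\<^sup>2 - Q * (norm \<theta>)\<^sup>2)"
    have m: "ennreal (Q powr (- 1 - s) * max 0 (- (x \<bullet> \<theta>)) * tpow (s - 1/2) ((x \<bullet> \<theta>)\<^sup>2 - Q * (norm \<theta>)\<^sup>2)) =
       ennreal (Q powr (- 1 - s)) * ennreal ?T"
      by (subst ennreal_mult[symmetric]) (auto simp: mult.assoc)
    show "?I (norm \<theta>) * (\<integral>\<^sup>+\<sigma>. ?J \<sigma> * (ennreal ((1 / \<sigma>) ^ ?n / \<sigma>) * ?F ((1 / \<sigma>) *\<^sub>R \<theta>)) \<partial>lborel) =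
      (ennreal (Q powr (- 1 - s)) * ?B) * (?I (norm \<theta>) * ennreal (norm \<theta> powr - (real ?n + 2 * s)) * ennreal ?T)"
    proof (cases "1 < norm \<theta>")
      case True
      show ?thesis unfolding inner[OF True] m by (simp only: mult_ac)
    next
      case False
      then have "?I (norm \<theta>) = 0" by (auto simp: indicator_def)
      then show ?thesis by (simp only: mult_zero_left mult_zero_right)
    qed
  qed
  also have "\<dots> = (ennreal (Q powr (- 1 - s)) * ?B) * (\<integral>\<^sup>+(\<theta>::'a). (?I (norm \<theta>) * ennreal (norm \<theta> powr - (real ?n + 2 * s)) *
      ennreal (max 0 (- (x \<bullet> \<theta>)) * tpow (s - 1/2) ((x \<bullet> \<theta>)\<^sup>2 - Q * (norm \<theta>)\<^sup>2))) \<partial>lborel)"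
    by (rule nn_integral_cmult) measurable
  finally show ?thesis .
qed

section \<open>Angular integrals, by slicing along the direction of x\<close>

lemma nn_integral_half_square:
  fixes f :: "real \<Rightarrow> real" and b :: real
  assumes [measurable]: "f \<in> borel_measurable borel" and f0: "\<And>y. 0 \<le> f y"
    and supp: "\<And>y. y \<le> b \<or> 4 \<le> y \<Longrightarrow> f y = 0" and b: "0 \<le> b"
  shows "2 * (\<integral>\<^sup>+t. ennreal (max 0 t * f (b + t\<^sup>2)) \<partial>lborel) = (\<integral>\<^sup>+y. ennreal (f y) \<partial>lborel)"
proof -
  \<comment> \<open>The upper limit t = 2 suffices: f vanishes from 4 on, the square of the outer
    radius of the shell, and b \<ge> 0.\<close>
  let ?g = "\<lambda>t::real. b + t\<^sup>2"
  have "(\<integral>\<^sup>+y. ennreal (f y) \<partial>lborel) = (\<integral>\<^sup>+y. f y * indicator {?g 0..?g 2} y \<partial>lborel)"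
    using supp b by (intro nn_integral_cong) (auto simp: indicator_def)
  also have "\<dots> = (\<integral>\<^sup>+t. f (?g t) * (2 * t) * indicator {0..2} t \<partial>lborel)"
    by (rule nn_integral_substitution) (auto intro!: derivative_eq_intros continuous_intros simp: set_borel_measurable_def)
  also have "\<dots> = (\<integral>\<^sup>+t. 2 * ennreal (max 0 t * f (?g t)) \<partial>lborel)"
  proof (rule nn_integral_cong)
    fix t :: real
    have "4 \<le> ?g t" if "2 < t" using that b power_mono[of 2 t 2] by simp
    then have z: "f (?g t) = 0" if "2 < t" using that supp by blast
    have "ennreal (2 * (max 0 t * f (?g t))) = 2 * ennreal (max 0 t * f (?g t))"
      using f0 by (subst ennreal_mult) auto
    moreover have "f (?g t) * (2 * t) * indicator {0..2} t = 2 * (max 0 t * f (?g t))"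
      using z by (cases "t < 0"; cases "2 < t") (auto simp: indicator_def max_def)
    ultimately show "ennreal (f (?g t) * (2 * t) * indicator {0..2} t) = 2 * ennreal (max 0 t * f (?g t))" by (simp only:)
  qed
  also have "\<dots> = 2 * (\<integral>\<^sup>+t. ennreal (max 0 t * f (?g t)) \<partial>lborel)"
    by (rule nn_integral_cmult) measurable
  finally show ?thesis by simp
qed

text \<open>Only the n - 1 directions orthogonal to e are scaled, hence the exponent 1 - n. A
  dilation of the whole space gives \<rho>^(-n) and changes the thickness of the slab from 1 to
  \<rho>; slicing shows that this thickness is a plain factor.\<close>

lemma nn_integral_slice_scale:
  fixes N :: "real \<Rightarrow> ennreal" and e :: "'a::euclidean_space"
  assumes [measurable]: "N \<in> borel_measurable borel" and e: "norm e = 1" and \<rho>: "0 < \<rho>"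
  shows "(\<integral>\<^sup>+(x::'a). indicator {0..1} (x \<bullet> e) * N (\<rho> * norm (x - (x \<bullet> e) *\<^sub>R e)) \<partial>lborel) =
    ennreal (\<rho> powr (1 - real DIM('a))) * (\<integral>\<^sup>+(x::'a). indicator {0..1} (x \<bullet> e) * N (norm (x - (x \<bullet> e) *\<^sub>R e)) \<partial>lborel)"
proof -
  let ?n = "DIM('a)" and ?g = "indicator {0..1} :: real \<Rightarrow> ennreal" and ?P = "\<lambda>x. norm (x - (x \<bullet> e) *\<^sub>R e)"
  let ?K = "\<integral>\<^sup>+(x::'a). ?g (x \<bullet> e) * N (?P x) \<partial>lborel"
  have ee: "e \<bullet> e = 1" using e by (simp add: dot_square_norm)
  have G: "(\<integral>\<^sup>+t. ?g t \<partial>lborel) = 1" by (simp add: nn_integral_indicator)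
  have G2: "(\<integral>\<^sup>+t. ?g (t / \<rho>) \<partial>lborel) = ennreal \<rho>"
    using \<rho> by (subst nn_integral_real_affine[where c=\<rho> and t=0]) (auto simp: G)
  have shift: "?P (x - (x \<bullet> e) *\<^sub>R e + t *\<^sub>R e) = ?P x" "(x - (x \<bullet> e) *\<^sub>R e + t *\<^sub>R e) \<bullet> e = t" for x t
    using ee by (simp_all add: inner_add_left inner_diff_left)
  have "(\<integral>\<^sup>+(x::'a). ?g (x \<bullet> e / \<rho>) * N (?P x) \<partial>lborel) =
     (\<integral>\<^sup>+(x::'a). ?g (x \<bullet> e) * (\<integral>\<^sup>+t. ?g (t / \<rho>) * N (?P x) \<partial>lborel) \<partial>lborel)"
    using nn_integral_slice[of "\<lambda>x. ?g (x \<bullet> e / \<rho>) * N (?P x)" ?g e] e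
    unfolding shift G by simp
  also have "\<dots> = (\<integral>\<^sup>+(x::'a). ennreal \<rho> * (?g (x \<bullet> e) * N (?P x)) \<partial>lborel)"
    by (intro nn_integral_cong) (simp add: nn_integral_multc G2 mult_ac)
  also have "\<dots> = ennreal \<rho> * ?K" by (rule nn_integral_cmult) measurable
  finally have 1: "(\<integral>\<^sup>+(x::'a). ?g (x \<bullet> e / \<rho>) * N (?P x) \<partial>lborel) = ennreal \<rho> * ?K" .
  have scale: "\<rho> * ?P (0 + (1 / \<rho>) *\<^sub>R x) = ?P x" for x :: 'a
  proof -
    have "0 + (1 / \<rho>) *\<^sub>R x - ((0 + (1 / \<rho>) *\<^sub>R x) \<bullet> e) *\<^sub>R e = (1 / \<rho>) *\<^sub>R (x - (x \<bullet> e) *\<^sub>R e)"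
      by (simp add: algebra_simps)
    then show ?thesis using \<rho> by simp
  qed
  have "(\<integral>\<^sup>+(x::'a). ?g (x \<bullet> e) * N (\<rho> * ?P x) \<partial>lborel) =
    ennreal (\<bar>1 / \<rho>\<bar> ^ ?n) * (\<integral>\<^sup>+(x::'a). ?g ((0 + (1 / \<rho>) *\<^sub>R x) \<bullet> e) * N (\<rho> * ?P (0 + (1 / \<rho>) *\<^sub>R x)) \<partial>lborel)"
    by (rule nn_integral_lborel_affine) (use \<rho> in auto)
  also have "\<dots> = ennreal (\<bar>1 / \<rho>\<bar> ^ ?n) * (\<integral>\<^sup>+(x::'a). ?g (x \<bullet> e / \<rho>) * N (?P x) \<partial>lborel)"
    unfolding scale by simp
  finally have "(\<integral>\<^sup>+(x::'a). ?g (x \<bullet> e) * N (\<rho> * ?P x) \<partial>lborel) = ennreal (\<bar>1 / \<rho>\<bar> ^ ?n) * (ennreal \<rho> * ?K)"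
    unfolding 1 .
  moreover have "ennreal (\<bar>1 / \<rho>\<bar> ^ ?n) * ennreal \<rho> = ennreal (\<rho> powr (1 - real ?n))"
    using \<rho> by (subst ennreal_mult[symmetric]) (auto simp: powr_diff powr_realpow power_one_over divide_inverse power_inverse mult.commute)
  ultimately show ?thesis by (simp add: mult.assoc[symmetric])
qed

text \<open>The integrand only involves \<open>norm \<theta>\<close> and \<open>x \<bullet> \<theta>\<close>. Along each line parallel to \<open>x\<close> the substitution
  \<open>y = (norm \<theta>)\<^sup>2\<close> leaves \<open>x\<close> only through \<open>norm x\<close> times the distance of the line from the origin.\<close>

lemma nn_integral_angular:
  fixes e0 :: "'a::euclidean_space" and s :: real
  assumes e0: "norm e0 = 1"
  shows "\<exists>K. \<forall>x::'a. 1 < norm x \<longrightarrow>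
    (\<integral>\<^sup>+(\<theta>::'a). indicator {1<..<2} (norm \<theta>) * ennreal (norm \<theta> powr - (real DIM('a) + 2 * s)) *
        ennreal (max 0 (- (x \<bullet> \<theta>)) * tpow (s - 1/2) ((x \<bullet> \<theta>)\<^sup>2 - ((norm x)\<^sup>2 - 1) * (norm \<theta>)\<^sup>2)) \<partial>lborel) =
    ennreal (norm x powr (2 - real DIM('a))) * K"
proof -
  let ?n = "DIM('a)" and ?g = "indicator {0..1} :: real \<Rightarrow> ennreal"
  define \<omega> where "\<omega> t = indicator {1<..<2} t * t powr - (real ?n + 2 * s)" for t :: real
  have [measurable]: "\<omega> \<in> borel_measurable borel" unfolding \<omega>_def by measurable
  have \<omega>0: "0 \<le> \<omega> t" for t by (simp add: \<omega>_def)
  have \<omega>z: "\<omega> t = 0" if "\<not> (1 < t \<and> t < 2)" for t using that by (auto simp: \<omega>_def)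
  define h where "h b y = \<omega> (sqrt y) * tpow (s - 1/2) (y - b\<^sup>2)" for b y :: real
  define N where "N b = (\<integral>\<^sup>+y. ennreal (h b y) \<partial>lborel)" for b
  have [measurable]: "N \<in> borel_measurable borel" unfolding N_def h_def by measurable
  \<comment> \<open>The transversal integral for the direction e. Its integrand depends only on the
    norm and the height along e, so reflection invariance makes it the same for all unit vectors, in
    particular for the direction of any x.\<close>
  define KK where "KK e = (\<integral>\<^sup>+(x::'a). ?g (x \<bullet> e) * N (norm (x - (x \<bullet> e) *\<^sub>R e)) \<partial>lborel)" for e :: 'a
  have KK: "KK e = KK e0" if e: "norm e = 1" for e
  proof -
    have *: "norm (x - (x \<bullet> e) *\<^sub>R e) = sqrt ((norm x)\<^sup>2 - (x \<bullet> e)\<^sup>2)" if e: "norm e = 1" for e x :: 'a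
    proof -
      have "(norm (x - (x \<bullet> e) *\<^sub>R e))\<^sup>2 = (norm x)\<^sup>2 - (x \<bullet> e)\<^sup>2"
        using norm_eq_1[of e] e unfolding power2_norm_eq_inner
        by (simp add: inner_diff_left inner_diff_right inner_commute power2_eq_square)
      then show ?thesis by (metis norm_ge_zero real_sqrt_unique)
    qed
    show ?thesis unfolding KK_def *[OF e] *[OF e0]
      by (rule nn_integral_reflection_invariant[of "\<lambda>r t. ?g t * N (sqrt (r\<^sup>2 - t\<^sup>2))"]) (use e e0 in \<open>measurable; simp\<close>)+
  qed
  have main: "(\<integral>\<^sup>+(\<theta>::'a). indicator {1<..<2} (norm \<theta>) * ennreal (norm \<theta> powr - (real ?n + 2 * s)) *
        ennreal (max 0 (- (x \<bullet> \<theta>)) * tpow (s - 1/2) ((x \<bullet> \<theta>)\<^sup>2 - ((norm x)\<^sup>2 - 1) * (norm \<theta>)\<^sup>2)) \<partial>lborel) =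
    ennreal (norm x powr (2 - real ?n)) * (ennreal (1/2) * KK e0)" (is "?V = _") if x: "1 < norm x" for x :: 'a
  proof -
    let ?\<rho> = "norm x"
    define e where "e = - x /\<^sub>R ?\<rho>"
    have x0: "x \<noteq> 0" using x by auto
    then have e: "norm e = 1" unfolding e_def by simp
    have ee: "e \<bullet> e = 1" using e by (simp add: dot_square_norm)
    have xe: "x = - ?\<rho> *\<^sub>R e" using x0 by (simp add: e_def)
    have xt: "x \<bullet> \<theta> = - ?\<rho> * (\<theta> \<bullet> e)" for \<theta> by (subst xe) (simp add: inner_commute)
    define F where "F \<theta> = \<omega> (norm \<theta>) * (max 0 (?\<rho> * (\<theta> \<bullet> e)) * tpow (s - 1/2) ((?\<rho> * (\<theta> \<bullet> e))\<^sup>2 - (?\<rho>\<^sup>2 - 1) * (norm \<theta>)\<^sup>2))" for \<theta> :: 'a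
    have [measurable]: "F \<in> borel_measurable borel" unfolding F_def by measurable
    have "?V = (\<integral>\<^sup>+\<theta>. ennreal (F \<theta>) \<partial>lborel)"
      unfolding xt F_def \<omega>_def
      by (intro nn_integral_cong) (auto simp: indicator_def ennreal_mult')
    also have "\<dots> = (\<integral>\<^sup>+(\<theta>::'a). ?g (\<theta> \<bullet> e) * (\<integral>\<^sup>+t. ennreal (F (\<theta> - (\<theta> \<bullet> e) *\<^sub>R e + t *\<^sub>R e)) \<partial>lborel) \<partial>lborel)"
      using nn_integral_slice[of "\<lambda>\<theta>. ennreal (F \<theta>)" ?g e] e by (simp add: nn_integral_indicator)
    also have "\<dots> = (\<integral>\<^sup>+(\<theta>::'a). ennreal (?\<rho> / 2) * (?g (\<theta> \<bullet> e) * N (?\<rho> * norm (\<theta> - (\<theta> \<bullet> e) *\<^sub>R e))) \<partial>lborel)"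
    proof (rule nn_integral_cong)
      fix \<theta> :: 'a
      let ?p = "\<theta> - (\<theta> \<bullet> e) *\<^sub>R e"
      let ?b = "(norm ?p)\<^sup>2"
      have pe: "?p \<bullet> e = 0" using ee by (simp add: inner_diff_left)
      have nn: "(norm (?p + t *\<^sub>R e))\<^sup>2 = ?b + t\<^sup>2" for t
      proof -
        have "(norm (?p + t *\<^sub>R e))\<^sup>2 = ?p \<bullet> ?p + 2 * t * (?p \<bullet> e) + t * t * (e \<bullet> e)"
          unfolding power2_norm_eq_inner by (simp only: inner_add_left inner_add_right inner_scaleR_left inner_scaleR_right inner_commute[of e ?p]) (simp add: algebra_simps)
        then show ?thesis using pe ee by (simp add: power2_norm_eq_inner power2_eq_square[of t])
      qed
      then have n: "norm (?p + t *\<^sub>R e) = sqrt (?b + t\<^sup>2)" for t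
        by (metis norm_ge_zero real_sqrt_unique)
      have te: "(?p + t *\<^sub>R e) \<bullet> e = t" for t using pe ee by (simp add: inner_add_left)
      have Ft: "F (?p + t *\<^sub>R e) = ?\<rho> * (max 0 t * h (?\<rho> * norm ?p) (?b + t\<^sup>2))" for t
      proof -
        \<comment> \<open>The terms \<rho>^2 t^2 cancel. What remains is the squared norm of the
          point on the line minus the square of \<rho> times the distance of the line from the
          origin.\<close>
        have "(?\<rho> * t)\<^sup>2 - (?\<rho>\<^sup>2 - 1) * (?b + t\<^sup>2) = ?b + t\<^sup>2 - (?\<rho> * norm ?p)\<^sup>2"
          by (simp add: power_mult_distrib algebra_simps)
        moreover have "max 0 (?\<rho> * t) = ?\<rho> * max 0 t" using x by (auto simp: max_def mult_le_0_iff zero_le_mult_iff)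
        ultimately show ?thesis unfolding F_def te nn n h_def by (simp add: mult_ac)
      qed
      \<comment> \<open>As \<rho> > 1, the function h vanishes up to the square of \<rho> times the
        distance, which is at least ?b. So the substitution may start at ?b.\<close>
      have supp: "h (?\<rho> * norm ?p) y = 0" if "y \<le> ?b \<or> 4 \<le> y" for y
      proof (cases "4 \<le> y")
        case True
        then have "2 \<le> sqrt y" by (intro real_le_rsqrt) simp
        then show ?thesis by (simp add: h_def \<omega>z)
      next
        case False
        have "1 * norm ?p \<le> ?\<rho> * norm ?p" using x by (intro mult_right_mono) auto
        then have "?b \<le> (?\<rho> * norm ?p)\<^sup>2" by (intro power_mono) auto
        then have "y - (?\<rho> * norm ?p)\<^sup>2 \<le> 0" using that False by linarith
        then show ?thesis unfolding h_def by (simp only: tpow_neg mult_zero_right)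
      qed
      have [measurable]: "h c \<in> borel_measurable borel" for c unfolding h_def by measurable
      have "2 * (\<integral>\<^sup>+t. ennreal (max 0 t * h (?\<rho> * norm ?p) (?b + t\<^sup>2)) \<partial>lborel) = N (?\<rho> * norm ?p)"
        unfolding N_def by (rule nn_integral_half_square) (use supp in \<open>auto simp: h_def \<omega>0\<close>)
      then have "ennreal (?\<rho> / 2) * N (?\<rho> * norm ?p) = ennreal (?\<rho> / 2) * 2 * (\<integral>\<^sup>+t. ennreal (max 0 t * h (?\<rho> * norm ?p) (?b + t\<^sup>2)) \<partial>lborel)"
        by (simp only: mult.assoc)
      also have "ennreal (?\<rho> / 2) * 2 = ennreal ?\<rho>"
        using ennreal_mult[of "?\<rho> / 2" 2] by simp
      also have "ennreal ?\<rho> * (\<integral>\<^sup>+t. ennreal (max 0 t * h (?\<rho> * norm ?p) (?b + t\<^sup>2)) \<partial>lborel) =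
         (\<integral>\<^sup>+t. ennreal ?\<rho> * ennreal (max 0 t * h (?\<rho> * norm ?p) (?b + t\<^sup>2)) \<partial>lborel)"
        by (rule nn_integral_cmult[symmetric]) measurable
      also have "\<dots> = (\<integral>\<^sup>+t. ennreal (F (?p + t *\<^sub>R e)) \<partial>lborel)"
        unfolding Ft by (intro nn_integral_cong) (simp add: ennreal_mult')
      finally show "?g (\<theta> \<bullet> e) * (\<integral>\<^sup>+t. ennreal (F (?p + t *\<^sub>R e)) \<partial>lborel) =
        ennreal (?\<rho> / 2) * (?g (\<theta> \<bullet> e) * N (?\<rho> * norm ?p))"
        by (metis mult.left_commute)
    qed
    also have "\<dots> = ennreal (?\<rho> / 2) * (\<integral>\<^sup>+(\<theta>::'a). (?g (\<theta> \<bullet> e) * N (?\<rho> * norm (\<theta> - (\<theta> \<bullet> e) *\<^sub>R e))) \<partial>lborel)"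
      by (rule nn_integral_cmult) measurable
    also have "(\<integral>\<^sup>+(\<theta>::'a). (?g (\<theta> \<bullet> e) * N (?\<rho> * norm (\<theta> - (\<theta> \<bullet> e) *\<^sub>R e))) \<partial>lborel) =
      ennreal (?\<rho> powr (1 - real ?n)) * KK e"
      unfolding KK_def by (rule nn_integral_slice_scale) (use e x0 in auto)
    also have "ennreal (?\<rho> / 2) * (ennreal (?\<rho> powr (1 - real ?n)) * KK e) =
       (ennreal (?\<rho> / 2) * ennreal (?\<rho> powr (1 - real ?n))) * KK e" by (simp only: mult.assoc)
    also have "ennreal (?\<rho> / 2) * ennreal (?\<rho> powr (1 - real ?n)) = ennreal (?\<rho> powr (2 - real ?n)) * ennreal (1/2)"
    proof -
      have "?\<rho> powr (2 - real ?n) = ?\<rho> * ?\<rho> powr (1 - real ?n)"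
        using powr_add[of ?\<rho> 1 "1 - real ?n"] x0 by simp
      then have "?\<rho> / 2 * ?\<rho> powr (1 - real ?n) = ?\<rho> powr (2 - real ?n) * (1/2)" by simp
      then show ?thesis by (metis ennreal_mult powr_ge_zero norm_ge_zero divide_nonneg_pos zero_less_numeral zero_le_one zero_le_divide_iff zero_le_numeral)
    qed
    finally show ?thesis unfolding KK[OF e] by (simp only: mult.assoc)
  qed
  then show ?thesis by blast
qed

lemma ext_pot_shift:
  fixes x :: "'a::euclidean_space"
  shows "ext_pot a s r x = (\<integral>\<^sup>+(y::'a). ennreal (tpow a (r\<^sup>2 - (norm y)\<^sup>2) * norm (y - x) powr - (real DIM('a) + 2 * s)) \<partial>lborel)"
  unfolding ext_pot_def
  using nn_integral_lborel_translate[of "\<lambda>y. ennreal (tpow a (r\<^sup>2 - (norm y)\<^sup>2) * norm (y - x) powr - (real DIM('a) + 2 * s))" x]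
  by simp

lemma not_AE_notin_ball: "0 < r \<Longrightarrow> \<not> (AE x::'a::euclidean_space in lborel. x \<notin> ball c r)"
proof
  assume r: "0 < r" and "AE x::'a in lborel. x \<notin> ball c r"
  then have "ball c r \<in> null_sets lborel" by (subst AE_iff_null_sets) auto
  then have "measure lborel (ball c r) = 0" by (simp add: null_sets_def measure_def)
  then show False using content_ball_pos[OF r, of c] by simp
qed

text \<open>The angular factor K is known only as an extended nonnegative number that does not
  depend on x. One evaluation of the potential, at a point of norm 2, shows it positive and finite
  there; this excludes 0 and infinity and produces c.\<close>

lemma ext_pot_unit:
  assumes s: "0 < s" "s < 1"
  shows "\<exists>c>0. \<forall>x::'a::euclidean_space. 1 < norm x \<longrightarrow>
    ext_pot (s - 1) s 1 x = ennreal (c * (norm x powr (2 - real DIM('a)) * ((norm x)\<^sup>2 - 1) powr (- 1 - s)))"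
proof -
  let ?n = "DIM('a)"
  obtain e0 :: 'a where "e0 \<in> Basis" using nonempty_Basis by blast
  then have e0: "norm e0 = 1" by simp
  obtain K where K: "\<And>x::'a. 1 < norm x \<Longrightarrow>
    (\<integral>\<^sup>+(\<theta>::'a). indicator {1<..<2} (norm \<theta>) * ennreal (norm \<theta> powr - (real DIM('a) + 2 * s)) *
        ennreal (max 0 (- (x \<bullet> \<theta>)) * tpow (s - 1/2) ((x \<bullet> \<theta>)\<^sup>2 - ((norm x)\<^sup>2 - 1) * (norm \<theta>)\<^sup>2)) \<partial>lborel) =
    ennreal (norm x powr (2 - real DIM('a))) * K" using nn_integral_angular[OF e0, of s] by blast
  define C where "C = (\<integral>\<^sup>+u. ennreal (tpow (s - 1) (1 - u\<^sup>2)) \<partial>lborel) * K"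
  let ?f = "\<lambda>x::'a. norm x powr (2 - real ?n) * ((norm x)\<^sup>2 - 1) powr (- 1 - s)"
  have W: "ennreal (ln 2) * ext_pot (s - 1) s 1 x = ennreal (?f x) * C" if "1 < norm x" for x :: 'a
    unfolding ext_pot_polar[OF that s(1)] K[OF that] C_def
    by (subst ennreal_mult) (auto simp: mult_ac)
  \<comment> \<open>At norm 2 the kernel is at most 1 on the unit ball, so only the singularity of
    the power s - 1 at the unit sphere has to be integrated.\<close>
  define x0 where "x0 = 2 *\<^sub>R e0"
  have x0: "norm x0 = 2" using e0 by (simp add: x0_def)
  let ?h = "\<lambda>y. tpow (s - 1) (1 - (norm y)\<^sup>2) * norm (y - x0) powr - (real ?n + 2 * s)"
  have "ext_pot (s - 1) s 1 x0 \<le> (\<integral>\<^sup>+(z::'a). ennreal (\<bar>(norm z)\<^sup>2 - 1\<bar> powr (-(1 - s))) * indicator {..<2} (norm z) \<partial>lborel)"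
    unfolding ext_pot_shift
  proof (rule nn_integral_mono)
    fix y :: 'a
    have "?h y \<le> \<bar>(norm y)\<^sup>2 - 1\<bar> powr (s - 1)" if "norm y < 1"
    proof -
      have "norm x0 \<le> norm (x0 - y) + norm y" by (metis diff_add_cancel norm_triangle_ineq)
      then have 1: "1 \<le> norm (y - x0)" using that x0 by (simp add: norm_minus_commute)
      have "norm (y - x0) powr - (real ?n + 2 * s) \<le> 1 powr - (real ?n + 2 * s)"
        using 1 s by (intro powr_mono2') auto
      moreover have "tpow (s - 1) (1 - (norm y)\<^sup>2) \<le> \<bar>(norm y)\<^sup>2 - 1\<bar> powr (s - 1)"
        by (simp add: tpow_def)
      ultimately show ?thesis using mult_mono[of "tpow (s - 1) (1 - (norm y)\<^sup>2)" "\<bar>(norm y)\<^sup>2 - 1\<bar> powr (s - 1)" "norm (y - x0) powr - (real ?n + 2 * s)" 1] by simp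
    qed
    moreover have "?h y = 0" if "\<not> norm y < 1"
    proof -
      have "1 \<le> (norm y)\<^sup>2" using that by (simp add: one_le_power)
      then show ?thesis by (simp add: tpow_neg)
    qed
    ultimately show "ennreal (tpow (s - 1) (1\<^sup>2 - (norm y)\<^sup>2) * norm (y - x0) powr - (real ?n + 2 * s)) \<le>
       ennreal (\<bar>(norm y)\<^sup>2 - 1\<bar> powr (-(1 - s))) * indicator {..<2} (norm y)"
      by (cases "norm y < 1") (auto intro: ennreal_leI)
  qed
  also have "\<dots> < top" by (rule nn_integral_shell_finite) (use s in auto)
  finally have Wfin: "ext_pot (s - 1) s 1 x0 < top" .
  have Wpos: "ext_pot (s - 1) s 1 x0 \<noteq> 0"
  proof
    assume "ext_pot (s - 1) s 1 x0 = 0"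
    then have "AE y in lborel. ennreal (tpow (s - 1) (1\<^sup>2 - (norm y)\<^sup>2) * norm (y - x0) powr - (real ?n + 2 * s)) = 0"
      unfolding ext_pot_shift by (subst (asm) nn_integral_0_iff_AE) auto
    then have "AE y in lborel. y \<notin> ball (0::'a) 1"
    proof (rule AE_mp, intro AE_I2 impI)
      fix y :: 'a
      assume z: "ennreal (tpow (s - 1) (1\<^sup>2 - (norm y)\<^sup>2) * norm (y - x0) powr - (real ?n + 2 * s)) = 0"
      show "y \<notin> ball 0 1"
      proof
        assume "y \<in> ball 0 1"
        then have y: "norm y < 1" by simp
        then have "(norm y)\<^sup>2 < 1" by (simp add: abs_square_less_1)
        moreover have "y \<noteq> x0" using y x0 by auto
        ultimately have "0 < tpow (s - 1) (1\<^sup>2 - (norm y)\<^sup>2) * norm (y - x0) powr - (real ?n + 2 * s)"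
          by (intro mult_pos_pos) (auto simp: tpow_def)
        then show False using z by (simp add: ennreal_eq_0_iff)
      qed
    qed
    then show False using not_AE_notin_ball[of 1 "0::'a"] by simp
  qed
  have f0: "0 < ?f x0" using x0 by (intro mult_pos_pos) (auto simp: x0)
  have W0: "ennreal (ln 2) * ext_pot (s - 1) s 1 x0 = ennreal (?f x0) * C" using x0 by (intro W) simp
  have "C \<noteq> top"
  proof
    assume "C = top"
    then have "ennreal (ln 2) * ext_pot (s - 1) s 1 x0 = top" using W0 x0 by (auto simp: ennreal_mult_top)
    then show False using Wfin by (simp add: ennreal_mult_eq_top_iff)
  qed
  moreover have "C \<noteq> 0"
  proof
    assume "C = 0"
    then have "ennreal (ln 2) * ext_pot (s - 1) s 1 x0 = 0" using W0 by simp
    then show False using Wpos by simp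
  qed
  ultimately obtain c where c: "C = ennreal c" "0 < c" 
    by (cases C) (auto simp: ennreal_eq_0_iff less_le)
  show ?thesis
  proof (intro exI[of _ "c / ln 2"] conjI allI impI)
    fix x :: 'a assume x: "1 < norm x"
    have "ennreal (ln 2) * ext_pot (s - 1) s 1 x = ennreal (?f x) * ennreal c" using W[OF x] c by simp
    also have "\<dots> = ennreal (ln 2 * (c / ln 2 * ?f x))"
      by (subst ennreal_mult[symmetric]) (use c in auto)
    also have "\<dots> = ennreal (ln 2) * ennreal (c / ln 2 * ?f x)"
      by (rule ennreal_mult) (use c in auto)
    finally show "ext_pot (s - 1) s 1 x = ennreal (c / ln 2 * ?f x)"
      by (simp add: ennreal_mult_cancel_left)
  qed (use c in simp)
qed

lemma ext_pot_scale:
  fixes x :: "'a::euclidean_space"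
  assumes r: "0 < r"
  shows "ext_pot a s r x = ennreal (r powr (2 * a - 2 * s)) * ext_pot a s 1 (x /\<^sub>R r)"
proof -
  let ?n = "DIM('a)"
  have "ext_pot a s r x = ennreal (\<bar>r\<bar> ^ ?n) * (\<integral>\<^sup>+(z::'a). ennreal (tpow a (r\<^sup>2 - (norm (x + (0 + r *\<^sub>R z)))\<^sup>2) * norm (0 + r *\<^sub>R z) powr - (real ?n + 2 * s)) \<partial>lborel)"
    unfolding ext_pot_def by (rule nn_integral_lborel_affine) (use r in auto)
  also have "\<dots> = ennreal (\<bar>r\<bar> ^ ?n) * (\<integral>\<^sup>+(z::'a). ennreal (r powr (2 * a) * r powr - (real ?n + 2 * s)) *
      ennreal (tpow a (1\<^sup>2 - (norm (x /\<^sub>R r + z))\<^sup>2) * norm z powr - (real ?n + 2 * s)) \<partial>lborel)"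
  proof (rule arg_cong[where f="\<lambda>y. ennreal (\<bar>r\<bar> ^ ?n) * y"], rule nn_integral_cong)
    fix z :: 'a
    have "x + (0 + r *\<^sub>R z) = r *\<^sub>R (x /\<^sub>R r + z)" using r by (simp add: scaleR_add_right)
    then have "r\<^sup>2 - (norm (x + (0 + r *\<^sub>R z)))\<^sup>2 = r\<^sup>2 * (1\<^sup>2 - (norm (x /\<^sub>R r + z))\<^sup>2)"
      using r by (simp only: norm_scaleR power_mult_distrib) (simp add: algebra_simps)
    then have "tpow a (r\<^sup>2 - (norm (x + (0 + r *\<^sub>R z)))\<^sup>2) = (r\<^sup>2) powr a * tpow a (1\<^sup>2 - (norm (x /\<^sub>R r + z))\<^sup>2)"
      using r by (simp only:) (rule tpow_cmult, simp)
    moreover have "(r\<^sup>2) powr a = r powr (2 * a)"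
      using r powr_powr[of r 2 a] by (simp add: powr_numeral)
    moreover have "norm (0 + r *\<^sub>R z) powr - (real ?n + 2 * s) = r powr - (real ?n + 2 * s) * norm z powr - (real ?n + 2 * s)"
      using r by (simp add: powr_mult)
    ultimately have "tpow a (r\<^sup>2 - (norm (x + (0 + r *\<^sub>R z)))\<^sup>2) * norm (0 + r *\<^sub>R z) powr - (real ?n + 2 * s) =
      (r powr (2 * a) * r powr - (real ?n + 2 * s)) * (tpow a (1\<^sup>2 - (norm (x /\<^sub>R r + z))\<^sup>2) * norm z powr - (real ?n + 2 * s))"
      by (simp only: mult_ac)
    then show "ennreal (tpow a (r\<^sup>2 - (norm (x + (0 + r *\<^sub>R z)))\<^sup>2) * norm (0 + r *\<^sub>R z) powr - (real ?n + 2 * s)) =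
      ennreal (r powr (2 * a) * r powr - (real ?n + 2 * s)) * ennreal (tpow a (1\<^sup>2 - (norm (x /\<^sub>R r + z))\<^sup>2) * norm z powr - (real ?n + 2 * s))"
      by (simp only: ennreal_mult' mult_nonneg_nonneg powr_ge_zero)
  qed
  also have "\<dots> = ennreal (\<bar>r\<bar> ^ ?n) * (ennreal (r powr (2 * a) * r powr - (real ?n + 2 * s)) * ext_pot a s 1 (x /\<^sub>R r))"
    unfolding ext_pot_def by (subst nn_integral_cmult) auto
  also have "\<dots> = (ennreal (\<bar>r\<bar> ^ ?n) * ennreal (r powr (2 * a) * r powr - (real ?n + 2 * s))) * ext_pot a s 1 (x /\<^sub>R r)"
    by (simp only: mult.assoc)
  also have "ennreal (\<bar>r\<bar> ^ ?n) * ennreal (r powr (2 * a) * r powr - (real ?n + 2 * s)) = ennreal (r powr (2 * a - 2 * s))"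
  proof -
    have "\<bar>r\<bar> ^ ?n * (r powr (2 * a) * r powr - (real ?n + 2 * s)) = r powr (real ?n + (2 * a + - (real ?n + 2 * s)))"
      using r by (simp only: powr_add) (simp add: powr_realpow)
    also have "real ?n + (2 * a + - (real ?n + 2 * s)) = 2 * a - 2 * s" by simp
    finally show ?thesis by (subst ennreal_mult[symmetric]) auto
  qed
  finally show ?thesis .
qed

lemma ext_pot_explicit:
  assumes s: "0 < s" "s < 1"
  shows "\<exists>c>0. \<forall>r>0. \<forall>x::'a::euclidean_space. r < norm x \<longrightarrow>
    ext_pot (s - 1) s r x = ennreal (c * (norm x powr (2 - real DIM('a)) * r powr (real DIM('a) + 2 * s - 2) * ((norm x)\<^sup>2 - r\<^sup>2) powr (- 1 - s)))"
proof -
  let ?n = "DIM('a)"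
  obtain c where c: "0 < c" and W: "\<And>x::'a. 1 < norm x \<Longrightarrow>
    ext_pot (s - 1) s 1 x = ennreal (c * (norm x powr (2 - real DIM('a)) * ((norm x)\<^sup>2 - 1) powr (- 1 - s)))"
    using ext_pot_unit[OF s] by blast
  show ?thesis
  proof (intro exI[of _ c] conjI allI impI c)
    fix r :: real and x :: 'a assume r: "0 < r" and x: "r < norm x"
    have nx: "norm (x /\<^sub>R r) = norm x / r" using r by (simp add: divide_inverse mult.commute)
    have x1: "1 < norm (x /\<^sub>R r)" unfolding nx using r x by simp
    have Q: "0 < (norm x)\<^sup>2 - r\<^sup>2" using r x by (simp add: power_strict_mono)
    have "((norm x / r)\<^sup>2 - 1) powr (- 1 - s) = (((norm x)\<^sup>2 - r\<^sup>2) / r\<^sup>2) powr (- 1 - s)"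
      using r by (simp add: field_simps power_divide)
    also have "\<dots> = ((norm x)\<^sup>2 - r\<^sup>2) powr (- 1 - s) / (r\<^sup>2) powr (- 1 - s)"
      using Q by (intro powr_divide)
    also have "(r\<^sup>2) powr (- 1 - s) = r powr (2 * (- 1 - s))"
      using r powr_powr[of r 2 "- 1 - s"] by (simp add: powr_numeral)
    finally have e1: "((norm x / r)\<^sup>2 - 1) powr (- 1 - s) = ((norm x)\<^sup>2 - r\<^sup>2) powr (- 1 - s) * r powr (- (2 * (- 1 - s)))"
      by (simp only: powr_minus divide_inverse)
    have e2: "(norm x / r) powr (2 - real ?n) = norm x powr (2 - real ?n) * r powr (- (2 - real ?n))"
      using r by (simp only: powr_minus divide_inverse[symmetric] powr_divide)
    have e3: "r powr (2 * (s - 1) - 2 * s) * (r powr (- (2 * (- 1 - s))) * r powr (- (2 - real ?n))) = r powr (real ?n + 2 * s - 2)"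
      unfolding powr_add[symmetric] by (rule arg_cong[where f="\<lambda>y. r powr y"]) simp
    have "ext_pot (s - 1) s r x = ennreal (r powr (2 * (s - 1) - 2 * s)) * ennreal (c * ((norm x / r) powr (2 - real ?n) * ((norm x / r)\<^sup>2 - 1) powr (- 1 - s)))"
      unfolding ext_pot_scale[OF r, of "s - 1"] W[OF x1] nx ..
    also have "\<dots> = ennreal (r powr (2 * (s - 1) - 2 * s) * (c * ((norm x / r) powr (2 - real ?n) * ((norm x / r)\<^sup>2 - 1) powr (- 1 - s))))"
      by (rule ennreal_mult'[symmetric]) simp
    also have "r powr (2 * (s - 1) - 2 * s) * (c * ((norm x / r) powr (2 - real ?n) * ((norm x / r)\<^sup>2 - 1) powr (- 1 - s))) =
      c * (norm x powr (2 - real ?n) * (r powr (2 * (s - 1) - 2 * s) * (r powr (- (2 * (- 1 - s))) * r powr (- (2 - real ?n)))) * ((norm x)\<^sup>2 - r\<^sup>2) powr (- 1 - s))"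
      unfolding e1 e2 by (simp only: mult_ac)
    finally show "ext_pot (s - 1) s r x = ennreal (c * (norm x powr (2 - real ?n) * r powr (real ?n + 2 * s - 2) * ((norm x)\<^sup>2 - r\<^sup>2) powr (- 1 - s)))"
      unfolding e3 .
  qed
qed

text \<open>The kernel \<open>K^s_r(0, y)\<close> without its constant, extended by \<open>0\<close> to the closed ball.\<close>

definition kap :: "real \<Rightarrow> real \<Rightarrow> 'a::euclidean_space \<Rightarrow> real" where
  "kap s r y = (if r < norm y then (r\<^sup>2 / ((norm y)\<^sup>2 - r\<^sup>2)) powr s / norm y ^ DIM('a) else 0)"

lemma kap_nonneg [simp]: "0 \<le> kap s r y"
  by (simp add: kap_def)

lemma kap_measurable [measurable]: "(\<lambda>(r, y::'a::euclidean_space). kap s r y) \<in> borel_measurable (borel \<Otimes>\<^sub>M borel)"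
  unfolding kap_def by measurable

text \<open>The r-derivative of the power s of r^2 - t is 2 s r times the power s - 1. The torsion
  profile is thus a superposition of profiles whose potential is explicit.\<close>

lemma tpow_square_superposition:
  assumes s: "0 < s" and t: "0 \<le> t" and R: "0 < R"
  shows "ennreal (tpow s (R\<^sup>2 - t)) = (\<integral>\<^sup>+r. ennreal (2 * s * r * indicator {0..R} r) * ennreal (tpow (s - 1) (r\<^sup>2 - t)) \<partial>lborel)"
proof -
  have "ennreal (tpow s (R\<^sup>2 - t)) = ennreal (tpow s (R\<^sup>2 - t) - tpow s (- t))"
    using t by (simp add: tpow_neg)
  also have "\<dots> = (\<integral>\<^sup>+X. ennreal (s * tpow (s - 1) X) * indicator {-t..R\<^sup>2 - t} X \<partial>lborel)"
    by (rule nn_integral_tpow_FTC[symmetric]) (use s in auto)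
  also have "\<dots> = (\<integral>\<^sup>+X. ennreal (s * tpow (s - 1) (-t + X)) * indicator {-t..R\<^sup>2 - t} (-t + X) \<partial>lborel)"
    by (rule nn_integral_lborel_translate[symmetric, of "\<lambda>X. ennreal (s * tpow (s - 1) X) * indicator {-t..R\<^sup>2 - t} X"]) measurable
  also have "\<dots> = (\<integral>\<^sup>+X. (s * tpow (s - 1) (X - t)) * indicator {0\<^sup>2..R\<^sup>2} X \<partial>lborel)"
    by (intro nn_integral_cong) (auto simp: indicator_def)
  also have "\<dots> = (\<integral>\<^sup>+r. (s * tpow (s - 1) (r\<^sup>2 - t)) * (2 * r) * indicator {0..R} r \<partial>lborel)"
    by (rule nn_integral_substitution) (use R in \<open>auto intro!: derivative_eq_intros continuous_intros simp: set_borel_measurable_def\<close>)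
  also have "\<dots> = (\<integral>\<^sup>+r. ennreal (2 * s * r * indicator {0..R} r) * ennreal (tpow (s - 1) (r\<^sup>2 - t)) \<partial>lborel)"
    by (intro nn_integral_cong, subst ennreal_mult[symmetric]) (use s in \<open>auto simp: indicator_def mult_ac\<close>)
  finally show ?thesis .
qed

lemma ext_pot_superposition:
  fixes x :: "'a::euclidean_space"
  assumes s: "0 < s" and R: "0 < R"
  shows "ext_pot s s R x = (\<integral>\<^sup>+r. ennreal (2 * s * r * indicator {0..R} r) * ext_pot (s - 1) s r x \<partial>lborel)"
proof -
  let ?k = "\<lambda>z::'a. norm z powr - (real DIM('a) + 2 * s)"
  have "ext_pot s s R x = (\<integral>\<^sup>+z. (\<integral>\<^sup>+r. ennreal (2 * s * r * indicator {0..R} r) * ennreal (tpow (s - 1) (r\<^sup>2 - (norm (x + z))\<^sup>2) * ?k z) \<partial>lborel) \<partial>lborel)"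
    unfolding ext_pot_def
  proof (rule nn_integral_cong)
    fix z :: 'a
    have "ennreal (tpow s (R\<^sup>2 - (norm (x + z))\<^sup>2) * ?k z) = ennreal (tpow s (R\<^sup>2 - (norm (x + z))\<^sup>2)) * ennreal (?k z)"
      by (rule ennreal_mult) auto
    also have "\<dots> = (\<integral>\<^sup>+r. ennreal (2 * s * r * indicator {0..R} r) * ennreal (tpow (s - 1) (r\<^sup>2 - (norm (x + z))\<^sup>2)) * ennreal (?k z) \<partial>lborel)"
      by (subst tpow_square_superposition[OF s _ R]) (auto simp: nn_integral_multc)
    also have "\<dots> = (\<integral>\<^sup>+r. ennreal (2 * s * r * indicator {0..R} r) * ennreal (tpow (s - 1) (r\<^sup>2 - (norm (x + z))\<^sup>2) * ?k z) \<partial>lborel)"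
      by (intro nn_integral_cong) (simp add: ennreal_mult' mult.assoc)
    finally show "ennreal (tpow s (R\<^sup>2 - (norm (x + z))\<^sup>2) * ?k z) = \<dots>" .
  qed
  also have "\<dots> = (\<integral>\<^sup>+r. (\<integral>\<^sup>+z. ennreal (2 * s * r * indicator {0..R} r) * ennreal (tpow (s - 1) (r\<^sup>2 - (norm (x + z))\<^sup>2) * ?k z) \<partial>lborel) \<partial>lborel)"
    by (rule lborel_pair.Fubini'[symmetric]) measurable
  also have "\<dots> = (\<integral>\<^sup>+r. ennreal (2 * s * r * indicator {0..R} r) * ext_pot (s - 1) s r x \<partial>lborel)"
    unfolding ext_pot_def by (intro nn_integral_cong nn_integral_cmult) measurable
  finally show ?thesis .
qed

text \<open>Up to constants r^n \<open>kap s r x\<close> is r^(n + 2 s) (\<rho>^2 - r^2)^(-s) with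
  \<rho> = |x|. It vanishes at r = 0, and its r-derivative splits into n r^(n - 1)
  \<open>kap s r x\<close> and the density in the superposition of the potential. Integration up to
  R gives the identity, written as a sum so that nothing is subtracted in
  \<open>ennreal\<close>.\<close>

lemma ext_pot_kap:
  assumes s: "0 < s" "s < 1"
  shows "\<exists>c>0. \<forall>R>0. \<forall>x::'a::euclidean_space. R < norm x \<longrightarrow>
    ext_pot s s R x + (\<integral>\<^sup>+r. ennreal (c * real DIM('a) * r ^ (DIM('a) - 1) * indicator {0..R} r * kap s r x) \<partial>lborel) =
      ennreal (c * R ^ DIM('a) * kap s R x)"
proof -
  let ?n = "DIM('a)"
  obtain c where c: "0 < c" and W: "\<And>r x::'a. 0 < r \<Longrightarrow> r < norm x \<Longrightarrow>
    ext_pot (s - 1) s r x = ennreal (c * (norm x powr (2 - real ?n) * r powr (real ?n + 2 * s - 2) * ((norm x)\<^sup>2 - r\<^sup>2) powr (- 1 - s)))"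
    using ext_pot_explicit[OF s] by blast
  show ?thesis
  proof (intro exI[of _ c] conjI allI impI c)
    fix R :: real and x :: 'a assume R: "0 < R" and x: "R < norm x"
    let ?\<rho> = "norm x"
    have x0: "x \<noteq> 0" using R x by auto
    define F where "F r = c * (r powr (real ?n + 2 * s) * (?\<rho>\<^sup>2 - r\<^sup>2) powr (- s)) / ?\<rho> ^ ?n" for r
    define f1 where "f1 r = 2 * s * r * (c * (?\<rho> powr (2 - real ?n) * r powr (real ?n + 2 * s - 2) * (?\<rho>\<^sup>2 - r\<^sup>2) powr (- 1 - s)))" for r
    define f2 where "f2 r = c * real ?n * r ^ (?n - 1) * kap s r x" for r
    have kap: "kap s r x = r powr (2 * s) * (?\<rho>\<^sup>2 - r\<^sup>2) powr (- s) / ?\<rho> ^ ?n" if "0 < r" "r \<le> R" for r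
    proof -
      have Q: "0 < ?\<rho>\<^sup>2 - r\<^sup>2" using that x by (simp add: power_strict_mono)
      have "(r\<^sup>2 / (?\<rho>\<^sup>2 - r\<^sup>2)) powr s = (r\<^sup>2) powr s / (?\<rho>\<^sup>2 - r\<^sup>2) powr s"
        by (rule powr_divide)
      also have "(r\<^sup>2) powr s = r powr (2 * s)"
        using that powr_powr[of r 2 s] by (simp add: powr_numeral)
      finally show ?thesis using that x unfolding kap_def by (simp add: powr_minus divide_inverse)
    qed
    \<comment> \<open>With Q = \<rho>^2 - r^2 the product rule leaves the bracket (n + 2 s) Q + 2 s
      r^2 = n Q + 2 s \<rho>^2. The part n Q belongs to the Poisson kernel (f2), the part 2 s
      \<rho>^2 to the potential (f1).\<close>
    have f12: "f1 r + f2 r = c / ?\<rho> ^ ?n * ((real ?n + 2 * s) * r powr (real ?n + 2 * s - 1) * (?\<rho>\<^sup>2 - r\<^sup>2) powr (- s) +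
        r powr (real ?n + 2 * s) * (2 * s * r * (?\<rho>\<^sup>2 - r\<^sup>2) powr (- s - 1)))" if r: "0 < r" "r \<le> R" for r
    proof -
      define Q where "Q = ?\<rho>\<^sup>2 - r\<^sup>2"
      have Q: "0 < Q" using r x by (simp add: Q_def power_strict_mono)
      define E where "E = r powr (real ?n + 2 * s - 1)"
      define P where "P = Q powr (- 1 - s)"
      have p0: "?\<rho> powr (2 - real ?n) = ?\<rho>\<^sup>2 / ?\<rho> ^ ?n"
        using x0 by (simp add: powr_diff powr_realpow powr_numeral)
      have p1: "r * r powr (real ?n + 2 * s - 2) = E"
        unfolding E_def using r powr_add[of r 1 "real ?n + 2 * s - 2"] by simp
      have p2: "r ^ (?n - 1) * r powr (2 * s) = E"
      proof -
        have "r ^ (?n - 1) = r powr (real ?n - 1)"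
          using r DIM_positive[where 'a='a] by (simp add: powr_realpow[symmetric] of_nat_diff Suc_leI)
        then show ?thesis unfolding E_def using powr_add[of r "real ?n - 1" "2 * s"] by (simp add: algebra_simps)
      qed
      have p3: "r powr (real ?n + 2 * s) = E * r"
        unfolding E_def using r powr_add[of r "real ?n + 2 * s - 1" 1] by simp
      have p4: "Q powr (- s) = P * Q"
        unfolding P_def using Q powr_add[of Q "- 1 - s" 1] by simp
      have p5: "Q powr (- s - 1) = P" unfolding P_def by (rule arg_cong[where f="\<lambda>y. Q powr y"]) simp
      have "f1 r = c / ?\<rho> ^ ?n * (2 * s * ?\<rho>\<^sup>2 * E * P)"
        unfolding f1_def p0 p1[symmetric] Q_def[symmetric] P_def by simp
      moreover have "f2 r = c / ?\<rho> ^ ?n * (real ?n * E * P * Q)"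
        unfolding f2_def kap[OF r] p2[symmetric] Q_def[symmetric] p4 by simp
      moreover have "2 * s * ?\<rho>\<^sup>2 * E * P + real ?n * E * P * Q = (real ?n + 2 * s) * E * (P * Q) + E * r * (2 * s * r * P)"
      proof -
        have "?\<rho>\<^sup>2 = Q + r * r" by (simp add: Q_def power2_eq_square)
        then show ?thesis by (simp only:) (simp add: algebra_simps)
      qed
      ultimately show ?thesis
        unfolding Q_def[symmetric] p5 p3 p4 E_def[symmetric] by (simp only: distrib_left[symmetric])
    qed
    have "((\<lambda>r. f1 r + f2 r) has_integral (F R - F 0)) {0..R}"
    proof (rule fundamental_theorem_of_calculus_interior)
      have "?\<rho>\<^sup>2 - r\<^sup>2 \<noteq> 0" if "0 \<le> r" "r \<le> R" for r
      proof -
        have "r\<^sup>2 < ?\<rho>\<^sup>2" using that x by (intro power_strict_mono) auto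
        then show ?thesis by simp
      qed
      then show "continuous_on {0..R} F"
        unfolding F_def using s x0 by (intro continuous_intros continuous_on_powr' continuous_on_powr) auto
      fix r assume "r \<in> {0<..<R}"
      then have r: "0 < r" "r \<le> R" by auto
      have Q: "0 < ?\<rho>\<^sup>2 - r\<^sup>2" using r x by (simp add: power_strict_mono)
      have "(F has_real_derivative (f1 r + f2 r)) (at r)"
        unfolding f12[OF r] F_def
        by (rule derivative_eq_intros refl | use r Q x0 in simp)+
      then show "(F has_vector_derivative (f1 r + f2 r)) (at r)"
        by (simp add: has_real_derivative_iff_has_vector_derivative)
    qed (use R in auto)
    moreover have f10: "0 \<le> f1 r" and f20: "0 \<le> f2 r" if "0 \<le> r" for r
      using that s c by (auto simp: f1_def f2_def)
    ultimately have I: "(\<integral>\<^sup>+r. ennreal (f1 r + f2 r) * indicator {0..R} r \<partial>lborel) = ennreal (F R - F 0)"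
      by (intro nn_integral_has_integral_lebesgue') auto
    have [measurable]: "f1 \<in> borel_measurable borel" "f2 \<in> borel_measurable borel"
      unfolding f1_def f2_def kap_def by measurable
    have "ext_pot s s R x = (\<integral>\<^sup>+r. ennreal (f1 r) * indicator {0..R} r \<partial>lborel)"
      unfolding ext_pot_superposition[OF s(1) R]
    proof (rule nn_integral_cong)
      fix r :: real
      show "ennreal (2 * s * r * indicator {0..R} r) * ext_pot (s - 1) s r x = ennreal (f1 r) * indicator {0..R} r"
      proof (cases "0 < r \<and> r \<le> R")
        case True
        then have "ext_pot (s - 1) s r x = ennreal (c * (?\<rho> powr (2 - real ?n) * r powr (real ?n + 2 * s - 2) * (?\<rho>\<^sup>2 - r\<^sup>2) powr (- 1 - s)))"
          using x by (intro W) auto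
        then show ?thesis using True s c unfolding f1_def by (simp add: ennreal_mult')
      next
        case False
        then show ?thesis by (auto simp: indicator_def f1_def)
      qed
    qed
    moreover have "(\<integral>\<^sup>+r. ennreal (c * real ?n * r ^ (?n - 1) * indicator {0..R} r * kap s r x) \<partial>lborel) =
      (\<integral>\<^sup>+r. ennreal (f2 r) * indicator {0..R} r \<partial>lborel)"
      by (intro nn_integral_cong) (auto simp: f2_def indicator_def)
    moreover have "(\<integral>\<^sup>+r. ennreal (f1 r + f2 r) * indicator {0..R} r \<partial>lborel) =
      (\<integral>\<^sup>+r. ennreal (f1 r) * indicator {0..R} r + ennreal (f2 r) * indicator {0..R} r \<partial>lborel)"
      by (intro nn_integral_cong) (auto simp: indicator_def f10 f20)
    moreover have "\<dots> = (\<integral>\<^sup>+r. ennreal (f1 r) * indicator {0..R} r \<partial>lborel) + (\<integral>\<^sup>+r. ennreal (f2 r) * indicator {0..R} r \<partial>lborel)"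
      by (rule nn_integral_add) measurable
    moreover have "F R - F 0 = c * R ^ ?n * kap s R x"
      using R kap[of R] by (simp add: F_def powr_add powr_realpow)
    ultimately show "ext_pot s s R x + (\<integral>\<^sup>+r. ennreal (c * real ?n * r ^ (?n - 1) * indicator {0..R} r * kap s r x) \<partial>lborel) =
      ennreal (c * R ^ ?n * kap s R x)" using I by simp
  qed
qed

section \<open>The interior identity on lines\<close>

text \<open>The absolute values let one formula serve both signs of c, that is, the increments of
  the truncated quadratic in either direction of its linear coefficient.\<close>

lemma nn_integral_tpow_affine:
  assumes s: "0 < s" and c: "c \<noteq> 0" and m: "0 \<le> m"
  shows "(\<integral>\<^sup>+\<mu>. ennreal (s * tpow (s - 1) (A + c * \<mu>)) * indicator {0..m} \<mu> \<partial>lborel) =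
    ennreal (\<bar>tpow s (A + c * m) - tpow s A\<bar> / \<bar>c\<bar>)"
proof -
  define lo where "lo = min A (A + c * m)"
  define hi where "hi = max A (A + c * m)"
  let ?g = "\<lambda>X. ennreal (s * tpow (s - 1) X) * indicator {lo..hi} X"
  have ind: "(A + c * \<mu> \<in> {lo..hi}) = (\<mu> \<in> {0..m})" for \<mu>
  proof (cases "0 < c")
    case True
    then show ?thesis using m by (auto simp: lo_def hi_def min_def max_def zero_le_mult_iff mult_le_0_iff)
  next
    case False
    then have "c < 0" using c by simp
    then show ?thesis using m by (auto simp: lo_def hi_def min_def max_def zero_le_mult_iff mult_le_0_iff)
  qed
  have "ennreal \<bar>c\<bar> * (\<integral>\<^sup>+\<mu>. ennreal (s * tpow (s - 1) (A + c * \<mu>)) * indicator {0..m} \<mu> \<partial>lborel) = (\<integral>\<^sup>+X. ?g X \<partial>lborel)"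
    by (subst nn_integral_real_affine[of ?g c A]) (use c in \<open>simp_all add: indicator_def ind[unfolded atLeastAtMost_iff]\<close>)
  also have "\<dots> = ennreal (tpow s hi - tpow s lo)"
    by (rule nn_integral_tpow_FTC) (use s in \<open>auto simp: lo_def hi_def\<close>)
  also have "tpow s hi - tpow s lo = \<bar>tpow s (A + c * m) - tpow s A\<bar>"
  proof (cases "A \<le> A + c * m")
    case True
    then show ?thesis using tpow_mono[of s A "A + c * m"] s by (simp add: lo_def hi_def min_def max_def)
  next
    case False
    then show ?thesis using tpow_mono[of s "A + c * m" A] s by (simp add: lo_def hi_def min_def max_def)
  qed
  also have "\<dots> = \<bar>c\<bar> * (\<bar>tpow s (A + c * m) - tpow s A\<bar> / \<bar>c\<bar>)" using c by simp
  also have "ennreal \<dots> = ennreal \<bar>c\<bar> * ennreal (\<bar>tpow s (A + c * m) - tpow s A\<bar> / \<bar>c\<bar>)"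
    by (rule ennreal_mult) auto
  finally show ?thesis using c by (simp add: ennreal_mult_cancel_left)
qed

text \<open>The shift u = \<sigma> + \<mu> / (2 q) moves both endpoints. But \<kappa> > 0 makes the
  truncated power vanish wherever |u| \<le> |\<mu>| / (2 q), so the lower endpoint may stay at 0.
  The sign of \<mu> is then visible in the upper endpoint alone.\<close>

lemma nn_integral_complete_square:
  fixes q \<kappa> \<mu> N a :: real
  assumes q: "0 < q" and \<kappa>: "0 < \<kappa>"
  shows "(\<integral>\<^sup>+\<sigma>. indicator {0<..N} \<sigma> * ennreal (tpow a (q * \<sigma>\<^sup>2 - \<kappa> + \<mu> * \<sigma>)) \<partial>lborel) =
    (\<integral>\<^sup>+u. indicator {0<..N + \<mu> / (2 * q)} u * ennreal (tpow a (q * u\<^sup>2 - (\<kappa> + \<mu>\<^sup>2 / (4 * q)))) \<partial>lborel)"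
proof -
  define c where "c = \<mu> / (2 * q)"
  have mu: "\<mu> = 2 * q * c" using q by (simp add: c_def)
  have "(\<integral>\<^sup>+\<sigma>. indicator {0<..N} \<sigma> * ennreal (tpow a (q * \<sigma>\<^sup>2 - \<kappa> + \<mu> * \<sigma>)) \<partial>lborel) =
     (\<integral>\<^sup>+u. indicator {0<..N} (-c + u) * ennreal (tpow a (q * (-c + u)\<^sup>2 - \<kappa> + \<mu> * (-c + u))) \<partial>lborel)"
    by (rule nn_integral_lborel_translate[symmetric]) measurable
  also have "\<dots> = (\<integral>\<^sup>+u. indicator {0<..N + c} u * ennreal (tpow a (q * u\<^sup>2 - (\<kappa> + \<mu>\<^sup>2 / (4 * q)))) \<partial>lborel)"
  proof (rule nn_integral_cong)
    fix u :: real
    have h: "\<mu>\<^sup>2 / (4 * q) = q * c\<^sup>2" using q by (simp add: mu power2_eq_square)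
    have e: "q * (-c + u)\<^sup>2 - \<kappa> + \<mu> * (-c + u) = q * u\<^sup>2 - (\<kappa> + \<mu>\<^sup>2 / (4 * q))"
      unfolding h by (simp add: mu power2_eq_square algebra_simps)
    show "indicator {0<..N} (-c + u) * ennreal (tpow a (q * (-c + u)\<^sup>2 - \<kappa> + \<mu> * (-c + u))) =
      indicator {0<..N + c} u * ennreal (tpow a (q * u\<^sup>2 - (\<kappa> + \<mu>\<^sup>2 / (4 * q))))"
    proof (cases "0 < q * u\<^sup>2 - (\<kappa> + \<mu>\<^sup>2 / (4 * q))")
      case True
      then have "q * c\<^sup>2 < q * u\<^sup>2" using \<kappa> unfolding h by linarith
      then have "c\<^sup>2 < u\<^sup>2" using q by simp
      then have "\<bar>c\<bar> < \<bar>u\<bar>" using abs_le_square_iff[of u c] by linarith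
      then have "(0 < -c + u \<and> -c + u \<le> N) \<longleftrightarrow> (0 < u \<and> u \<le> N + c)" by (auto simp: abs_if split: if_splits)
      then show ?thesis unfolding e by (simp add: indicator_def)
    next
      case False
      then show ?thesis unfolding e by (simp add: tpow_neg)
    qed
  qed
  finally show ?thesis by (simp add: c_def)
qed

text \<open>Division by \<sigma> cancels the factor that differentiation in \<mu> produces, so the
  two first differences are the integrals over 0 \<le> \<mu> \<le> m of U at \<mu> and at - \<mu>.
  After completing the square these differ only by a window around N of bounded width, on which the
  integrand is of order N^(2 s - 2). As s < 1, the second difference disappears in the
  limit.\<close>

lemma line_interior_tendsto:
  fixes q \<kappa> m s :: real
  assumes q: "0 < q" and \<kappa>: "0 < \<kappa>" and s: "0 < s" "s < 1" and m: "0 \<le> m"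
  defines "f \<equiv> \<lambda>\<mu> \<sigma>. tpow s (q * \<sigma>\<^sup>2 - \<kappa> + \<mu> * \<sigma>)"
  shows "(\<lambda>N::nat. LINT \<sigma>|lborel. indicator {0<..real N} \<sigma> * ((f m \<sigma> + f (- m) \<sigma> - 2 * f 0 \<sigma>) / \<sigma>)) \<longlonglongrightarrow> 0"
proof -
  \<comment> \<open>C bounds the shifts \<mu> / (2 q), H bounds \<kappa> + \<mu>^2 / (4 q), and Y N
    is a common lower bound of the quadratic on the windows.\<close>
  define C where "C = m / (2 * q)"
  define H where "H = \<kappa> + m\<^sup>2 / (4 * q)"
  define Y where "Y N = q * (N - C)\<^sup>2 - H" for N :: real
  define a where "a \<sigma> = (f m \<sigma> - f 0 \<sigma>) / \<sigma>" for \<sigma>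
  define b where "b \<sigma> = (f 0 \<sigma> - f (- m) \<sigma>) / \<sigma>" for \<sigma>
  have [measurable]: "a \<in> borel_measurable borel" "b \<in> borel_measurable borel"
    unfolding a_def b_def f_def by measurable
  have C0: "0 \<le> C" using m q by (simp add: C_def)
  have f_mono: "f \<mu> \<sigma> \<le> f \<nu> \<sigma>" if "\<mu> \<le> \<nu>" "0 < \<sigma>" for \<mu> \<nu> \<sigma>
    unfolding f_def using that s by (intro tpow_mono) (auto simp: mult_right_mono)
  have a0: "0 \<le> a \<sigma>" and b0: "0 \<le> b \<sigma>" if "0 < \<sigma>" for \<sigma>
    using f_mono[of 0 m \<sigma>] f_mono[of "-m" 0 \<sigma>] that m by (auto simp: a_def b_def)
  define U where "U \<mu> N = (\<integral>\<^sup>+\<sigma>. indicator {0<..N} \<sigma> * ennreal (s * tpow (s - 1) (q * \<sigma>\<^sup>2 - \<kappa> + \<mu> * \<sigma>)) \<partial>lborel)" for \<mu> N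
  have [measurable]: "(\<lambda>\<mu>. U \<mu> N) \<in> borel_measurable borel" for N unfolding U_def by measurable
  have A: "(\<integral>\<^sup>+\<sigma>. indicator {0<..N} \<sigma> * ennreal (a \<sigma>) \<partial>lborel) = (\<integral>\<^sup>+\<mu>. U \<mu> N * indicator {0..m} \<mu> \<partial>lborel)" 
   and B: "(\<integral>\<^sup>+\<sigma>. indicator {0<..N} \<sigma> * ennreal (b \<sigma>) \<partial>lborel) = (\<integral>\<^sup>+\<mu>. U (- \<mu>) N * indicator {0..m} \<mu> \<partial>lborel)" for N
  proof -
    have *: "(\<integral>\<^sup>+\<sigma>. indicator {0<..N} \<sigma> * (\<integral>\<^sup>+\<mu>. ennreal (s * tpow (s - 1) (q * \<sigma>\<^sup>2 - \<kappa> + (\<epsilon> * \<sigma>) * \<mu>)) * indicator {0..m} \<mu> \<partial>lborel) \<partial>lborel)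
       = (\<integral>\<^sup>+\<mu>. U (\<epsilon> * \<mu>) N * indicator {0..m} \<mu> \<partial>lborel)" for \<epsilon> :: real
    proof -
      have "(\<integral>\<^sup>+\<sigma>. indicator {0<..N} \<sigma> * (\<integral>\<^sup>+\<mu>. ennreal (s * tpow (s - 1) (q * \<sigma>\<^sup>2 - \<kappa> + (\<epsilon> * \<sigma>) * \<mu>)) * indicator {0..m} \<mu> \<partial>lborel) \<partial>lborel)
        = (\<integral>\<^sup>+\<sigma>. (\<integral>\<^sup>+\<mu>. indicator {0<..N} \<sigma> * (ennreal (s * tpow (s - 1) (q * \<sigma>\<^sup>2 - \<kappa> + (\<epsilon> * \<sigma>) * \<mu>)) * indicator {0..m} \<mu>) \<partial>lborel) \<partial>lborel)"
        by (intro nn_integral_cong nn_integral_cmult[symmetric]) measurable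
      also have "\<dots> = (\<integral>\<^sup>+\<mu>. (\<integral>\<^sup>+\<sigma>. indicator {0<..N} \<sigma> * (ennreal (s * tpow (s - 1) (q * \<sigma>\<^sup>2 - \<kappa> + (\<epsilon> * \<sigma>) * \<mu>)) * indicator {0..m} \<mu>) \<partial>lborel) \<partial>lborel)"
        by (rule lborel_pair.Fubini'[symmetric]) measurable
      also have "\<dots> = (\<integral>\<^sup>+\<mu>. U (\<epsilon> * \<mu>) N * indicator {0..m} \<mu> \<partial>lborel)"
        unfolding U_def by (intro nn_integral_cong, subst nn_integral_multc[symmetric]) (auto simp: mult_ac)
      finally show ?thesis .
    qed
    have "(\<integral>\<^sup>+\<sigma>. indicator {0<..N} \<sigma> * ennreal (a \<sigma>) \<partial>lborel) =
      (\<integral>\<^sup>+\<sigma>. indicator {0<..N} \<sigma> * (\<integral>\<^sup>+\<mu>. ennreal (s * tpow (s - 1) (q * \<sigma>\<^sup>2 - \<kappa> + (1 * \<sigma>) * \<mu>)) * indicator {0..m} \<mu> \<partial>lborel) \<partial>lborel)"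
    proof (rule nn_integral_cong)
      fix \<sigma> :: real
      show "indicator {0<..N} \<sigma> * ennreal (a \<sigma>) = indicator {0<..N} \<sigma> * (\<integral>\<^sup>+\<mu>. ennreal (s * tpow (s - 1) (q * \<sigma>\<^sup>2 - \<kappa> + (1 * \<sigma>) * \<mu>)) * indicator {0..m} \<mu> \<partial>lborel)"
        using nn_integral_tpow_affine[OF s(1) _ m, of "1 * \<sigma>" "q * \<sigma>\<^sup>2 - \<kappa>"] f_mono[of 0 m \<sigma>] m
        by (cases "0 < \<sigma>") (auto simp: a_def f_def mult.commute)
    qed
    then show "(\<integral>\<^sup>+\<sigma>. indicator {0<..N} \<sigma> * ennreal (a \<sigma>) \<partial>lborel) = (\<integral>\<^sup>+\<mu>. U \<mu> N * indicator {0..m} \<mu> \<partial>lborel)"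
      using *[of 1] by simp
    have "(\<integral>\<^sup>+\<sigma>. indicator {0<..N} \<sigma> * ennreal (b \<sigma>) \<partial>lborel) =
      (\<integral>\<^sup>+\<sigma>. indicator {0<..N} \<sigma> * (\<integral>\<^sup>+\<mu>. ennreal (s * tpow (s - 1) (q * \<sigma>\<^sup>2 - \<kappa> + (-1 * \<sigma>) * \<mu>)) * indicator {0..m} \<mu> \<partial>lborel) \<partial>lborel)"
    proof (rule nn_integral_cong)
      fix \<sigma> :: real
      show "indicator {0<..N} \<sigma> * ennreal (b \<sigma>) = indicator {0<..N} \<sigma> * (\<integral>\<^sup>+\<mu>. ennreal (s * tpow (s - 1) (q * \<sigma>\<^sup>2 - \<kappa> + (-1 * \<sigma>) * \<mu>)) * indicator {0..m} \<mu> \<partial>lborel)"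
        using nn_integral_tpow_affine[OF s(1) _ m, of "-1 * \<sigma>" "q * \<sigma>\<^sup>2 - \<kappa>"] f_mono[of "-m" 0 \<sigma>] m
        by (cases "0 < \<sigma>") (auto simp: b_def f_def mult.commute)
    qed
    then show "(\<integral>\<^sup>+\<sigma>. indicator {0<..N} \<sigma> * ennreal (b \<sigma>) \<partial>lborel) = (\<integral>\<^sup>+\<mu>. U (- \<mu>) N * indicator {0..m} \<mu> \<partial>lborel)"
      using *[of "-1"] by simp
  qed
  have U: "U \<mu> N \<le> U (- \<mu>) N + ennreal (s * Y N powr (s - 1) * (2 * C))"
    if \<mu>: "0 \<le> \<mu>" "\<mu> \<le> m" and N: "C < N" "0 < Y N" for \<mu> N
  proof -
    define c where "c = \<mu> / (2 * q)"
    define h where "h = \<kappa> + \<mu>\<^sup>2 / (4 * q)"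
    have c: "0 \<le> c" "c \<le> C" using \<mu> q by (auto simp: c_def C_def divide_right_mono)
    have hH: "h \<le> H" unfolding h_def H_def using \<mu> q by (auto intro!: divide_right_mono power_mono)
    define G where "G u = ennreal (s * tpow (s - 1) (q * u\<^sup>2 - h))" for u
    have [measurable]: "G \<in> borel_measurable borel" unfolding G_def by measurable
    have UU: "U \<nu> N = (\<integral>\<^sup>+u. indicator {0<..N + \<nu> / (2 * q)} u * ennreal (s * tpow (s - 1) (q * u\<^sup>2 - (\<kappa> + \<nu>\<^sup>2 / (4 * q)))) \<partial>lborel)" for \<nu>
    proof -
      have "U \<nu> N = ennreal s * (\<integral>\<^sup>+\<sigma>. indicator {0<..N} \<sigma> * ennreal (tpow (s - 1) (q * \<sigma>\<^sup>2 - \<kappa> + \<nu> * \<sigma>)) \<partial>lborel)"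
        unfolding U_def using s by (subst nn_integral_cmult[symmetric]) (auto simp: ennreal_mult' mult_ac)
      also have "\<dots> = (\<integral>\<^sup>+u. indicator {0<..N + \<nu> / (2 * q)} u * ennreal (s * tpow (s - 1) (q * u\<^sup>2 - (\<kappa> + \<nu>\<^sup>2 / (4 * q)))) \<partial>lborel)"
        unfolding nn_integral_complete_square[OF q \<kappa>] using s by (subst nn_integral_cmult[symmetric]) (auto simp: ennreal_mult' mult_ac)
      finally show ?thesis .
    qed
    have "U \<mu> N = (\<integral>\<^sup>+u. indicator {0<..N + c} u * G u \<partial>lborel)"
      unfolding UU G_def h_def c_def ..
    also have "\<dots> = (\<integral>\<^sup>+u. indicator {0<..N - c} u * G u + indicator {N - c<..N + c} u * G u \<partial>lborel)"
      using c N by (intro nn_integral_cong) (auto simp: indicator_def)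
    also have "\<dots> = (\<integral>\<^sup>+u. indicator {0<..N - c} u * G u \<partial>lborel) + (\<integral>\<^sup>+u. indicator {N - c<..N + c} u * G u \<partial>lborel)"
      by (rule nn_integral_add) measurable
    also have "(\<integral>\<^sup>+u. indicator {0<..N - c} u * G u \<partial>lborel) = U (- \<mu>) N"
      unfolding UU G_def h_def c_def by simp
    also have "(\<integral>\<^sup>+u. indicator {N - c<..N + c} u * G u \<partial>lborel) \<le> (\<integral>\<^sup>+u. ennreal (s * Y N powr (s - 1)) * indicator {N - c<..N + c} u \<partial>lborel)"
    proof (rule nn_integral_mono)
      fix u :: real
      show "indicator {N - c<..N + c} u * G u \<le> ennreal (s * Y N powr (s - 1)) * indicator {N - c<..N + c} u"
      proof (cases "N - c < u \<and> u \<le> N + c")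
        case True
        have "(N - C)\<^sup>2 \<le> u\<^sup>2" using True c N by (intro power_mono) auto
        then have "Y N \<le> q * u\<^sup>2 - h" unfolding Y_def using hH q by (smt (verit) mult_left_mono)
        then have "tpow (s - 1) (q * u\<^sup>2 - h) \<le> Y N powr (s - 1)"
          using N s by (simp add: tpow_def powr_mono2')
        then show ?thesis using True s by (auto simp: G_def intro!: ennreal_leI mult_left_mono)
      qed auto
    qed
    also have "\<dots> = ennreal (s * Y N powr (s - 1)) * ennreal (2 * c)"
      using c by (subst nn_integral_cmult_indicator) (auto simp: mult_ac)
    also have "\<dots> \<le> ennreal (s * Y N powr (s - 1)) * ennreal (2 * C)"
      using c by (intro mult_left_mono ennreal_leI) auto
    also have "\<dots> = ennreal (s * Y N powr (s - 1) * (2 * C))"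
      using C0 s by (intro ennreal_mult'[symmetric]) auto
    finally show ?thesis by simp
  qed
  define E where "E N = s * Y N powr (s - 1) * (2 * C) * m" for N
  have E0: "0 \<le> E N" for N using s C0 m by (simp add: E_def)
  have AB: "(\<integral>\<^sup>+\<sigma>. indicator {0<..N} \<sigma> * ennreal (a \<sigma>) \<partial>lborel) \<le> (\<integral>\<^sup>+\<sigma>. indicator {0<..N} \<sigma> * ennreal (b \<sigma>) \<partial>lborel) + ennreal (E N)"
    if N: "C < N" "0 < Y N" for N
  proof -
    have "(\<integral>\<^sup>+\<mu>. U \<mu> N * indicator {0..m} \<mu> \<partial>lborel) \<le> (\<integral>\<^sup>+\<mu>. U (- \<mu>) N * indicator {0..m} \<mu> + ennreal (s * Y N powr (s - 1) * (2 * C)) * indicator {0..m} \<mu> \<partial>lborel)"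
      using U[OF _ _ N] by (intro nn_integral_mono) (auto simp: indicator_def)
    also have "\<dots> = (\<integral>\<^sup>+\<mu>. U (- \<mu>) N * indicator {0..m} \<mu> \<partial>lborel) + (\<integral>\<^sup>+\<mu>. ennreal (s * Y N powr (s - 1) * (2 * C)) * indicator {0..m} \<mu> \<partial>lborel)"
      by (rule nn_integral_add) measurable
    also have "(\<integral>\<^sup>+\<mu>. ennreal (s * Y N powr (s - 1) * (2 * C)) * indicator {0..m} \<mu> \<partial>lborel) = ennreal (E N)"
      unfolding E_def using m by (subst nn_integral_cmult_indicator) (auto simp: ennreal_mult'')
    finally show ?thesis unfolding A B .
  qed
  have BA: "(\<integral>\<^sup>+\<sigma>. indicator {0<..N} \<sigma> * ennreal (b \<sigma>) \<partial>lborel) \<le> (\<integral>\<^sup>+\<sigma>. indicator {0<..N} \<sigma> * ennreal (a \<sigma>) \<partial>lborel)" for N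
  proof -
    have "U (- \<mu>) N \<le> U \<mu> N" if "0 \<le> \<mu>" for \<mu>
    proof -
      have UU: "U \<nu> N = ennreal s * (\<integral>\<^sup>+u. indicator {0<..N + \<nu> / (2 * q)} u * ennreal (tpow (s - 1) (q * u\<^sup>2 - (\<kappa> + \<nu>\<^sup>2 / (4 * q)))) \<partial>lborel)" for \<nu>
        unfolding U_def nn_integral_complete_square[OF q \<kappa>, symmetric] using s by (subst nn_integral_cmult[symmetric]) (auto simp: ennreal_mult' mult_ac)
      have "0 \<le> \<mu> / (2 * q)" using that q by simp
      then have cc: "N + - \<mu> / (2 * q) \<le> N + \<mu> / (2 * q)" unfolding minus_divide_left[symmetric] by linarith
      show ?thesis unfolding UU
      proof (intro mult_left_mono nn_integral_mono)
        fix u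
        show "indicator {0<..N + - \<mu> / (2 * q)} u * ennreal (tpow (s - 1) (q * u\<^sup>2 - (\<kappa> + (- \<mu>)\<^sup>2 / (4 * q)))) \<le>
          indicator {0<..N + \<mu> / (2 * q)} u * ennreal (tpow (s - 1) (q * u\<^sup>2 - (\<kappa> + \<mu>\<^sup>2 / (4 * q))))"
          unfolding power2_minus using cc by (intro mult_right_mono) (auto simp: indicator_def)
      qed simp
    qed
    then show ?thesis unfolding A B by (intro nn_integral_mono) (auto simp: indicator_def)
  qed
  \<comment> \<open>Division by \<sigma> does no harm near 0, since \<open>f 0\<close> vanishes for
    \<sigma> \<le> sqrt (\<kappa> / q). Finiteness allows the two inequalities between A and B to be
    read as inequalities of real integrals.\<close>
  have Bfin: "(\<integral>\<^sup>+\<sigma>. indicator {0<..N} \<sigma> * ennreal (b \<sigma>) \<partial>lborel) < top" if "0 < N" for N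
  proof -
    let ?M = "tpow s (q * N\<^sup>2) / sqrt (\<kappa> / q)"
    have "(\<integral>\<^sup>+\<sigma>. indicator {0<..N} \<sigma> * ennreal (b \<sigma>) \<partial>lborel) \<le> (\<integral>\<^sup>+\<sigma>. ennreal ?M * indicator {0<..N} \<sigma> \<partial>lborel)"
    proof (rule nn_integral_mono)
      fix \<sigma> :: real
      show "indicator {0<..N} \<sigma> * ennreal (b \<sigma>) \<le> ennreal ?M * indicator {0<..N} \<sigma>"
      proof (cases "0 < \<sigma> \<and> \<sigma> \<le> N")
        case True
        have b1: "b \<sigma> \<le> f 0 \<sigma> / \<sigma>" unfolding b_def using True by (intro divide_right_mono) (auto simp: f_def)
        have "f 0 \<sigma> / \<sigma> \<le> ?M"
        proof (cases "0 < q * \<sigma>\<^sup>2 - \<kappa>")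
          case T: True
          have "\<kappa> / q \<le> \<sigma>\<^sup>2" using T q by (simp add: field_simps)
          then have "sqrt (\<kappa> / q) \<le> \<sigma>" using True by (intro real_le_lsqrt) auto
          moreover have "f 0 \<sigma> \<le> tpow s (q * N\<^sup>2)"
            unfolding f_def
          proof (rule tpow_mono)
            have "\<sigma>\<^sup>2 \<le> N\<^sup>2" using True by (intro power_mono) auto
            then have "q * \<sigma>\<^sup>2 \<le> q * N\<^sup>2" using q by simp
            then show "q * \<sigma>\<^sup>2 - \<kappa> + 0 * \<sigma> \<le> q * N\<^sup>2" using \<kappa> by simp
          qed (use s in simp)
          ultimately show ?thesis using q \<kappa> True by (intro frac_le) auto
        qed (use q \<kappa> in \<open>simp add: f_def tpow_neg\<close>)
        then show ?thesis using b1 True by (auto intro: ennreal_leI)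
      qed auto
    qed
    also have "\<dots> < top" using that by (subst nn_integral_cmult_indicator) (auto simp: ennreal_mult_less_top)
    finally show ?thesis .
  qed
  have lim: "\<bar>LINT \<sigma>|lborel. indicator {0<..N} \<sigma> * ((f m \<sigma> + f (- m) \<sigma> - 2 * f 0 \<sigma>) / \<sigma>)\<bar> \<le> E N"
    if N: "C < N" "0 < Y N" for N
  proof -
    have N0: "0 < N" using N C0 by simp
    have Afin: "(\<integral>\<^sup>+\<sigma>. indicator {0<..N} \<sigma> * ennreal (a \<sigma>) \<partial>lborel) < top"
      using AB[OF N] Bfin[OF N0] by (auto intro: le_less_trans simp: less_top)
    have ia: "(\<lambda>\<sigma>. indicator {0<..N} \<sigma> * ennreal (a \<sigma>)) = (\<lambda>\<sigma>. ennreal (indicator {0<..N} \<sigma> * a \<sigma>))"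
      and ib: "(\<lambda>\<sigma>. indicator {0<..N} \<sigma> * ennreal (b \<sigma>)) = (\<lambda>\<sigma>. ennreal (indicator {0<..N} \<sigma> * b \<sigma>))"
      by (auto simp: fun_eq_iff indicator_def)
    have pos: "AE \<sigma> in lborel. 0 \<le> indicator {0<..N} \<sigma> * a \<sigma>" "AE \<sigma> in lborel. 0 \<le> indicator {0<..N} \<sigma> * b \<sigma>"
      using a0 b0 by (auto simp: indicator_def)
    have int: "integrable lborel (\<lambda>\<sigma>. indicator {0<..N} \<sigma> * a \<sigma>)" "integrable lborel (\<lambda>\<sigma>. indicator {0<..N} \<sigma> * b \<sigma>)"
      using Afin Bfin[OF N0] pos unfolding ia ib by (auto intro!: integrableI_nonneg)
    have ea: "(\<integral>\<^sup>+\<sigma>. indicator {0<..N} \<sigma> * ennreal (a \<sigma>) \<partial>lborel) = ennreal (LINT \<sigma>|lborel. indicator {0<..N} \<sigma> * a \<sigma>)"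
      and eb: "(\<integral>\<^sup>+\<sigma>. indicator {0<..N} \<sigma> * ennreal (b \<sigma>) \<partial>lborel) = ennreal (LINT \<sigma>|lborel. indicator {0<..N} \<sigma> * b \<sigma>)"
      unfolding ia ib by (intro nn_integral_eq_integral int pos)+
    have nb: "0 \<le> (LINT \<sigma>|lborel. indicator {0<..N} \<sigma> * b \<sigma>)" by (rule integral_nonneg_AE) (rule pos)
    have na: "0 \<le> (LINT \<sigma>|lborel. indicator {0<..N} \<sigma> * a \<sigma>)" by (rule integral_nonneg_AE) (rule pos)
    have "(LINT \<sigma>|lborel. indicator {0<..N} \<sigma> * a \<sigma>) \<le> (LINT \<sigma>|lborel. indicator {0<..N} \<sigma> * b \<sigma>) + E N"
      using AB[OF N] nb E0[of N] unfolding ea eb by (simp flip: ennreal_plus)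
    moreover have "(LINT \<sigma>|lborel. indicator {0<..N} \<sigma> * b \<sigma>) \<le> (LINT \<sigma>|lborel. indicator {0<..N} \<sigma> * a \<sigma>)"
      using BA[of N] na unfolding ea eb by simp
    moreover have "(LINT \<sigma>|lborel. indicator {0<..N} \<sigma> * ((f m \<sigma> + f (- m) \<sigma> - 2 * f 0 \<sigma>) / \<sigma>)) =
      (LINT \<sigma>|lborel. indicator {0<..N} \<sigma> * a \<sigma>) - (LINT \<sigma>|lborel. indicator {0<..N} \<sigma> * b \<sigma>)"
      unfolding Bochner_Integration.integral_diff[OF int, symmetric]
      by (rule Bochner_Integration.integral_cong) (auto simp: a_def b_def diff_divide_distrib add_divide_distrib algebra_simps)
    ultimately show ?thesis by linarith
  qed
  have Ylim: "filterlim (\<lambda>N::nat. Y (real N)) at_top sequentially"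
  proof -
    have "filterlim (\<lambda>N::nat. - C + real N) at_top sequentially"
      by (intro filterlim_tendsto_add_at_top[OF tendsto_const] filterlim_real_sequentially)
    then have "filterlim (\<lambda>N::nat. real N - C) at_top sequentially"
      by (simp add: add.commute)
    then have "filterlim (\<lambda>N::nat. (real N - C) * (real N - C)) at_top sequentially"
      by (intro filterlim_at_top_mult_at_top)
    then have "filterlim (\<lambda>N::nat. q * ((real N - C) * (real N - C))) at_top sequentially"
      using q by (intro filterlim_tendsto_pos_mult_at_top[OF tendsto_const])
    then have "filterlim (\<lambda>N::nat. - H + q * ((real N - C) * (real N - C))) at_top sequentially"
      by (intro filterlim_tendsto_add_at_top[OF tendsto_const])
    then show ?thesis by (simp add: Y_def power2_eq_square)
  qed
  have "((\<lambda>N::nat. Y (real N) powr (s - 1)) \<longlongrightarrow> 0) sequentially"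
    by (rule tendsto_neg_powr[OF _ Ylim]) (use s in simp)
  then have El: "(\<lambda>N::nat. E (real N)) \<longlonglongrightarrow> 0"
    unfolding E_def by (intro tendsto_mult_left_zero tendsto_mult_right_zero)
  show ?thesis
  proof (rule Lim_null_comparison[OF _ El])
    have "eventually (\<lambda>N::nat. C < real N) sequentially"
      using filterlim_real_sequentially by (simp add: filterlim_at_top_dense)
    moreover have "eventually (\<lambda>N::nat. 0 < Y (real N)) sequentially"
      using Ylim by (simp add: filterlim_at_top_dense)
    ultimately show "eventually (\<lambda>N::nat. norm (LINT \<sigma>|lborel. indicator {0<..real N} \<sigma> * ((f m \<sigma> + f (- m) \<sigma> - 2 * f 0 \<sigma>) / \<sigma>)) \<le> E (real N)) sequentially"
      by eventually_elim (use lim in simp)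
  qed
qed

text \<open>The second difference along a line in the variable \<open>\<sigma> = 1 / t\<close>, where \<open>t\<close> is the position on the line.\<close>

definition line_defect :: "real \<Rightarrow> real \<Rightarrow> real \<Rightarrow> real \<Rightarrow> real \<Rightarrow> real" where
  "line_defect s q \<kappa> m \<sigma> = indicator {0<..} \<sigma> *
     ((2 * (q powr s * \<sigma> powr (2 * s)) - tpow s (q * \<sigma>\<^sup>2 - \<kappa> + m * \<sigma>) - tpow s (q * \<sigma>\<^sup>2 - \<kappa> + (- m) * \<sigma>)) / \<sigma>)"

lemma line_defect_measurable [measurable]: "line_defect s q \<kappa> m \<in> borel_measurable borel"
  unfolding line_defect_def by measurable

lemma line_defect_even: "line_defect s q \<kappa> (- m) = line_defect s q \<kappa> m"
  by (auto simp: line_defect_def fun_eq_iff)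

text \<open>Between the two defects the terms with q^s \<sigma>^(2 s) cancel. What remains is the
  second difference of \<open>line_interior_tendsto\<close>, whose integral is controlled over
  bounded ranges; hence the cut at N before the limit. Negative m follows by evenness.\<close>

lemma integral_line_defect:
  assumes q: "0 < q" and \<kappa>: "0 < \<kappa>" and s: "0 < s" "s < 1"
    and im: "integrable lborel (line_defect s q \<kappa> m)" and i0: "integrable lborel (line_defect s q \<kappa> 0)"
  shows "integral\<^sup>L lborel (line_defect s q \<kappa> m) = integral\<^sup>L lborel (line_defect s q \<kappa> 0)"
proof -
  let ?D = "line_defect s q \<kappa>"
  have *: "integral\<^sup>L lborel (?D m) = integral\<^sup>L lborel (?D 0)" if m: "0 \<le> m" and im: "integrable lborel (?D m)" for m
  proof -
    have trunc: "(\<lambda>N::nat. LINT \<sigma>|lborel. indicator {0<..real N} \<sigma> * g \<sigma>) \<longlonglongrightarrow> integral\<^sup>L lborel (\<lambda>\<sigma>. indicator {0<..} \<sigma> * g \<sigma>)"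
      if g: "integrable lborel (\<lambda>\<sigma>. indicator {0<..} \<sigma> * g \<sigma>)" and [measurable]: "g \<in> borel_measurable borel" for g :: "real \<Rightarrow> real"
    proof (rule integral_dominated_convergence[where w="\<lambda>\<sigma>. norm (indicator {0<..} \<sigma> * g \<sigma>)"])
      show "AE \<sigma> in lborel. (\<lambda>N::nat. indicator {0<..real N} \<sigma> * g \<sigma>) \<longlonglongrightarrow> indicator {0<..} \<sigma> * g \<sigma>"
      proof (rule AE_I2)
        fix \<sigma> :: real
        have "eventually (\<lambda>N::nat. \<sigma> \<le> real N) sequentially"
          using filterlim_real_sequentially by (simp add: filterlim_at_top)
        then have "eventually (\<lambda>N::nat. indicator {0<..real N} \<sigma> * g \<sigma> = indicator {0<..} \<sigma> * g \<sigma>) sequentially"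
          by eventually_elim (auto simp: indicator_def)
        then show "(\<lambda>N::nat. indicator {0<..real N} \<sigma> * g \<sigma>) \<longlonglongrightarrow> indicator {0<..} \<sigma> * g \<sigma>"
          by (rule tendsto_eventually)
      qed
      show "integrable lborel (\<lambda>\<sigma>. norm (indicator {0<..} \<sigma> * g \<sigma>))" using g by (rule integrable_norm)
    qed (auto simp: indicator_def)
    define g where "g m \<sigma> = (2 * (q powr s * \<sigma> powr (2 * s)) - tpow s (q * \<sigma>\<^sup>2 - \<kappa> + m * \<sigma>) - tpow s (q * \<sigma>\<^sup>2 - \<kappa> + (- m) * \<sigma>)) / \<sigma>" for m \<sigma>
    have [measurable]: "g m \<in> borel_measurable borel" for m unfolding g_def by measurable
    have D: "?D m = (\<lambda>\<sigma>. indicator {0<..} \<sigma> * g m \<sigma>)" for m by (simp add: line_defect_def g_def fun_eq_iff)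
    have it: "integrable lborel (\<lambda>\<sigma>. indicator {0<..N} \<sigma> * g m \<sigma>)" if "integrable lborel (?D m)" for N m
    proof (rule Bochner_Integration.integrable_bound[OF that])
      show "AE \<sigma> in lborel. norm (indicator {0<..N} \<sigma> * g m \<sigma>) \<le> norm (?D m \<sigma>)"
        unfolding D by (auto simp: indicator_def)
    qed measurable
    have "(\<lambda>N::nat. (LINT \<sigma>|lborel. indicator {0<..real N} \<sigma> * g 0 \<sigma>) - (LINT \<sigma>|lborel. indicator {0<..real N} \<sigma> * g m \<sigma>)) \<longlonglongrightarrow>
      integral\<^sup>L lborel (?D 0) - integral\<^sup>L lborel (?D m)"
      unfolding D using im i0 by (intro tendsto_diff trunc) (auto simp: D)
    also have "(\<lambda>N::nat. (LINT \<sigma>|lborel. indicator {0<..real N} \<sigma> * g 0 \<sigma>) - (LINT \<sigma>|lborel. indicator {0<..real N} \<sigma> * g m \<sigma>)) =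
      (\<lambda>N::nat. LINT \<sigma>|lborel. indicator {0<..real N} \<sigma> * ((tpow s (q * \<sigma>\<^sup>2 - \<kappa> + m * \<sigma>) + tpow s (q * \<sigma>\<^sup>2 - \<kappa> + (- m) * \<sigma>) - 2 * tpow s (q * \<sigma>\<^sup>2 - \<kappa> + 0 * \<sigma>)) / \<sigma>))"
    proof (rule ext)
      fix N :: nat
      show "(LINT \<sigma>|lborel. indicator {0<..real N} \<sigma> * g 0 \<sigma>) - (LINT \<sigma>|lborel. indicator {0<..real N} \<sigma> * g m \<sigma>) =
        (LINT \<sigma>|lborel. indicator {0<..real N} \<sigma> * ((tpow s (q * \<sigma>\<^sup>2 - \<kappa> + m * \<sigma>) + tpow s (q * \<sigma>\<^sup>2 - \<kappa> + (- m) * \<sigma>) - 2 * tpow s (q * \<sigma>\<^sup>2 - \<kappa> + 0 * \<sigma>)) / \<sigma>))"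
        unfolding Bochner_Integration.integral_diff[OF it[OF i0] it[OF im], symmetric]
        by (rule Bochner_Integration.integral_cong) (auto simp: g_def diff_divide_distrib add_divide_distrib algebra_simps)
    qed
    finally have "integral\<^sup>L lborel (?D 0) - integral\<^sup>L lborel (?D m) = 0"
      using line_interior_tendsto[OF q \<kappa> s m] LIMSEQ_unique by blast
    then show ?thesis by simp
  qed
  show ?thesis
  proof (cases "0 \<le> m")
    case True
    then show ?thesis using * im by blast
  next
    case False
    then show ?thesis using *[of "- m"] im by (simp add: line_defect_even)
  qed
qed

text \<open>At m = 0 the defect is a function of sqrt q \<sigma> divided by \<sigma>, so the factor
  sqrt q is exactly the Jacobian of the dilation.\<close>

lemma line_defect_scale:
  assumes q: "0 < q"
  shows "line_defect s q \<kappa> 0 \<sigma> = sqrt q * line_defect s 1 \<kappa> 0 (sqrt q * \<sigma>)"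
proof (cases "0 < \<sigma>")
  case True
  have "(sqrt q * \<sigma>) powr (2 * s) = (sqrt q * sqrt q) powr s * \<sigma> powr (2 * s)"
    using q True powr_powr[of "sqrt q" 2 s] by (simp add: powr_mult powr_numeral)
  moreover have "sqrt q * sqrt q = q" using q by simp
  ultimately show ?thesis using q True
    by (simp add: line_defect_def power_mult_distrib field_simps)
next
  case False
  then show ?thesis using q by (simp add: line_defect_def zero_less_mult_iff)
qed

text \<open>On a line through x the ball enters through q = R^2 - |x|^2 and the linear coefficient
  m. The shift has removed m and the dilation removes q: neither the radius nor the point is visible
  any more.\<close>

lemma integral_line_defect_normalize:
  assumes q: "0 < q" and \<kappa>: "0 < \<kappa>" and s: "0 < s" "s < 1"
    and im: "integrable lborel (line_defect s q \<kappa> m)" and i1: "integrable lborel (line_defect s 1 \<kappa> 0)"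
  shows "integral\<^sup>L lborel (line_defect s q \<kappa> m) = integral\<^sup>L lborel (line_defect s 1 \<kappa> 0)"
proof -
  have e: "line_defect s q \<kappa> 0 = (\<lambda>\<sigma>. sqrt q * line_defect s 1 \<kappa> 0 (0 + sqrt q * \<sigma>))"
    using line_defect_scale[OF q] by (auto simp: fun_eq_iff)
  have i0: "integrable lborel (line_defect s q \<kappa> 0)"
    unfolding e using lborel_integrable_real_affine[OF i1, of "sqrt q" 0] q by (intro integrable_mult_right) simp
  have "integral\<^sup>L lborel (line_defect s q \<kappa> 0) = integral\<^sup>L lborel (line_defect s 1 \<kappa> 0)"
    unfolding e using lborel_integral_real_affine[of "sqrt q" "line_defect s 1 \<kappa> 0" 0] q by simp
  then show ?thesis using integral_line_defect[OF q \<kappa> s im i0] by simp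
qed

section \<open>Signed integrals in polar coordinates and integrability of the singular
  kernel\<close>

lemma integral_polar_inverse:
  fixes F :: "'a::euclidean_space \<Rightarrow> real"
  assumes F: "integrable lborel F"
  defines "H \<equiv> \<lambda>(\<theta>::'a, \<sigma>). indicator {1<..<2} (norm \<theta>) * (indicator {0<..} \<sigma> * ((1 / \<sigma>) ^ DIM('a) / \<sigma> * F ((1 / \<sigma>) *\<^sub>R \<theta>)))"
  shows "integrable (lborel \<Otimes>\<^sub>M lborel) H" and "integral\<^sup>L (lborel \<Otimes>\<^sub>M lborel) H = ln 2 * integral\<^sup>L lborel F"
proof -
  have *: "has_bochner_integral (lborel \<Otimes>\<^sub>M lborel) (\<lambda>(\<theta>::'a, \<sigma>). indicator {1<..<2} (norm \<theta>) * (indicator {0<..} \<sigma> * ((1 / \<sigma>) ^ DIM('a) / \<sigma> * f ((1 / \<sigma>) *\<^sub>R \<theta>))))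
      (ln 2 * integral\<^sup>L lborel f)" if f: "integrable lborel f" and f0: "\<And>z. 0 \<le> f z" for f :: "'a \<Rightarrow> real"
  proof (rule has_bochner_integral_nn_integral)
    have [measurable]: "f \<in> borel_measurable borel" using f by auto
    show "(\<lambda>(\<theta>::'a, \<sigma>). indicator {1<..<2} (norm \<theta>) * (indicator {0<..} \<sigma> * ((1 / \<sigma>) ^ DIM('a) / \<sigma> * f ((1 / \<sigma>) *\<^sub>R \<theta>)))) \<in> borel_measurable (lborel \<Otimes>\<^sub>M lborel)"
      by measurable
    show "AE x in lborel \<Otimes>\<^sub>M lborel. 0 \<le> (case x of (\<theta>::'a, \<sigma>) \<Rightarrow> indicator {1<..<2} (norm \<theta>) * (indicator {0<..} \<sigma> * ((1 / \<sigma>) ^ DIM('a) / \<sigma> * f ((1 / \<sigma>) *\<^sub>R \<theta>))))"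
      using f0 by (auto simp: indicator_def)
    show "0 \<le> ln 2 * integral\<^sup>L lborel f" using f0 by (simp add: integral_nonneg_AE)
    have "(\<integral>\<^sup>+x. ennreal (case x of (\<theta>::'a, \<sigma>) \<Rightarrow> indicator {1<..<2} (norm \<theta>) * (indicator {0<..} \<sigma> * ((1 / \<sigma>) ^ DIM('a) / \<sigma> * f ((1 / \<sigma>) *\<^sub>R \<theta>)))) \<partial>(lborel \<Otimes>\<^sub>M lborel)) =
      (\<integral>\<^sup>+(\<theta>::'a). (\<integral>\<^sup>+\<sigma>. ennreal (indicator {1<..<2} (norm \<theta>) * (indicator {0<..} \<sigma> * ((1 / \<sigma>) ^ DIM('a) / \<sigma> * f ((1 / \<sigma>) *\<^sub>R \<theta>)))) \<partial>lborel) \<partial>lborel)"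
      by (subst lborel.nn_integral_fst[symmetric]) auto
    also have "\<dots> = (\<integral>\<^sup>+(\<theta>::'a). indicator {1<..<2} (norm \<theta>) * (\<integral>\<^sup>+\<sigma>. indicator {0<..} \<sigma> * (ennreal ((1 / \<sigma>) ^ DIM('a) / \<sigma>) * ennreal (f ((1 / \<sigma>) *\<^sub>R \<theta>))) \<partial>lborel) \<partial>lborel)"
    proof (rule nn_integral_cong)
      fix \<theta> :: 'a
      have "(\<integral>\<^sup>+\<sigma>. ennreal (indicator {1<..<2} (norm \<theta>) * (indicator {0<..} \<sigma> * ((1 / \<sigma>) ^ DIM('a) / \<sigma> * f ((1 / \<sigma>) *\<^sub>R \<theta>)))) \<partial>lborel) =
        (\<integral>\<^sup>+\<sigma>. indicator {1<..<2} (norm \<theta>) * (indicator {0<..} \<sigma> * (ennreal ((1 / \<sigma>) ^ DIM('a) / \<sigma>) * ennreal (f ((1 / \<sigma>) *\<^sub>R \<theta>)))) \<partial>lborel)"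
        using f0 by (intro nn_integral_cong) (auto simp: indicator_def ennreal_mult''[symmetric])
      also have "\<dots> = indicator {1<..<2} (norm \<theta>) * (\<integral>\<^sup>+\<sigma>. indicator {0<..} \<sigma> * (ennreal ((1 / \<sigma>) ^ DIM('a) / \<sigma>) * ennreal (f ((1 / \<sigma>) *\<^sub>R \<theta>))) \<partial>lborel)"
        by (rule nn_integral_cmult) measurable
      finally show "(\<integral>\<^sup>+\<sigma>. ennreal (indicator {1<..<2} (norm \<theta>) * (indicator {0<..} \<sigma> * ((1 / \<sigma>) ^ DIM('a) / \<sigma> * f ((1 / \<sigma>) *\<^sub>R \<theta>)))) \<partial>lborel) = \<dots>" .
    qed
    also have "\<dots> = ennreal (ln 2) * (\<integral>\<^sup>+z. ennreal (f z) \<partial>lborel)"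
      by (rule nn_integral_polar_inverse[symmetric]) measurable
    also have "\<dots> = ennreal (ln 2 * integral\<^sup>L lborel f)"
      using f0 by (subst nn_integral_eq_integral[OF f]) (auto simp: ennreal_mult' integral_nonneg_AE)
    finally show "(\<integral>\<^sup>+x. ennreal (case x of (\<theta>::'a, \<sigma>) \<Rightarrow> indicator {1<..<2} (norm \<theta>) * (indicator {0<..} \<sigma> * ((1 / \<sigma>) ^ DIM('a) / \<sigma> * f ((1 / \<sigma>) *\<^sub>R \<theta>)))) \<partial>(lborel \<Otimes>\<^sub>M lborel)) = ennreal (ln 2 * integral\<^sup>L lborel f)" .
  qed
  let ?p = "\<lambda>z. max 0 (F z)" and ?m = "\<lambda>z. max 0 (- F z)"
  have ip: "integrable lborel ?p" "integrable lborel ?m" using F by auto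
  have "F = (\<lambda>z. ?p z - ?m z)" by (auto simp: fun_eq_iff max_def)
  then have "integral\<^sup>L lborel F = integral\<^sup>L lborel (\<lambda>z. ?p z - ?m z)" by simp
  then have I: "integral\<^sup>L lborel F = integral\<^sup>L lborel ?p - integral\<^sup>L lborel ?m"
    using Bochner_Integration.integral_diff[OF ip] by simp
  have HH: "H = (\<lambda>x. (case x of (\<theta>::'a, \<sigma>) \<Rightarrow> indicator {1<..<2} (norm \<theta>) * (indicator {0<..} \<sigma> * ((1 / \<sigma>) ^ DIM('a) / \<sigma> * ?p ((1 / \<sigma>) *\<^sub>R \<theta>)))) -
    (case x of (\<theta>::'a, \<sigma>) \<Rightarrow> indicator {1<..<2} (norm \<theta>) * (indicator {0<..} \<sigma> * ((1 / \<sigma>) ^ DIM('a) / \<sigma> * ?m ((1 / \<sigma>) *\<^sub>R \<theta>)))))"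
    by (auto simp: H_def fun_eq_iff max_def)
  have "has_bochner_integral (lborel \<Otimes>\<^sub>M lborel) H (ln 2 * integral\<^sup>L lborel ?p - ln 2 * integral\<^sup>L lborel ?m)"
    unfolding HH by (rule has_bochner_integral_diff) (intro * ip; simp)+
  then have "has_bochner_integral (lborel \<Otimes>\<^sub>M lborel) H (ln 2 * integral\<^sup>L lborel F)"
    unfolding I by (simp add: algebra_simps)
  then show "integrable (lborel \<Otimes>\<^sub>M lborel) H" "integral\<^sup>L (lborel \<Otimes>\<^sub>M lborel) H = ln 2 * integral\<^sup>L lborel F"
    by (auto simp: has_bochner_integral_iff)
qed

definition kern :: "real \<Rightarrow> 'a::euclidean_space \<Rightarrow> real" where
  "kern s z = norm z powr - (real DIM('a) + 2 * s)"

lemma kern_measurable [measurable]: "kern s \<in> borel_measurable borel"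
  unfolding kern_def by measurable

lemma kern_nonneg [simp]: "0 \<le> kern s z"
  by (simp add: kern_def)

lemma kern_minus [simp]: "kern s (- z) = kern s z"
  by (simp add: kern_def)

lemma nn_integral_powr_far_finite:
  assumes \<alpha>: "0 < \<alpha>"
  shows "(\<integral>\<^sup>+(z::'a::euclidean_space). ennreal (indicator {1..} (norm z) * norm z powr - (real DIM('a) + \<alpha>)) \<partial>lborel) < top" (is "?L < _")
proof -
  let ?n = "DIM('a)"
  let ?F = "\<lambda>z::'a. ennreal (indicator {1..} (norm z) * norm z powr - (real ?n + \<alpha>))"
  let ?C = "\<integral>\<^sup>+\<tau>. ennreal (\<tau> powr (- \<alpha> - 1)) * indicator {1/2..} \<tau> \<partial>lborel"
  have C: "?C < top"
  proof -
    have "((\<lambda>\<tau>. - (\<tau> powr - \<alpha>) / \<alpha>) \<longlongrightarrow> - 0 / \<alpha>) at_top"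
      by (intro tendsto_intros tendsto_neg_powr filterlim_ident) (use \<alpha> in auto)
    moreover have "DERIV (\<lambda>\<tau>. - (\<tau> powr - \<alpha>) / \<alpha>) x :> x powr (- \<alpha> - 1)" if "1/2 \<le> x" for x
      using that \<alpha> by (auto intro!: derivative_eq_intros)
    ultimately have "?C = ennreal (- 0 / \<alpha> - (- ((1/2) powr - \<alpha>) / \<alpha>))"
      by (intro nn_integral_FTC_atLeast) auto
    then show ?thesis by simp
  qed
  show ?thesis
  proof (rule nn_integral_polar_finite)
    show "?C < top" by (rule C)
    fix \<theta> :: 'a assume "1 < norm \<theta>" "norm \<theta> < 2"
    then have th: "1 < norm \<theta> \<and> norm \<theta> < 2" by simp
    show "(\<integral>\<^sup>+\<tau>. indicator {0<..} \<tau> * (ennreal (\<tau> ^ ?n / \<tau>) * ?F (\<tau> *\<^sub>R \<theta>)) \<partial>lborel) \<le> ?C"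
    proof (rule nn_integral_mono)
      fix \<tau> :: real
      show "indicator {0<..} \<tau> * (ennreal (\<tau> ^ ?n / \<tau>) * ?F (\<tau> *\<^sub>R \<theta>)) \<le> ennreal (\<tau> powr (- \<alpha> - 1)) * indicator {1/2..} \<tau>"
      proof (cases "0 < \<tau> \<and> 1 \<le> \<tau> * norm \<theta>")
        case T: True
        have "\<tau> * norm \<theta> \<le> \<tau> * 2" using T th by (intro mult_left_mono) auto
        then have t2: "1/2 \<le> \<tau>" using T by linarith
        have "norm \<theta> powr - (real ?n + \<alpha>) \<le> 1 powr - (real ?n + \<alpha>)" using th \<alpha> by (intro powr_mono2') auto
        then have n1: "norm \<theta> powr - (real ?n + \<alpha>) \<le> 1" by simp
        have "\<tau> ^ ?n / \<tau> * (\<tau> * norm \<theta>) powr - (real ?n + \<alpha>) = (\<tau> powr (real ?n + (-1) + - (real ?n + \<alpha>))) * norm \<theta> powr - (real ?n + \<alpha>)"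
          unfolding powr_add using T by (simp add: powr_mult powr_realpow powr_minus[of \<tau> 1] divide_inverse)
        also have "real ?n + (-1) + - (real ?n + \<alpha>) = - \<alpha> - 1" by simp
        also have "\<tau> powr (- \<alpha> - 1) * norm \<theta> powr - (real ?n + \<alpha>) \<le> \<tau> powr (- \<alpha> - 1)"
          using n1 by (simp add: mult_left_le)
        finally have "\<tau> ^ ?n / \<tau> * (\<tau> * norm \<theta>) powr - (real ?n + \<alpha>) \<le> \<tau> powr (- \<alpha> - 1)" .
        then have "ennreal (\<tau> ^ ?n / \<tau>) * ennreal ((\<tau> * norm \<theta>) powr - (real ?n + \<alpha>)) \<le> ennreal (\<tau> powr (- \<alpha> - 1))"
          by (subst ennreal_mult''[symmetric]) (auto intro: ennreal_leI)
        then show ?thesis using T t2 by (simp add: indicator_def)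
      qed (auto simp: indicator_def)
    qed
  qed measurable
qed

lemma nn_integral_powr_near_finite:
  assumes \<beta>: "0 < \<beta>"
  shows "(\<integral>\<^sup>+(z::'a::euclidean_space). ennreal (indicator {..<1} (norm z) * norm z powr (\<beta> - real DIM('a))) \<partial>lborel) < top" (is "?L < _")
proof -
  let ?n = "DIM('a)"
  let ?F = "\<lambda>z::'a. ennreal (indicator {..<1} (norm z) * norm z powr (\<beta> - real ?n))"
  let ?C = "\<integral>\<^sup>+\<tau>. ennreal (\<beta> * tpow (\<beta> - 1) \<tau>) * indicator {0..1} \<tau> \<partial>lborel"
  have C: "?C < top"
    using nn_integral_tpow_FTC[OF \<beta>, of 0 1] by simp
  let ?K = "ennreal (2 powr \<beta> / \<beta>)"
  show ?thesis
  proof (rule nn_integral_polar_finite)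
    show "?K * ?C < top" using C by (simp add: ennreal_mult_less_top)
    fix \<theta> :: 'a assume "1 < norm \<theta>" "norm \<theta> < 2"
    then have th: "1 < norm \<theta> \<and> norm \<theta> < 2" by simp
    have "(\<integral>\<^sup>+\<tau>. indicator {0<..} \<tau> * (ennreal (\<tau> ^ ?n / \<tau>) * ?F (\<tau> *\<^sub>R \<theta>)) \<partial>lborel) \<le> (\<integral>\<^sup>+\<tau>. ?K * (ennreal (\<beta> * tpow (\<beta> - 1) \<tau>) * indicator {0..1} \<tau>) \<partial>lborel)"
    proof (rule nn_integral_mono)
      fix \<tau> :: real
      show "indicator {0<..} \<tau> * (ennreal (\<tau> ^ ?n / \<tau>) * ?F (\<tau> *\<^sub>R \<theta>)) \<le> ?K * (ennreal (\<beta> * tpow (\<beta> - 1) \<tau>) * indicator {0..1} \<tau>)"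
      proof (cases "0 < \<tau> \<and> \<tau> * norm \<theta> < 1")
        case T: True
        have "\<tau> * 1 \<le> \<tau> * norm \<theta>" using T th by (intro mult_left_mono) auto
        then have t2: "\<tau> \<le> 1" using T by linarith
        have "norm \<theta> powr (\<beta> - real ?n) \<le> norm \<theta> powr \<beta>" using th by (intro powr_mono) auto
        also have "\<dots> \<le> 2 powr \<beta>" using th \<beta> by (intro powr_mono2) auto
        finally have n1: "norm \<theta> powr (\<beta> - real ?n) \<le> 2 powr \<beta>" .
        have "\<tau> ^ ?n / \<tau> * (\<tau> * norm \<theta>) powr (\<beta> - real ?n) = (\<tau> powr (real ?n + (-1) + (\<beta> - real ?n))) * norm \<theta> powr (\<beta> - real ?n)"
          unfolding powr_add using T by (simp add: powr_mult powr_realpow powr_minus[of \<tau> 1] divide_inverse)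
        also have "real ?n + (-1) + (\<beta> - real ?n) = \<beta> - 1" by simp
        also have "\<tau> powr (\<beta> - 1) * norm \<theta> powr (\<beta> - real ?n) \<le> \<tau> powr (\<beta> - 1) * 2 powr \<beta>"
          using n1 by (intro mult_left_mono) auto
        also have "\<dots> = (2 powr \<beta> / \<beta>) * (\<beta> * tpow (\<beta> - 1) \<tau>)" using T \<beta> by (simp add: tpow_def)
        finally have "\<tau> ^ ?n / \<tau> * (\<tau> * norm \<theta>) powr (\<beta> - real ?n) \<le> (2 powr \<beta> / \<beta>) * (\<beta> * tpow (\<beta> - 1) \<tau>)" .
        then have "ennreal (\<tau> ^ ?n / \<tau> * (\<tau> * norm \<theta>) powr (\<beta> - real ?n)) \<le> ennreal ((2 powr \<beta> / \<beta>) * (\<beta> * tpow (\<beta> - 1) \<tau>))"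
          by (rule ennreal_leI)
        then have "ennreal (\<tau> ^ ?n / \<tau>) * ennreal ((\<tau> * norm \<theta>) powr (\<beta> - real ?n)) \<le> ?K * ennreal (\<beta> * tpow (\<beta> - 1) \<tau>)"
          using \<beta> by (subst (asm) ennreal_mult'', simp, subst (asm) ennreal_mult, auto)
        then show ?thesis using T t2 by (simp add: indicator_def)
      qed (auto simp: indicator_def)
    qed
    also have "\<dots> = ?K * ?C" by (rule nn_integral_cmult) measurable
    finally show "(\<integral>\<^sup>+\<tau>. indicator {0<..} \<tau> * (ennreal (\<tau> ^ ?n / \<tau>) * ?F (\<tau> *\<^sub>R \<theta>)) \<partial>lborel) \<le> ?K * ?C" .
  qed measurable
qed

text \<open>The comparison function for second differences: order |z|^\<beta> with \<beta> > 2 s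
  compensates the singularity at 0, and boundedness suffices at infinity.\<close>

lemma integrable_min_kern:
  assumes s: "0 < s" and \<beta>: "2 * s < \<beta>"
  shows "integrable lborel (\<lambda>z::'a::euclidean_space. min 1 (norm z powr \<beta>) * kern s z)"
proof (rule integrableI_nonneg)
  have "(\<integral>\<^sup>+(z::'a). ennreal (min 1 (norm z powr \<beta>) * kern s z) \<partial>lborel) \<le>
    (\<integral>\<^sup>+(z::'a). ennreal (indicator {1..} (norm z) * norm z powr - (real DIM('a) + 2 * s)) +
       ennreal (indicator {..<1} (norm z) * norm z powr ((\<beta> - 2 * s) - real DIM('a))) \<partial>lborel)"
  proof (rule nn_integral_mono)
    fix z :: 'a
    show "ennreal (min 1 (norm z powr \<beta>) * kern s z) \<le> ennreal (indicator {1..} (norm z) * norm z powr - (real DIM('a) + 2 * s)) +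
       ennreal (indicator {..<1} (norm z) * norm z powr ((\<beta> - 2 * s) - real DIM('a)))"
    proof (cases "norm z < 1")
      case True
      have "min 1 (norm z powr \<beta>) * kern s z \<le> norm z powr \<beta> * norm z powr - (real DIM('a) + 2 * s)"
        unfolding kern_def by (intro mult_right_mono) auto
      also have "\<dots> = norm z powr ((\<beta> - 2 * s) - real DIM('a))"
        unfolding powr_add[symmetric] by (rule arg_cong[where f="\<lambda>y. norm z powr y"]) simp
      finally show ?thesis using True by (simp add: ennreal_leI)
    next
      case False
      have "min 1 (norm z powr \<beta>) * kern s z \<le> 1 * kern s z" by (intro mult_right_mono) auto
      then show ?thesis using False by (simp add: ennreal_leI kern_def)
    qed
  qed
  also have "\<dots> = (\<integral>\<^sup>+(z::'a). ennreal (indicator {1..} (norm z) * norm z powr - (real DIM('a) + 2 * s)) \<partial>lborel) +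
     (\<integral>\<^sup>+(z::'a). ennreal (indicator {..<1} (norm z) * norm z powr ((\<beta> - 2 * s) - real DIM('a))) \<partial>lborel)"
    by (rule nn_integral_add) measurable
  also have "\<dots> < top" using nn_integral_powr_far_finite[of "2 * s", where 'a='a] nn_integral_powr_near_finite[of "\<beta> - 2 * s", where 'a='a] s \<beta>
    by (simp add: ennreal_add_less_top)
  finally show "(\<integral>\<^sup>+(z::'a). ennreal (min 1 (norm z powr \<beta>) * kern s z) \<partial>lborel) < \<infinity>" by simp
qed auto

section \<open>Second differences of the torsion function of the ball\<close>

text \<open>Weighted convexity of exp between 0 and ln t.\<close>

lemma powr_le_tangent:
  fixes t s :: real
  assumes s: "0 < s" "s < 1" and t: "0 \<le> t"
  shows "t powr s \<le> 1 + s * (t - 1)"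
proof (cases "t = 0")
  case False
  have "exp ((1 - s) * 0 + s * ln t) \<le> (1 - s) * exp 0 + s * exp (ln t)"
    using convex_onD[OF exp_convex, of s 0 "ln t"] s by simp
  then show ?thesis using False t by (simp add: powr_def algebra_simps)
qed (use s in simp)

text \<open>The bound 1 + (s - 1) (t - 1) for t^(s - 1), multiplied by t. Unlike a Taylor estimate
  it holds down to t = 0, so points x + z arbitrarily close to the sphere are covered.\<close>

lemma powr_ge_tangent:
  fixes t s :: real
  assumes s: "0 < s" "s < 1" and t: "0 \<le> t"
  shows "1 + s * (t - 1) - (t - 1)\<^sup>2 \<le> t powr s"
proof (cases "t = 0")
  case False
  then have t0: "0 < t" using t by simp
  have "(s - 1) * (t - 1) \<le> (s - 1) * ln t" using s ln_le_minus_one[OF t0] by (intro mult_left_mono_neg) auto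
  then have "1 + (s - 1) * (t - 1) \<le> exp ((s - 1) * ln t)" using exp_ge_add_one_self[of "(s - 1) * ln t"] by linarith
  then have "t * (1 + (s - 1) * (t - 1)) \<le> t * t powr (s - 1)" using t0 by (simp add: powr_def)
  also have "t * t powr (s - 1) = t powr s" using t0 powr_add[of t 1 "s - 1"] by simp
  finally have "1 + s * (t - 1) - (t - 1)\<^sup>2 + s * (t - 1)\<^sup>2 \<le> t powr s"
    by (simp add: power2_eq_square algebra_simps)
  moreover have "0 \<le> s * (t - 1)\<^sup>2" using s by simp
  ultimately show ?thesis by linarith
qed (use s in simp)

definition sdiff :: "('a::real_vector \<Rightarrow> real) \<Rightarrow> 'a \<Rightarrow> 'a \<Rightarrow> real" where
  "sdiff f x z = 2 * f x - f (x + z) - f (x - z)"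

text \<open>The torsion function of the ball of radius R, up to a constant; \<open>tpow\<close>
  extends it by 0 outside the ball.\<close>

definition bump :: "real \<Rightarrow> real \<Rightarrow> 'a::euclidean_space \<Rightarrow> real" where
  "bump s R x = tpow s (R\<^sup>2 - (norm x)\<^sup>2)"

lemma bump_nonneg [simp]: "0 \<le> bump s R x"
  by (simp add: bump_def)

lemma continuous_bump: "0 < s \<Longrightarrow> continuous_on UNIV (bump s R :: 'a::euclidean_space \<Rightarrow> real)"
  unfolding bump_def
  by (rule continuous_on_compose2[OF continuous_on_tpow]) (auto intro!: continuous_intros)

lemma bump_measurable [measurable]: "bump s R \<in> borel_measurable borel"
  unfolding bump_def by measurable

lemma bump_outside: "0 < R \<Longrightarrow> R \<le> norm x \<Longrightarrow> bump s R x = 0"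
  unfolding bump_def by (intro tpow_neg) (simp add: power_mono)

lemma bump_le: "0 < s \<Longrightarrow> 0 < R \<Longrightarrow> bump s R x \<le> R powr (2 * s)"
proof -
  assume s: "0 < s" and R: "0 < R"
  have "bump s R x \<le> tpow s (R\<^sup>2)" unfolding bump_def using s by (intro tpow_mono) auto
  also have "\<dots> = R powr (2 * s)" using R powr_powr[of R 2 s] by (simp add: tpow_def powr_numeral)
  finally show ?thesis .
qed

lemma norm_parallelogram:
  fixes x z :: "'a::real_inner"
  shows "(norm (x + z))\<^sup>2 + (norm (x - z))\<^sup>2 = 2 * (norm x)\<^sup>2 + 2 * (norm z)\<^sup>2"
  unfolding power2_norm_eq_inner by (simp add: inner_add_left inner_add_right inner_diff_left inner_diff_right)

text \<open>Dividing by q, the value of R^2 - |.|^2 at x, makes the tangent inequalities at 1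
  applicable. By the parallelogram law the first-order terms at x + z and x - z add up to - 2 s
  |z|^2 / q, so only quadratic quantities remain.\<close>

lemma sdiff_bump_estimates:
  fixes x z :: "'a::euclidean_space"
  assumes s: "0 < s" "s < 1" and R: "0 < R" and x: "norm x < R" and z: "norm (x + z) \<le> R" "norm (x - z) \<le> R"
  defines "q \<equiv> R\<^sup>2 - (norm x)\<^sup>2"
  shows "0 \<le> sdiff (bump s R) x z"
    and "sdiff (bump s R) x z \<le> q powr s * (2 * s * (norm z)\<^sup>2 / q + (((norm x)\<^sup>2 - (norm (x + z))\<^sup>2) / q)\<^sup>2 + (((norm x)\<^sup>2 - (norm (x - z))\<^sup>2) / q)\<^sup>2)"
proof -
  have q: "0 < q" using x R by (simp add: q_def power_strict_mono)
  define A where "A = (R\<^sup>2 - (norm (x + z))\<^sup>2) / q"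
  define B where "B = (R\<^sup>2 - (norm (x - z))\<^sup>2) / q"
  have A0: "0 \<le> A" "0 \<le> B" using z R q by (auto simp: A_def B_def power_mono)
  have t: "tpow s Y = q powr s * (Y / q) powr s" if "0 \<le> Y" for Y
    using that q s by (simp add: tpow_def powr_divide)
  have bA: "bump s R (x + z) = q powr s * A powr s" "bump s R (x - z) = q powr s * B powr s" "bump s R x = q powr s"
    unfolding bump_def A_def B_def using z R q by (auto intro!: t simp: power_mono q_def[symmetric] tpow_pos)
  have S: "sdiff (bump s R) x z = q powr s * (2 - A powr s - B powr s)"
    unfolding sdiff_def bA by (simp add: algebra_simps)
  have AB: "A - 1 = ((norm x)\<^sup>2 - (norm (x + z))\<^sup>2) / q" "B - 1 = ((norm x)\<^sup>2 - (norm (x - z))\<^sup>2) / q"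
    using q by (simp_all add: A_def B_def q_def field_simps)
  have sum: "(A - 1) + (B - 1) = - (2 * (norm z)\<^sup>2 / q)"
    unfolding AB add_divide_distrib[symmetric] minus_divide_left using norm_parallelogram[of x z] by (intro arg_cong2[where f="(/)"]) auto
  have zq: "0 \<le> 2 * (norm z)\<^sup>2 / q" using q by simp
  have sAB: "s * (A - 1) + s * (B - 1) = - (2 * s * (norm z)\<^sup>2 / q)"
    using arg_cong[OF sum, of "\<lambda>y. s * y"] by (simp add: algebra_simps)
  have "A powr s + B powr s \<le> 2 + (s * (A - 1) + s * (B - 1))"
    using powr_le_tangent[OF s A0(1)] powr_le_tangent[OF s A0(2)] by linarith
  moreover have "0 \<le> 2 * s * (norm z)\<^sup>2 / q" using s q by simp
  ultimately have "0 \<le> 2 - A powr s - B powr s" unfolding sAB by linarith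
  then show "0 \<le> sdiff (bump s R) x z" unfolding S by simp
  have "2 + (s * (A - 1) + s * (B - 1)) - (A - 1)\<^sup>2 - (B - 1)\<^sup>2 \<le> A powr s + B powr s"
    using powr_ge_tangent[OF s A0(1)] powr_ge_tangent[OF s A0(2)] by linarith
  then have "2 - A powr s - B powr s \<le> 2 * s * (norm z)\<^sup>2 / q + (A - 1)\<^sup>2 + (B - 1)\<^sup>2" unfolding sAB by linarith
  then show "sdiff (bump s R) x z \<le> q powr s * (2 * s * (norm z)\<^sup>2 / q + (((norm x)\<^sup>2 - (norm (x + z))\<^sup>2) / q)\<^sup>2 + (((norm x)\<^sup>2 - (norm (x - z))\<^sup>2) / q)\<^sup>2)"
    unfolding S AB by (intro mult_left_mono) auto
qed

text \<open>If both points stay in the ball, the tangent estimates apply. If one leaves it while |z|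
  \<le> 1, then |z| is at least q / L, and the crude bound M is itself at most M (L / q)^2 |z|^2.
  The constant obtained degenerates as x approaches the sphere, so integrability in x has to come
  from elsewhere, see \<open>sdiff_bump_L1\<close>.\<close>

lemma sdiff_bump_bound:
  fixes x :: "'a::euclidean_space"
  assumes s: "0 < s" "s < 1" and R: "0 < R" and x: "norm x < R"
  shows "\<exists>C\<ge>0. \<forall>z. \<bar>sdiff (bump s R) x z\<bar> \<le> C * min 1 (norm z powr 2)"
proof -
  define q where "q = R\<^sup>2 - (norm x)\<^sup>2"
  have q: "0 < q" using x R by (simp add: q_def power_strict_mono)
  \<comment> \<open>For |x| < R a step z with |z| \<le> 1 changes the squared norm by at most (2 R +
    1) |z|.\<close>
  define L where "L = 2 * R + 1"
  have L: "0 < L" using R by (simp add: L_def)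
  have near: "\<bar>(norm x)\<^sup>2 - (norm (x + z))\<^sup>2\<bar> \<le> L * norm z" if "norm z \<le> 1" for z
  proof -
    have "(norm x)\<^sup>2 - (norm (x + z))\<^sup>2 = - (2 * (x \<bullet> z)) - norm z * norm z"
    proof -
      have "(norm (x + z))\<^sup>2 = (norm x)\<^sup>2 + 2 * (x \<bullet> z) + (norm z)\<^sup>2"
        unfolding power2_norm_eq_inner by (simp add: inner_add_left inner_add_right inner_commute)
      then show ?thesis by (simp add: power2_eq_square[of "norm z"])
    qed
    moreover have "\<bar>x \<bullet> z\<bar> \<le> R * norm z"
      using Cauchy_Schwarz_ineq2[of x z] x mult_right_mono[of "norm x" R "norm z"] by auto
    moreover have "norm z * norm z \<le> 1 * norm z" using that by (intro mult_right_mono) auto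
    moreover have "0 \<le> norm z * norm z" by simp
    ultimately have "\<bar>(norm x)\<^sup>2 - (norm (x + z))\<^sup>2\<bar> \<le> 2 * (R * norm z) + norm z" by linarith
    then show ?thesis by (simp add: L_def algebra_simps)
  qed
  define C1 where "C1 = q powr s * (2 * s / q + 2 * (L / q)\<^sup>2)"
  define M where "M = 2 * R powr (2 * s)"
  define C where "C = C1 + M + M * (L / q)\<^sup>2"
  have C1: "0 \<le> C1" using q s by (simp add: C1_def)
  have M: "0 \<le> M" by (simp add: M_def)
  have crude: "\<bar>sdiff (bump s R) x z\<bar> \<le> M" for z
    using bump_le[OF s(1) R, of x] bump_le[OF s(1) R, of "x + z"] bump_le[OF s(1) R, of "x - z"]
      bump_nonneg[of s R x] bump_nonneg[of s R "x + z"] bump_nonneg[of s R "x - z"]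
    unfolding sdiff_def M_def abs_le_iff by linarith
  have "\<bar>sdiff (bump s R) x z\<bar> \<le> C * min 1 (norm z powr 2)" for z
  proof (cases "norm z \<le> 1")
    case True
    then have m: "min 1 (norm z powr 2) = (norm z)\<^sup>2"
      by (simp add: min_absorb2 power_le_one)
    have near2: "\<bar>(norm x)\<^sup>2 - (norm (x - z))\<^sup>2\<bar> \<le> L * norm z" using near[of "- z"] True by simp
    have sq: "(y / q)\<^sup>2 \<le> (L / q)\<^sup>2 * (norm z)\<^sup>2" if "\<bar>y\<bar> \<le> L * norm z" for y
    proof -
      have "y\<^sup>2 \<le> (L * norm z)\<^sup>2" using that L by (intro abs_le_square_iff[THEN iffD1]) simp
      then show ?thesis using q by (simp add: power_divide power_mult_distrib divide_right_mono)
    qed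
    have "\<bar>sdiff (bump s R) x z\<bar> \<le> (C1 + M * (L / q)\<^sup>2) * (norm z)\<^sup>2"
    proof (cases "norm (x + z) \<le> R \<and> norm (x - z) \<le> R")
      case T: True
      note est = sdiff_bump_estimates[OF s R x T[THEN conjunct1] T[THEN conjunct2], folded q_def]
      have "sdiff (bump s R) x z \<le> q powr s * (2 * s * (norm z)\<^sup>2 / q + (L / q)\<^sup>2 * (norm z)\<^sup>2 + (L / q)\<^sup>2 * (norm z)\<^sup>2)"
        using sq[OF near[OF True]] sq[OF near2] by (intro order.trans[OF est(2)] mult_left_mono add_mono) auto
      also have "\<dots> = C1 * (norm z)\<^sup>2" by (simp add: C1_def algebra_simps)
      also have "\<dots> \<le> (C1 + M * (L / q)\<^sup>2) * (norm z)\<^sup>2" using M by (intro mult_right_mono) auto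
      finally show ?thesis using est(1) by simp
    next
      case F: False
      have "q \<le> L * norm z"
      proof (cases "norm (x + z) \<le> R")
        case False
        then have "R\<^sup>2 \<le> (norm (x + z))\<^sup>2" using R by (intro power_mono) auto
        then show ?thesis using near[OF True] by (simp add: q_def)
      next
        case True
        then have "R\<^sup>2 \<le> (norm (x - z))\<^sup>2" using R F by (intro power_mono) auto
        then show ?thesis using near2 by (simp add: q_def)
      qed
      then have "1 \<le> L / q * norm z" using q by (simp add: field_simps)
      then have "1 \<le> (L / q * norm z)\<^sup>2" by (simp add: one_le_power)
      then have "M * 1 \<le> M * ((L / q)\<^sup>2 * (norm z)\<^sup>2)" using M unfolding power_mult_distrib by (rule mult_left_mono)
      also have "\<dots> \<le> (C1 + M * (L / q)\<^sup>2) * (norm z)\<^sup>2" using C1 by (simp add: distrib_right mult.assoc)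
      finally show ?thesis using crude[of z] by simp
    qed
    also have "\<dots> \<le> C * (norm z)\<^sup>2" using M by (intro mult_right_mono) (auto simp: C_def)
    finally show ?thesis unfolding m .
  next
    case False
    then have "1 \<le> norm z powr 2" by (simp add: one_le_power)
    then have m: "min 1 (norm z powr 2) = 1" by simp
    have "0 \<le> M * (L / q)\<^sup>2" using M by simp
    then show ?thesis unfolding m C_def mult_1_right using crude[of z] C1 by linarith
  qed
  moreover have "0 \<le> C" using C1 M by (simp add: C_def)
  ultimately show ?thesis by blast
qed

lemma sdiff_measurable [measurable]:
  fixes f :: "'a::euclidean_space \<Rightarrow> real"
  assumes [measurable]: "f \<in> borel_measurable borel"
  shows "(\<lambda>(x, z). sdiff f x z) \<in> borel_measurable (borel \<Otimes>\<^sub>M borel)"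
  unfolding sdiff_def by measurable

lemma integrable_sdiff_bump:
  fixes x :: "'a::euclidean_space"
  assumes s: "0 < s" "s < 1" and R: "0 < R" and x: "norm x < R"
  shows "integrable lborel (\<lambda>z. sdiff (bump s R) x z * kern s z)"
proof -
  obtain C where C: "0 \<le> C" "\<And>z. \<bar>sdiff (bump s R) x z\<bar> \<le> C * min 1 (norm z powr 2)"
    using sdiff_bump_bound[OF s R x] by blast
  have "integrable lborel (\<lambda>z::'a. C * (min 1 (norm z powr 2) * kern s z))"
    by (intro integrable_mult_right integrable_min_kern) (use s in auto)
  then show ?thesis
  proof (rule Bochner_Integration.integrable_bound)
    show "AE z in lborel. norm (sdiff (bump s R) x z * kern s z) \<le> norm (C * (min 1 (norm z powr 2) * kern s z))"
    proof (rule AE_I2)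
      fix z :: 'a
      have "\<bar>sdiff (bump s R) x z\<bar> * kern s z \<le> C * min 1 (norm z powr 2) * kern s z"
        using C(2)[of z] by (intro mult_right_mono) auto
      then show "norm (sdiff (bump s R) x z * kern s z) \<le> norm (C * (min 1 (norm z powr 2) * kern s z))"
        using C(1) by (simp add: abs_mult mult.assoc)
    qed
  qed measurable
qed

lemma sdiff_bump_line:
  fixes x \<theta> :: "'a::euclidean_space"
  assumes \<sigma>: "0 < \<sigma>" and R: "0 < R" and x: "norm x < R"
  shows "(1 / \<sigma>) ^ DIM('a) / \<sigma> * (sdiff (bump s R) x ((1 / \<sigma>) *\<^sub>R \<theta>) * kern s ((1 / \<sigma>) *\<^sub>R \<theta>)) =
    kern s \<theta> * line_defect s (R\<^sup>2 - (norm x)\<^sup>2) ((norm \<theta>)\<^sup>2) (- 2 * (x \<bullet> \<theta>)) \<sigma>"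
proof -
  define q where "q = R\<^sup>2 - (norm x)\<^sup>2"
  have q: "0 < q" using x R by (simp add: q_def power_strict_mono)
  have bz: "bump s R (x + (1 / \<sigma>) *\<^sub>R t) = \<sigma> powr (- 2 * s) * tpow s (q * \<sigma>\<^sup>2 - (norm t)\<^sup>2 + (- 2 * (x \<bullet> t)) * \<sigma>)" for t :: 'a
  proof -
    have nn: "(norm (x + (1 / \<sigma>) *\<^sub>R t))\<^sup>2 = (norm x)\<^sup>2 + 2 * (x \<bullet> t) / \<sigma> + (norm t)\<^sup>2 / \<sigma>\<^sup>2"
      unfolding power2_norm_eq_inner using \<sigma>
      by (simp add: inner_add_left inner_add_right inner_commute power2_eq_square field_simps)
    have eq: "R\<^sup>2 - (norm (x + (1 / \<sigma>) *\<^sub>R t))\<^sup>2 = (1 / \<sigma>\<^sup>2) * (q * \<sigma>\<^sup>2 - (norm t)\<^sup>2 + (- 2 * (x \<bullet> t)) * \<sigma>)"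
      unfolding nn q_def using \<sigma> by (simp add: field_simps power2_eq_square)
    have "1 / \<sigma>\<^sup>2 = \<sigma> powr (-2)" using \<sigma> by (simp add: powr_minus powr_numeral divide_inverse)
    then have "(1 / \<sigma>\<^sup>2) powr s = \<sigma> powr (- 2 * s)" by (simp add: powr_powr)
    then show ?thesis unfolding bump_def eq using \<sigma> by (subst tpow_cmult) auto
  qed
  have b0: "bump s R x = \<sigma> powr (- 2 * s) * (q powr s * \<sigma> powr (2 * s))"
  proof -
    have "\<sigma> powr (- 2 * s) * \<sigma> powr (2 * s) = 1" using \<sigma> unfolding powr_add[symmetric] by simp
    then show ?thesis unfolding bump_def q_def[symmetric] using q by (simp add: tpow_pos)
  qed
  \<comment> \<open>Exponents of \<sigma>: - n - 1 from the polar weight, - 2 s from the bump, n + 2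
    s from the kernel. Their sum - 1 is the division by \<sigma> in
    \<open>line_defect\<close>.\<close>
  have "(1 / \<sigma>) ^ DIM('a) / \<sigma> * \<sigma> powr (- 2 * s) * (1 / \<sigma>) powr - (real DIM('a) + 2 * s) = 1 / \<sigma>"
  proof -
    have a: "(1 / \<sigma>) ^ DIM('a) / \<sigma> = \<sigma> powr (- real DIM('a)) * \<sigma> powr (-1)"
      using \<sigma> by (simp add: powr_minus powr_realpow power_one_over divide_inverse power_inverse)
    have c: "(1 / \<sigma>) powr - (real DIM('a) + 2 * s) = \<sigma> powr (real DIM('a) + 2 * s)"
    proof -
      have "1 / \<sigma> = \<sigma> powr (-1)" using \<sigma> by (simp add: powr_minus divide_inverse)
      then show ?thesis by (simp only: powr_powr) (simp add: add.commute)
    qed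
    have "(1 / \<sigma>) ^ DIM('a) / \<sigma> * \<sigma> powr (- 2 * s) * (1 / \<sigma>) powr - (real DIM('a) + 2 * s) = \<sigma> powr (- real DIM('a) + (-1) + (- 2 * s) + (real DIM('a) + 2 * s))"
      unfolding a c powr_add ..
    also have "- real DIM('a) + (-1) + (- 2 * s) + (real DIM('a) + 2 * s) = -1" by simp
    finally show ?thesis using \<sigma> by (simp add: powr_minus divide_inverse)
  qed
  then have k: "(1 / \<sigma>) ^ DIM('a) / \<sigma> * \<sigma> powr (- 2 * s) * kern s ((1 / \<sigma>) *\<^sub>R \<theta>) = kern s \<theta> / \<sigma>"
  proof -
    assume e: "(1 / \<sigma>) ^ DIM('a) / \<sigma> * \<sigma> powr (- 2 * s) * (1 / \<sigma>) powr - (real DIM('a) + 2 * s) = 1 / \<sigma>"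
    have "kern s ((1 / \<sigma>) *\<^sub>R \<theta>) = (1 / \<sigma>) powr - (real DIM('a) + 2 * s) * kern s \<theta>"
      unfolding kern_def using \<sigma> by (simp add: powr_mult[symmetric])
    then have "(1 / \<sigma>) ^ DIM('a) / \<sigma> * \<sigma> powr (- 2 * s) * kern s ((1 / \<sigma>) *\<^sub>R \<theta>) =
      ((1 / \<sigma>) ^ DIM('a) / \<sigma> * \<sigma> powr (- 2 * s) * (1 / \<sigma>) powr - (real DIM('a) + 2 * s)) * kern s \<theta>"
      by (simp only: mult.assoc)
    then show ?thesis unfolding e by simp
  qed
  define X where "X = 2 * (q powr s * \<sigma> powr (2 * s)) - tpow s (q * \<sigma>\<^sup>2 - (norm \<theta>)\<^sup>2 + (- 2 * (x \<bullet> \<theta>)) * \<sigma>) - tpow s (q * \<sigma>\<^sup>2 - (norm \<theta>)\<^sup>2 + (- (- 2 * (x \<bullet> \<theta>))) * \<sigma>)"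
  have "sdiff (bump s R) x ((1 / \<sigma>) *\<^sub>R \<theta>) = \<sigma> powr (- 2 * s) * X"
    using bz[of \<theta>] bz[of "- \<theta>"] b0 unfolding sdiff_def X_def by (simp add: algebra_simps)
  then have "(1 / \<sigma>) ^ DIM('a) / \<sigma> * (sdiff (bump s R) x ((1 / \<sigma>) *\<^sub>R \<theta>) * kern s ((1 / \<sigma>) *\<^sub>R \<theta>)) =
    ((1 / \<sigma>) ^ DIM('a) / \<sigma> * \<sigma> powr (- 2 * s) * kern s ((1 / \<sigma>) *\<^sub>R \<theta>)) * X"
    by (simp only: mult_ac)
  then show ?thesis unfolding k line_defect_def X_def[symmetric] q_def[symmetric] using \<sigma> by simp
qed

text \<open>Inverse polar coordinates turn the integral into an average over directions of
  integrated line defects, each of which depends on |\<theta>| only. Fubini supplies integrability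
  of the defects for almost every \<theta>, so the comparison with the centre of the unit ball is
  made almost everywhere.\<close>

lemma integral_sdiff_bump_const:
  fixes x :: "'a::euclidean_space"
  assumes s: "0 < s" "s < 1" and R: "0 < R" and x: "norm x < R"
  shows "(LINT z|lborel. sdiff (bump s R) x z * kern s z) = (LINT z|lborel. sdiff (bump s 1) (0::'a) z * kern s z)"
proof -
  define T where "T R x \<theta> = (LINT \<sigma>|lborel. line_defect s (R\<^sup>2 - (norm x)\<^sup>2) ((norm \<theta>)\<^sup>2) (- 2 * (x \<bullet> \<theta>)) \<sigma>)" for R :: real and x \<theta> :: 'a
  have *: "(AE \<theta>::'a in lborel. 1 < norm \<theta> \<and> norm \<theta> < 2 \<longrightarrow> integrable lborel (line_defect s (R\<^sup>2 - (norm x)\<^sup>2) ((norm \<theta>)\<^sup>2) (- 2 * (x \<bullet> \<theta>)))) \<and>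
     ln 2 * (LINT z|lborel. sdiff (bump s R) x z * kern s z) = (LINT \<theta>|lborel. indicator {1<..<2} (norm \<theta>) * (kern s \<theta> * T R x \<theta>))"
    if R: "0 < R" and x: "norm x < R" for R and x :: 'a
  proof -
    let ?F = "\<lambda>z::'a. sdiff (bump s R) x z * kern s z"
    let ?L = "\<lambda>\<theta>. line_defect s (R\<^sup>2 - (norm x)\<^sup>2) ((norm \<theta>)\<^sup>2) (- 2 * (x \<bullet> \<theta>))"
    define H where "H = (\<lambda>(\<theta>::'a, \<sigma>). indicator {1<..<2} (norm \<theta>) * (indicator {0<..} \<sigma> * ((1 / \<sigma>) ^ DIM('a) / \<sigma> * ?F ((1 / \<sigma>) *\<^sub>R \<theta>))))"
    note pol = integral_polar_inverse[OF integrable_sdiff_bump[OF s R x], folded H_def]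
    have H: "H (\<theta>, \<sigma>) = (indicator {1<..<2} (norm \<theta>) * kern s \<theta>) * ?L \<theta> \<sigma>" for \<theta> \<sigma>
    proof (cases "0 < \<sigma>")
      case True
      then have "H (\<theta>, \<sigma>) = indicator {1<..<2} (norm \<theta>) * ((1 / \<sigma>) ^ DIM('a) / \<sigma> * ?F ((1 / \<sigma>) *\<^sub>R \<theta>))"
        unfolding H_def by simp
      then show ?thesis unfolding sdiff_bump_line[OF True R x] by (simp only: mult.assoc)
    next
      case False
      then show ?thesis by (simp add: H_def line_defect_def)
    qed
    have "AE \<theta> in lborel. integrable lborel (\<lambda>\<sigma>. H (\<theta>, \<sigma>))"
      by (rule lborel_pair.AE_integrable_fst') (rule pol)
    then have "AE \<theta>::'a in lborel. 1 < norm \<theta> \<and> norm \<theta> < 2 \<longrightarrow> integrable lborel (?L \<theta>)"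
    proof eventually_elim
      case (elim \<theta>)
      show ?case
      proof
        assume t: "1 < norm \<theta> \<and> norm \<theta> < 2"
        then have "kern s \<theta> \<noteq> 0" by (auto simp: kern_def)
        then show "integrable lborel (?L \<theta>)" using elim t unfolding H by (simp add: integrable_mult_right_iff)
      qed
    qed
    moreover have "(LINT \<theta>|lborel. (LINT \<sigma>|lborel. H (\<theta>, \<sigma>))) = integral\<^sup>L (lborel \<Otimes>\<^sub>M lborel) H"
      by (rule lborel_pair.integral_fst') (rule pol)
    ultimately show ?thesis unfolding pol(2)[symmetric] H T_def by (simp add: mult.assoc)
  qed
  have "(LINT \<theta>|lborel. indicator {1<..<2} (norm \<theta>) * (kern s \<theta> * T R x \<theta>)) = (LINT \<theta>|lborel. indicator {1<..<2} (norm \<theta>) * (kern s \<theta> * T 1 0 \<theta>))"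
  proof (rule integral_cong_AE)
    have m: "(\<lambda>\<theta>. T R x \<theta>) \<in> borel_measurable borel" for R x
    proof -
      have "(\<lambda>(\<theta>, \<sigma>). line_defect s (R\<^sup>2 - (norm x)\<^sup>2) ((norm \<theta>)\<^sup>2) (- 2 * (x \<bullet> \<theta>)) \<sigma>) \<in> borel_measurable (borel \<Otimes>\<^sub>M lborel)"
        unfolding line_defect_def by measurable
      then show ?thesis unfolding T_def by (rule lborel.borel_measurable_lebesgue_integral)
    qed
    note [measurable] = m
    show "(\<lambda>\<theta>. indicator {1<..<2} (norm \<theta>) * (kern s \<theta> * T R x \<theta>)) \<in> borel_measurable lborel" by measurable
    show "(\<lambda>\<theta>. indicator {1<..<2} (norm \<theta>) * (kern s \<theta> * T 1 0 \<theta>)) \<in> borel_measurable lborel" by measurable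
    show "AE \<theta> in lborel. indicator {1<..<2} (norm \<theta>) * (kern s \<theta> * T R x \<theta>) = indicator {1<..<2} (norm \<theta>) * (kern s \<theta> * T 1 0 \<theta>)"
      using *[OF R x, THEN conjunct1] *[of 1 0, simplified, THEN conjunct1]
    proof eventually_elim
      case (elim \<theta>)
      show ?case
      proof (cases "1 < norm \<theta> \<and> norm \<theta> < 2")
        case True
        have q: "0 < R\<^sup>2 - (norm x)\<^sup>2" using x R by (simp add: power_strict_mono)
        have "T R x \<theta> = T 1 0 \<theta>"
          unfolding T_def using integral_line_defect_normalize[OF q _ s, of "(norm \<theta>)\<^sup>2" "- 2 * (x \<bullet> \<theta>)"] elim True by (cases "\<theta> = 0") auto
        then show ?thesis by simp
      qed (auto simp: indicator_def)
    qed
  qed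
  then have "ln 2 * (LINT z|lborel. sdiff (bump s R) x z * kern s z) = ln 2 * (LINT z|lborel. sdiff (bump s 1) (0::'a) z * kern s z)"
    using *[OF R x] *[of 1 0] by simp
  then show ?thesis by simp
qed

section \<open>Poisson averages\<close>

lemma AE_norm_neq: "AE x::'a::euclidean_space in lborel. norm x \<noteq> R"
proof -
  have "negligible (sphere (0::'a) R)" by (rule negligible_sphere)
  then have "sphere (0::'a) R \<in> null_sets lebesgue" by (simp add: negligible_iff_null_sets)
  then have "sphere (0::'a) R \<in> null_sets lborel" by (subst (asm) null_sets_completion_iff) auto
  then have "AE x::'a in lborel. x \<notin> sphere 0 R" by (rule AE_not_in)
  then show ?thesis by simp
qed

lemma kap_scale:
  assumes r: "0 < r"
  shows "kap s r (r *\<^sub>R (w::'a::euclidean_space)) = kap s 1 w / r ^ DIM('a)"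
proof (cases "1 < norm w")
  case True
  have "r\<^sup>2 / ((norm (r *\<^sub>R w))\<^sup>2 - r\<^sup>2) = 1\<^sup>2 / ((norm w)\<^sup>2 - 1\<^sup>2)"
  proof -
    have "(norm (r *\<^sub>R w))\<^sup>2 - r\<^sup>2 = r\<^sup>2 * ((norm w)\<^sup>2 - 1\<^sup>2)" using r by (simp add: power_mult_distrib algebra_simps)
    then show ?thesis using r by simp
  qed
  moreover have "r < norm (r *\<^sub>R w)" using r True by simp
  ultimately show ?thesis using r True unfolding kap_def by (simp add: power_mult_distrib)
next
  case False
  moreover have "\<not> r < norm (r *\<^sub>R w)" using False r by (simp add: not_less)
  ultimately show ?thesis unfolding kap_def by simp
qed

lemma kap_measurable_snd [measurable]: "kap s r \<in> borel_measurable borel"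
  unfolding kap_def by measurable

lemma kap_far:
  fixes y :: "'a::euclidean_space"
  assumes s: "0 < s" and r: "0 < r" and y: "2 * r \<le> norm y"
  shows "kap s r y \<le> (4/3) powr s * r powr (2 * s) * norm y powr - (real DIM('a) + 2 * s)"
proof -
  let ?t = "norm y"
  have t: "0 < ?t" using r y by linarith
  \<comment> \<open>As r^2 is at most a quarter of |y|^2, the difference |y|^2 - r^2 is at least
    three quarters of it; hence the constant 4/3.\<close>
  have "(2 * r)\<^sup>2 \<le> ?t\<^sup>2" using r y by (intro power_mono) auto
  then have q: "3/4 * ?t\<^sup>2 \<le> ?t\<^sup>2 - r\<^sup>2" by (simp add: power_mult_distrib)
  have t2: "0 < ?t\<^sup>2" using t by simp
  have "r\<^sup>2 / (?t\<^sup>2 - r\<^sup>2) \<le> r\<^sup>2 / (3/4 * ?t\<^sup>2)" using q t2 by (intro divide_left_mono mult_pos_pos) (linarith | simp)+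
  also have "\<dots> = 4/3 * (r / ?t)\<^sup>2" by (simp add: power_divide)
  finally have "(r\<^sup>2 / (?t\<^sup>2 - r\<^sup>2)) powr s \<le> (4/3 * (r / ?t)\<^sup>2) powr s"
    using q t2 s by (intro powr_mono2 divide_nonneg_nonneg) (linarith | simp)+
  also have "\<dots> = (4/3) powr s * (r powr (2 * s) / ?t powr (2 * s))"
  proof -
    have "(r / ?t) powr 2 = (r / ?t)\<^sup>2" using r by (intro powr_numeral) simp
    then have "(r / ?t)\<^sup>2 powr s = (r / ?t) powr (2 * s)" by (metis powr_powr)
    then show ?thesis by (simp only: powr_mult powr_divide)
  qed
  finally have "(r\<^sup>2 / (?t\<^sup>2 - r\<^sup>2)) powr s / ?t ^ DIM('a) \<le> (4/3) powr s * (r powr (2 * s) / ?t powr (2 * s)) / ?t ^ DIM('a)"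
    using t by (intro divide_right_mono) auto
  also have "\<dots> = (4/3) powr s * r powr (2 * s) * ?t powr - (real DIM('a) + 2 * s)"
    using t by (simp only: powr_minus powr_add powr_realpow) (simp add: field_simps)
  finally show ?thesis using r y unfolding kap_def by simp
qed

lemma nn_integral_kap_scale:
  assumes r: "0 < r"
  shows "(\<integral>\<^sup>+(y::'a::euclidean_space). ennreal (kap s r y) \<partial>lborel) = (\<integral>\<^sup>+(y::'a). ennreal (kap s 1 y) \<partial>lborel)"
proof -
  have "(\<integral>\<^sup>+(y::'a). ennreal (kap s r y) \<partial>lborel) = ennreal (\<bar>r\<bar> ^ DIM('a)) * (\<integral>\<^sup>+(w::'a). ennreal (kap s r (0 + r *\<^sub>R w)) \<partial>lborel)"
    by (rule nn_integral_lborel_affine) (use r in auto)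
  also have "\<dots> = (\<integral>\<^sup>+(w::'a). ennreal (\<bar>r\<bar> ^ DIM('a)) * ennreal (kap s r (0 + r *\<^sub>R w)) \<partial>lborel)"
    by (rule nn_integral_cmult[symmetric]) measurable
  also have "\<dots> = (\<integral>\<^sup>+(y::'a). ennreal (kap s 1 y) \<partial>lborel)"
    using r by (intro nn_integral_cong) (simp add: kap_scale[OF r] ennreal_mult[symmetric])
  finally show ?thesis .
qed

text \<open>The singularity at the sphere has order s < 1, and at infinity the kernel decays like
  |y|^(- n - 2 s).\<close>

lemma nn_integral_kap_finite:
  assumes s: "0 < s" "s < 1"
  shows "(\<integral>\<^sup>+(y::'a::euclidean_space). ennreal (kap s 1 y) \<partial>lborel) < top"
proof -
  let ?K = "(4/3) powr s :: real"
  have "(\<integral>\<^sup>+(y::'a). ennreal (kap s 1 y) \<partial>lborel) \<le>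
    (\<integral>\<^sup>+(y::'a). ennreal (\<bar>(norm y)\<^sup>2 - 1\<bar> powr (-s)) * indicator {..<2} (norm y) +
       ennreal ?K * ennreal (indicator {1..} (norm y) * norm y powr - (real DIM('a) + 2 * s)) \<partial>lborel)"
  proof (rule nn_integral_mono)
    fix y :: 'a
    show "ennreal (kap s 1 y) \<le> ennreal (\<bar>(norm y)\<^sup>2 - 1\<bar> powr (-s)) * indicator {..<2} (norm y) +
       ennreal ?K * ennreal (indicator {1..} (norm y) * norm y powr - (real DIM('a) + 2 * s))"
    proof (cases "norm y < 2")
      case True
      have "kap s 1 y \<le> \<bar>(norm y)\<^sup>2 - 1\<bar> powr (-s)"
      proof (cases "1 < norm y")
        case T: True
        have q: "0 < (norm y)\<^sup>2 - 1" using T by (simp add: one_less_power)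
        have "kap s 1 y = ((norm y)\<^sup>2 - 1) powr (-s) / norm y ^ DIM('a)"
          using T by (simp add: kap_def powr_divide powr_minus divide_inverse inverse_powr)
        also have "\<dots> \<le> ((norm y)\<^sup>2 - 1) powr (-s) / 1"
          using T one_le_power[of "norm y" "DIM('a)"] by (intro divide_left_mono mult_pos_pos) (linarith | simp)+
        finally show ?thesis using q by simp
      qed (simp add: kap_def)
      then show ?thesis using True by (simp add: ennreal_leI add_increasing2)
    next
      case False
      then have "kap s 1 y \<le> ?K * (norm y powr - (real DIM('a) + 2 * s))"
        using kap_far[of s 1 y] s by simp
      then have "ennreal (kap s 1 y) \<le> ennreal ?K * ennreal (norm y powr - (real DIM('a) + 2 * s))"
        by (simp add: ennreal_mult[symmetric] ennreal_leI)
      then show ?thesis using False by simp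
    qed
  qed
  also have "\<dots> = (\<integral>\<^sup>+(y::'a). ennreal (\<bar>(norm y)\<^sup>2 - 1\<bar> powr (-s)) * indicator {..<2} (norm y) \<partial>lborel) +
     ennreal ?K * (\<integral>\<^sup>+(y::'a). ennreal (indicator {1..} (norm y) * norm y powr - (real DIM('a) + 2 * s)) \<partial>lborel)"
    by (subst nn_integral_add) (auto simp: nn_integral_cmult)
  also have "\<dots> < top"
    using nn_integral_shell_finite[of s, where 'a='a] nn_integral_powr_far_finite[of "2 * s", where 'a='a] s
    by (simp add: ennreal_add_less_top ennreal_mult_less_top)
  finally show ?thesis .
qed

text \<open>Continuity controls Poisson averages near the singular sphere, the L^1_s weight controls
  them at infinity.\<close>

definition tame :: "real \<Rightarrow> ('a::euclidean_space \<Rightarrow> real) \<Rightarrow> bool" where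
  "tame s v \<longleftrightarrow> continuous_on UNIV v \<and> integrable lborel (\<lambda>x. \<bar>v x\<bar> / (1 + norm x powr (real DIM('a) + 2 * s)))"

lemma tame_measurable: "tame s v \<Longrightarrow> v \<in> borel_measurable borel"
  unfolding tame_def by (elim conjE) (rule borel_measurable_continuous_onI)

lemma continuous_bounded_cball:
  fixes f :: "'a::euclidean_space \<Rightarrow> real"
  assumes "continuous_on UNIV f"
  obtains M where "0 \<le> M" "\<And>x. norm x \<le> R \<Longrightarrow> \<bar>f x\<bar> \<le> M"
proof -
  have "bounded (f ` cball 0 R)"
    by (intro compact_imp_bounded compact_continuous_image compact_cball continuous_on_subset[OF assms]) auto
  then obtain M where "\<And>y. y \<in> f ` cball 0 R \<Longrightarrow> norm y \<le> M" unfolding bounded_iff by blast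
  then have "\<And>x. norm x \<le> R \<Longrightarrow> \<bar>f x\<bar> \<le> max M 0" by (force simp: max_def)
  then show ?thesis using that[of "max M 0"] by simp
qed

lemma tame_bounded:
  assumes "tame s (v :: 'a::euclidean_space \<Rightarrow> real)"
  obtains M where "0 \<le> M" "\<And>x. norm x \<le> R \<Longrightarrow> \<bar>v x\<bar> \<le> M"
  using assms continuous_bounded_cball unfolding tame_def by blast

lemma weight_bound:
  fixes y w :: "'a::euclidean_space"
  assumes p: "0 < p" and K: "0 < K" and w: "1 \<le> norm w" and y: "norm y \<le> K * norm w"
  shows "norm w powr - p \<le> (1 + K powr p) / (1 + norm y powr p)"
proof -
  have "norm y powr p \<le> (K * norm w) powr p" using p y by (intro powr_mono2) auto
  also have "\<dots> = K powr p * norm w powr p" by (rule powr_mult)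
  finally have 1: "norm y powr p \<le> K powr p * norm w powr p" .
  have "1 powr p \<le> norm w powr p" using p w by (intro powr_mono2) auto
  then have "1 + norm y powr p \<le> (1 + K powr p) * norm w powr p" using 1 by (simp add: algebra_simps)
  moreover have "0 < norm w powr p" using w by (cases "w = 0") auto
  moreover have "0 < 1 + norm y powr p" by (simp add: add_pos_nonneg)
  ultimately show ?thesis by (simp add: powr_minus field_simps)
qed

text \<open>K does not involve r, so one majorant serves all kernels with r \<le> R.\<close>

lemma kap_tame_far:
  fixes y :: "'a::euclidean_space" and s R :: real
  defines "p \<equiv> real DIM('a) + 2 * s"
  defines "K \<equiv> (4/3) powr s * R powr (2 * s) * ((2 * R) powr - p * (1 + (2 * R) powr p))"
  assumes s: "0 < s" and r: "0 < r" "r \<le> R" and y: "2 * R \<le> norm y"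
  shows "kap s r y \<le> K / (1 + norm y powr p)"
proof -
  have R: "0 < R" using r by simp
  \<comment> \<open>Division by 2 R moves the region |y| \<ge> 2 R to norm at least 1, as
    \<open>weight_bound\<close> requires.\<close>
  let ?w = "y /\<^sub>R (2 * R)"
  have nw: "norm ?w = norm y / (2 * R)" using R by (simp add: field_simps)
  have w1: "1 \<le> norm ?w" unfolding nw using R y by simp
  have wb: "norm ?w powr - p \<le> (1 + (2 * R) powr p) / (1 + norm y powr p)"
  proof (rule weight_bound[OF _ _ w1])
    show "norm y \<le> 2 * R * norm ?w" unfolding nw using R by simp
  qed (use s R in \<open>auto simp: p_def\<close>)
  have "norm y powr - p = (2 * R) powr - p * norm ?w powr - p"
    using R unfolding nw by (subst powr_mult[symmetric]) simp
  also have "\<dots> \<le> (2 * R) powr - p * ((1 + (2 * R) powr p) / (1 + norm y powr p))"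
    by (intro mult_left_mono wb) auto
  finally have d: "norm y powr - p \<le> (2 * R) powr - p * ((1 + (2 * R) powr p) / (1 + norm y powr p))" .
  have "kap s r y \<le> (4/3) powr s * r powr (2 * s) * norm y powr - p"
    unfolding p_def using y r s by (intro kap_far) auto
  also have "\<dots> \<le> (4/3) powr s * R powr (2 * s) * ((2 * R) powr - p * ((1 + (2 * R) powr p) / (1 + norm y powr p)))"
    using r s by (intro mult_mono d mult_left_mono powr_mono2) auto
  also have "\<dots> = K / (1 + norm y powr p)" by (simp add: K_def)
  finally show ?thesis .
qed

text \<open>Uniformity in r is the point; it licenses Fubini in the radius. Although the singularity
  moves with r, the total mass of the kernel is scale invariant, so boundedness of v handles |y|
  \<le> 2 R. Beyond that the L^1_s weight takes over.\<close>

lemma tame_kap_bound: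
  fixes v :: "'a::euclidean_space \<Rightarrow> real"
  assumes s: "0 < s" "s < 1" and v: "tame s v" and R: "0 < R"
  obtains B where "0 \<le> B" "\<And>r. 0 < r \<Longrightarrow> r \<le> R \<Longrightarrow> (\<integral>\<^sup>+y. ennreal (kap s r y * \<bar>v y\<bar>) \<partial>lborel) \<le> ennreal B"
proof -
  note [measurable] = tame_measurable[OF v]
  let ?p = "real DIM('a) + 2 * s"
  obtain M where M: "0 \<le> M" "\<And>x. norm x \<le> 2 * R \<Longrightarrow> \<bar>v x\<bar> \<le> M" using tame_bounded[OF v] by blast
  define K where "K = (4/3) powr s * R powr (2 * s) * ((2 * R) powr - ?p * (1 + (2 * R) powr ?p))"
  have K0: "0 \<le> K" unfolding K_def by (intro mult_nonneg_nonneg) auto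
  define I where "I = (\<integral>\<^sup>+(y::'a). ennreal (kap s 1 y) \<partial>lborel)"
  define W where "W = (\<integral>\<^sup>+(y::'a). ennreal (\<bar>v y\<bar> / (1 + norm y powr ?p)) \<partial>lborel)"
  have I: "I < top" unfolding I_def by (rule nn_integral_kap_finite[OF s])
  have W: "W < top"
  proof -
    have "integrable lborel (\<lambda>y::'a. \<bar>v y\<bar> / (1 + norm y powr ?p))" using v unfolding tame_def by (elim conjE)
    moreover have "norm (\<bar>v y\<bar> / (1 + norm y powr ?p)) = \<bar>v y\<bar> / (1 + norm y powr ?p)" for y
      unfolding real_norm_def by (intro abs_of_nonneg divide_nonneg_nonneg add_nonneg_nonneg) simp_all
    ultimately show ?thesis unfolding W_def integrable_iff_bounded infinity_ennreal_def by (simp only:)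
  qed
  define T where "T = ennreal M * I + ennreal K * W"
  have T: "T < top" using I W by (simp add: T_def ennreal_mult_less_top)
  have main: "(\<integral>\<^sup>+y. ennreal (kap s r y * \<bar>v y\<bar>) \<partial>lborel) \<le> T" if r: "0 < r" "r \<le> R" for r
  proof -
    have "(\<integral>\<^sup>+y. ennreal (kap s r y * \<bar>v y\<bar>) \<partial>lborel) \<le> (\<integral>\<^sup>+(y::'a). ennreal M * ennreal (kap s r y) + ennreal K * ennreal (\<bar>v y\<bar> / (1 + norm y powr ?p)) \<partial>lborel)"
    proof (rule nn_integral_mono)
      fix y :: 'a
      show "ennreal (kap s r y * \<bar>v y\<bar>) \<le> ennreal M * ennreal (kap s r y) + ennreal K * ennreal (\<bar>v y\<bar> / (1 + norm y powr ?p))"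
      proof (cases "norm y \<le> 2 * R")
        case True
        have "kap s r y * \<bar>v y\<bar> \<le> M * kap s r y" using M(2)[OF True] by (simp add: mult.commute mult_right_mono)
        then have "ennreal (kap s r y * \<bar>v y\<bar>) \<le> ennreal M * ennreal (kap s r y)"
          using M(1) by (simp add: ennreal_mult[symmetric] ennreal_leI)
        then show ?thesis by (rule order.trans) simp
      next
        case False
        have "kap s r y \<le> K / (1 + norm y powr ?p)"
          unfolding K_def using False r s by (intro kap_tame_far) auto
        then have "kap s r y * \<bar>v y\<bar> \<le> K / (1 + norm y powr ?p) * \<bar>v y\<bar>" by (intro mult_right_mono) auto
        also have "\<dots> = K * (\<bar>v y\<bar> / (1 + norm y powr ?p))" by simp
        finally have "ennreal (kap s r y * \<bar>v y\<bar>) \<le> ennreal K * ennreal (\<bar>v y\<bar> / (1 + norm y powr ?p))"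
          using K0 by (subst ennreal_mult[symmetric]) (auto intro: ennreal_leI simp: add_nonneg_nonneg)
        then show ?thesis by (rule order.trans) simp
      qed
    qed
    also have "\<dots> = ennreal M * (\<integral>\<^sup>+(y::'a). ennreal (kap s r y) \<partial>lborel) + ennreal K * W"
      unfolding W_def by (subst nn_integral_add) (auto simp: nn_integral_cmult)
    also have "\<dots> = T" unfolding T_def I_def nn_integral_kap_scale[OF r(1)] ..
    finally show ?thesis .
  qed
  show ?thesis
  proof (rule that[of "enn2real T"])
    fix r assume "0 < r" "r \<le> R"
    then show "(\<integral>\<^sup>+y. ennreal (kap s r y * \<bar>v y\<bar>) \<partial>lborel) \<le> ennreal (enn2real T)"
      using main T by simp
  qed simp
qed

lemma integrable_kap:
  fixes v :: "'a::euclidean_space \<Rightarrow> real"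
  assumes s: "0 < s" "s < 1" and v: "tame s v" and r: "0 < r"
  shows "integrable lborel (\<lambda>y. kap s r y * v y)"
proof -
  note [measurable] = tame_measurable[OF v]
  obtain B where "\<And>t. 0 < t \<Longrightarrow> t \<le> r \<Longrightarrow> (\<integral>\<^sup>+y. ennreal (kap s t y * \<bar>v y\<bar>) \<partial>lborel) \<le> ennreal B"
    using tame_kap_bound[OF s v r] by blast
  from this[OF r] have "(\<integral>\<^sup>+y. ennreal (kap s r y * \<bar>v y\<bar>) \<partial>lborel) < \<infinity>"
    by (simp add: le_less_trans[OF _ ennreal_less_top])
  then show ?thesis unfolding integrable_iff_bounded by (simp add: abs_mult)
qed

text \<open>The Poisson average P(r) without the factor \<open>a_ns\<close>.\<close>

definition pavg :: "real \<Rightarrow> ('a::euclidean_space \<Rightarrow> real) \<Rightarrow> real \<Rightarrow> real" where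
  "pavg s v r = (LINT y|lborel. kap s r y * v y)"

lemma pavg_near_scale:
  fixes v :: "'a::euclidean_space \<Rightarrow> real"
  assumes r: "0 < r" and [measurable]: "v \<in> borel_measurable borel"
  shows "(LINT y|lborel. kap s r y * v y) = (LINT w|lborel. kap s 1 w * v (r *\<^sub>R w))"
proof -
  have "(LINT y|lborel. kap s r y * v y) = (LINT y|density (distr lborel borel (\<lambda>x::'a. 0 + r *\<^sub>R x)) (\<lambda>_. ennreal (\<bar>r\<bar> ^ DIM('a))). kap s r y * v y)"
    using lborel_affine[of r "0::'a"] r by simp
  also have "\<dots> = (LINT w|lborel. \<bar>r\<bar> ^ DIM('a) *\<^sub>R (kap s r (r *\<^sub>R w) * v (r *\<^sub>R w)))"
    by (subst integral_density) (auto simp: integral_distr)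
  also have "\<dots> = (LINT w|lborel. kap s 1 w * v (r *\<^sub>R w))"
    using r by (intro Bochner_Integration.integral_cong) (auto simp: kap_scale)
  finally show ?thesis .
qed

section \<open>Duality with the torsion function\<close>

lemma ext_pot_eq_bump: "ext_pot s s R x = (\<integral>\<^sup>+z. ennreal (bump s R (x + z) * kern s z) \<partial>lborel)"
  unfolding ext_pot_def bump_def kern_def ..

text \<open>Dropping the nonnegative integral in \<open>ext_pot_kap\<close> bounds the potential by
  c R^n \<open>kap s R x\<close>, which is integrable against |v|.\<close>

lemma ext_pot_tame_finite:
  fixes v :: "'a::euclidean_space \<Rightarrow> real"
  assumes s: "0 < s" "s < 1" and v: "tame s v" and R: "0 < R"
  shows "(\<integral>\<^sup>+x. indicator {R<..} (norm x) * (ennreal \<bar>v x\<bar> * ext_pot s s R x) \<partial>lborel) < top"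
proof -
  note [measurable] = tame_measurable[OF v]
  obtain c where c: "0 < c" and W: "\<And>x::'a. R < norm x \<Longrightarrow>
    ext_pot s s R x + (\<integral>\<^sup>+r. ennreal (c * real DIM('a) * r ^ (DIM('a) - 1) * indicator {0..R} r * kap s r x) \<partial>lborel) =
      ennreal (c * R ^ DIM('a) * kap s R x)" using ext_pot_kap[OF s, where 'a='a] R by blast
  obtain B where B: "(\<integral>\<^sup>+y. ennreal (kap s R y * \<bar>v y\<bar>) \<partial>lborel) \<le> ennreal B"
    using tame_kap_bound[OF s v R] R by blast
  have "(\<integral>\<^sup>+x. indicator {R<..} (norm x) * (ennreal \<bar>v x\<bar> * ext_pot s s R x) \<partial>lborel) \<le>
    (\<integral>\<^sup>+x. ennreal (c * R ^ DIM('a)) * ennreal (kap s R x * \<bar>v x\<bar>) \<partial>lborel)"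
  proof (rule nn_integral_mono)
    fix x :: 'a
    show "indicator {R<..} (norm x) * (ennreal \<bar>v x\<bar> * ext_pot s s R x) \<le> ennreal (c * R ^ DIM('a)) * ennreal (kap s R x * \<bar>v x\<bar>)"
    proof (cases "R < norm x")
      case True
      have "ext_pot s s R x \<le> ennreal (c * R ^ DIM('a) * kap s R x)" unfolding W[OF True, symmetric] by simp
      then have "ennreal \<bar>v x\<bar> * ext_pot s s R x \<le> ennreal \<bar>v x\<bar> * ennreal (c * R ^ DIM('a) * kap s R x)" by (intro mult_left_mono) auto
      also have "\<dots> = ennreal (c * R ^ DIM('a)) * ennreal (kap s R x * \<bar>v x\<bar>)"
        using c R by (simp add: ennreal_mult[symmetric] mult_ac)
      finally show ?thesis using True by simp
    qed auto
  qed
  also have "\<dots> = ennreal (c * R ^ DIM('a)) * (\<integral>\<^sup>+x. ennreal (kap s R x * \<bar>v x\<bar>) \<partial>lborel)"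
    by (rule nn_integral_cmult) measurable
  also have "\<dots> < top" using B by (auto simp: ennreal_mult_less_top intro: le_less_trans)
  finally show ?thesis .
qed

text \<open>Makes the constant function 1 available as a test function.\<close>

lemma tame_const: "0 < s \<Longrightarrow> tame s (\<lambda>_::'a::euclidean_space. c)"
  unfolding tame_def
proof (intro conjI)
  assume s: "0 < s"
  let ?p = "real DIM('a) + 2 * s"
  have [measurable]: "cball (0::'a) 1 \<in> sets borel" by simp
  show "integrable lborel (\<lambda>x::'a. \<bar>c\<bar> / (1 + norm x powr ?p))"
  proof (rule integrableI_nonneg)
    have "(\<integral>\<^sup>+(x::'a). ennreal (\<bar>c\<bar> / (1 + norm x powr ?p)) \<partial>lborel) \<le>
      (\<integral>\<^sup>+(x::'a). ennreal \<bar>c\<bar> * (indicator (cball 0 1) x + ennreal (indicator {1..} (norm x) * norm x powr - ?p)) \<partial>lborel)"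
    proof (rule nn_integral_mono)
      fix x :: 'a
      have "1 / (1 + norm x powr ?p) \<le> indicator (cball 0 1) x + indicator {1..} (norm x) * norm x powr - ?p"
      proof (cases "norm x \<le> 1")
        case True
        have "1 / (1 + norm x powr ?p) \<le> 1" by (simp add: add_pos_nonneg)
        moreover have "0 \<le> indicator {1..} (norm x) * norm x powr - ?p" by simp
        moreover have "indicator (cball 0 1) x = (1::real)" using True by simp
        ultimately show ?thesis by linarith
      next
        case False
        then have "0 < norm x powr ?p" by (cases "x = 0") auto
        then have "1 / (1 + norm x powr ?p) \<le> 1 / (norm x powr ?p)" by (intro divide_left_mono mult_pos_pos) linarith+
        also have "\<dots> = norm x powr - ?p" by (simp only: powr_minus divide_inverse mult_1)
        finally show ?thesis using False by simp
      qed
      then have "\<bar>c\<bar> * (1 / (1 + norm x powr ?p)) \<le> \<bar>c\<bar> * (indicator (cball 0 1) x + indicator {1..} (norm x) * norm x powr - ?p)"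
        by (rule mult_left_mono) simp
      then have "ennreal (\<bar>c\<bar> / (1 + norm x powr ?p)) \<le> ennreal (\<bar>c\<bar> * (indicator (cball 0 1) x + indicator {1..} (norm x) * norm x powr - ?p))"
        by (intro ennreal_leI) simp
      also have "\<dots> = ennreal \<bar>c\<bar> * (indicator (cball 0 1) x + ennreal (indicator {1..} (norm x) * norm x powr - ?p))"
        by (subst ennreal_mult) (auto simp: ennreal_indicator[symmetric] simp del: ennreal_indicator)
      finally show "ennreal (\<bar>c\<bar> / (1 + norm x powr ?p)) \<le> \<dots>" .
    qed
    also have "\<dots> = ennreal \<bar>c\<bar> * (emeasure lborel (cball (0::'a) 1) + (\<integral>\<^sup>+(x::'a). ennreal (indicator {1..} (norm x) * norm x powr - ?p) \<partial>lborel))"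
    proof -
      have "(\<integral>\<^sup>+(x::'a). ennreal \<bar>c\<bar> * (indicator (cball 0 1) x + ennreal (indicator {1..} (norm x) * norm x powr - ?p)) \<partial>lborel) =
        ennreal \<bar>c\<bar> * (\<integral>\<^sup>+(x::'a). (indicator (cball 0 1) x + ennreal (indicator {1..} (norm x) * norm x powr - ?p)) \<partial>lborel)"
        by (rule nn_integral_cmult) measurable
      then show ?thesis by (subst (asm) nn_integral_add) auto
    qed
    also have "\<dots> < top"
      using nn_integral_powr_far_finite[of "2 * s", where 'a='a] emeasure_lborel_cball_finite[of "0::'a" 1] s
      by (auto simp: ennreal_mult_less_top less_top)
    finally show "(\<integral>\<^sup>+(x::'a). ennreal (\<bar>c\<bar> / (1 + norm x powr ?p)) \<partial>lborel) < \<infinity>" by simp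
  qed (auto simp: add_nonneg_nonneg)
qed simp

text \<open>The total interaction of the torsion function with the exterior of its ball. It controls
  all second differences that cross the sphere.\<close>

definition ext_mass :: "'a::euclidean_space itself \<Rightarrow> real \<Rightarrow> real \<Rightarrow> ennreal" where
  "ext_mass _ s R = (\<integral>\<^sup>+(y::'a). indicator {R<..} (norm y) * ext_pot s s R y \<partial>lborel)"

lemma ext_mass_finite: "0 < s \<Longrightarrow> s < 1 \<Longrightarrow> 0 < R \<Longrightarrow> ext_mass TYPE('a::euclidean_space) s R < top"
  using ext_pot_tame_finite[OF _ _ tame_const[of s "1", where 'a='a]] by (simp add: ext_mass_def)

lemma nn_integral_bump_crossing:
  shows "(\<integral>\<^sup>+(x::'a::euclidean_space). (\<integral>\<^sup>+z. ennreal (indicator {R<..} (norm (x + z)) * (bump s R x * kern s z)) \<partial>lborel) \<partial>lborel) = ext_mass TYPE('a) s R"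
proof -
  have "(\<integral>\<^sup>+(x::'a). (\<integral>\<^sup>+z. ennreal (indicator {R<..} (norm (x + z)) * (bump s R x * kern s z)) \<partial>lborel) \<partial>lborel) =
    (\<integral>\<^sup>+(z::'a). (\<integral>\<^sup>+x. ennreal (indicator {R<..} (norm (x + z)) * (bump s R x * kern s z)) \<partial>lborel) \<partial>lborel)"
    by (rule lborel_pair.Fubini'[symmetric]) measurable
  also have "\<dots> = (\<integral>\<^sup>+(z::'a). (\<integral>\<^sup>+y. ennreal (indicator {R<..} (norm y) * (bump s R (y - z) * kern s z)) \<partial>lborel) \<partial>lborel)"
  proof (rule nn_integral_cong)
    fix z :: 'a
    show "(\<integral>\<^sup>+x. ennreal (indicator {R<..} (norm (x + z)) * (bump s R x * kern s z)) \<partial>lborel) =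
      (\<integral>\<^sup>+y. ennreal (indicator {R<..} (norm y) * (bump s R (y - z) * kern s z)) \<partial>lborel)"
      using nn_integral_lborel_translate[of "\<lambda>y. ennreal (indicator {R<..} (norm y) * (bump s R (y - z) * kern s z))" z]
      by (simp add: add.commute)
  qed
  also have "\<dots> = (\<integral>\<^sup>+(y::'a). (\<integral>\<^sup>+z. ennreal (indicator {R<..} (norm y) * (bump s R (y - z) * kern s z)) \<partial>lborel) \<partial>lborel)"
    by (rule lborel_pair.Fubini') measurable
  also have "\<dots> = (\<integral>\<^sup>+(y::'a). indicator {R<..} (norm y) * ext_pot s s R y \<partial>lborel)"
  proof (rule nn_integral_cong)
    fix y :: 'a
    have "(\<integral>\<^sup>+z. ennreal (indicator {R<..} (norm y) * (bump s R (y - z) * kern s z)) \<partial>lborel) =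
      (\<integral>\<^sup>+z. indicator {R<..} (norm y) * ennreal (bump s R (y - z) * kern s z) \<partial>lborel)"
      by (intro nn_integral_cong) (auto simp: indicator_def)
    also have "\<dots> = indicator {R<..} (norm y) * (\<integral>\<^sup>+z. ennreal (bump s R (y - z) * kern s z) \<partial>lborel)"
      by (rule nn_integral_cmult) measurable
    also have "(\<integral>\<^sup>+z. ennreal (bump s R (y - z) * kern s z) \<partial>lborel) = ext_pot s s R y"
      unfolding ext_pot_eq_bump using nn_integral_lborel_reflect[of "\<lambda>z. ennreal (bump s R (y + z) * kern s z)" 0] by simp
    finally show "(\<integral>\<^sup>+z. ennreal (indicator {R<..} (norm y) * (bump s R (y - z) * kern s z)) \<partial>lborel) = indicator {R<..} (norm y) * ext_pot s s R y" .
  qed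
  finally show ?thesis unfolding ext_mass_def .
qed

text \<open>With p = x - z and w = 2 z, the jump from x - z to x + z becomes one from p to p + w.
  The kernel contributes 2^(n + 2 s) and the change of variables 2^(-n), which leaves the factor
  2^(2 s).\<close>

lemma nn_integral_bump_crossing_opposite:
  shows "(\<integral>\<^sup>+(x::'a::euclidean_space). (\<integral>\<^sup>+z. ennreal (indicator {R<..} (norm (x + z)) * (bump s R (x - z) * kern s z)) \<partial>lborel) \<partial>lborel) =
    ennreal (2 powr (2 * s)) * ext_mass TYPE('a) s R"
proof -
  have "(\<integral>\<^sup>+(x::'a). (\<integral>\<^sup>+z. ennreal (indicator {R<..} (norm (x + z)) * (bump s R (x - z) * kern s z)) \<partial>lborel) \<partial>lborel) =
    (\<integral>\<^sup>+(z::'a). (\<integral>\<^sup>+x. ennreal (indicator {R<..} (norm (x + z)) * (bump s R (x - z) * kern s z)) \<partial>lborel) \<partial>lborel)"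
    by (rule lborel_pair.Fubini'[symmetric]) measurable
  also have "\<dots> = (\<integral>\<^sup>+(z::'a). (\<integral>\<^sup>+p. ennreal (indicator {R<..} (norm (p + 2 *\<^sub>R z)) * (bump s R p * kern s z)) \<partial>lborel) \<partial>lborel)"
  proof (rule nn_integral_cong)
    fix z :: 'a
    have "z + (z + x) = x + 2 *\<^sub>R z" for x by (simp add: scaleR_2)
    then show "(\<integral>\<^sup>+x. ennreal (indicator {R<..} (norm (x + z)) * (bump s R (x - z) * kern s z)) \<partial>lborel) =
      (\<integral>\<^sup>+p. ennreal (indicator {R<..} (norm (p + 2 *\<^sub>R z)) * (bump s R p * kern s z)) \<partial>lborel)"
      using nn_integral_lborel_translate[of "\<lambda>x. ennreal (indicator {R<..} (norm (x + z)) * (bump s R (x - z) * kern s z))" z]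
      by (simp add: add.commute add.left_commute)
  qed
  also have "\<dots> = (\<integral>\<^sup>+(p::'a). (\<integral>\<^sup>+z. ennreal (indicator {R<..} (norm (p + 2 *\<^sub>R z)) * (bump s R p * kern s z)) \<partial>lborel) \<partial>lborel)"
    by (rule lborel_pair.Fubini') measurable
  also have "\<dots> = (\<integral>\<^sup>+(p::'a). ennreal (2 powr (2 * s)) * (\<integral>\<^sup>+w. ennreal (indicator {R<..} (norm (p + w)) * (bump s R p * kern s w)) \<partial>lborel) \<partial>lborel)"
  proof (rule nn_integral_cong)
    fix p :: 'a
    have k: "kern s ((1/2) *\<^sub>R w) = 2 powr (real DIM('a) + 2 * s) * kern s w" for w :: 'a
    proof -
      have "norm ((1/2) *\<^sub>R w) powr - (real DIM('a) + 2 * s) = (1/2) powr - (real DIM('a) + 2 * s) * norm w powr - (real DIM('a) + 2 * s)"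
        by (simp add: powr_mult[symmetric])
      also have "(1/2::real) powr - (real DIM('a) + 2 * s) = 2 powr (real DIM('a) + 2 * s)"
        by (simp only: powr_minus powr_divide) simp
      finally show ?thesis unfolding kern_def .
    qed
    have "(\<integral>\<^sup>+z. ennreal (indicator {R<..} (norm (p + 2 *\<^sub>R z)) * (bump s R p * kern s z)) \<partial>lborel) =
      ennreal (\<bar>1/2\<bar> ^ DIM('a)) * (\<integral>\<^sup>+(w::'a). ennreal (indicator {R<..} (norm (p + 2 *\<^sub>R (0 + (1/2) *\<^sub>R w))) * (bump s R p * kern s (0 + (1/2) *\<^sub>R w))) \<partial>lborel)"
      by (rule nn_integral_lborel_affine) auto
    also have "\<dots> = (\<integral>\<^sup>+(w::'a). ennreal (\<bar>1/2\<bar> ^ DIM('a)) * ennreal (indicator {R<..} (norm (p + 2 *\<^sub>R (0 + (1/2) *\<^sub>R w))) * (bump s R p * kern s (0 + (1/2) *\<^sub>R w))) \<partial>lborel)"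
      by (rule nn_integral_cmult[symmetric]) measurable
    also have "\<dots> = (\<integral>\<^sup>+(w::'a). ennreal (2 powr (2 * s)) * ennreal (indicator {R<..} (norm (p + w)) * (bump s R p * kern s w)) \<partial>lborel)"
    proof (rule nn_integral_cong)
      fix w :: 'a
      have c: "\<bar>1/2::real\<bar> ^ DIM('a) * 2 powr (real DIM('a) + 2 * s) = 2 powr (2 * s)"
        by (simp add: powr_add powr_realpow power_one_over)
      have "\<bar>1/2::real\<bar> ^ DIM('a) * (indicator {R<..} (norm (p + 2 *\<^sub>R (0 + (1/2) *\<^sub>R w))) * (bump s R p * kern s (0 + (1/2) *\<^sub>R w))) =
        (\<bar>1/2::real\<bar> ^ DIM('a) * 2 powr (real DIM('a) + 2 * s)) * (indicator {R<..} (norm (p + w)) * (bump s R p * kern s w))"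
        unfolding add_0 k by simp
      then show "ennreal (\<bar>1/2\<bar> ^ DIM('a)) * ennreal (indicator {R<..} (norm (p + 2 *\<^sub>R (0 + (1/2) *\<^sub>R w))) * (bump s R p * kern s (0 + (1/2) *\<^sub>R w))) =
        ennreal (2 powr (2 * s)) * ennreal (indicator {R<..} (norm (p + w)) * (bump s R p * kern s w))"
        unfolding c by (subst (1 2) ennreal_mult'[symmetric]) (auto simp only: powr_ge_zero zero_le_power abs_ge_zero)
    qed
    also have "\<dots> = ennreal (2 powr (2 * s)) * (\<integral>\<^sup>+w. ennreal (indicator {R<..} (norm (p + w)) * (bump s R p * kern s w)) \<partial>lborel)"
      by (rule nn_integral_cmult) measurable
    finally show "(\<integral>\<^sup>+z. ennreal (indicator {R<..} (norm (p + 2 *\<^sub>R z)) * (bump s R p * kern s z)) \<partial>lborel) =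
      ennreal (2 powr (2 * s)) * (\<integral>\<^sup>+w. ennreal (indicator {R<..} (norm (p + w)) * (bump s R p * kern s w)) \<partial>lborel)" .
  qed
  also have "\<dots> = ennreal (2 powr (2 * s)) * (\<integral>\<^sup>+(p::'a). (\<integral>\<^sup>+w. ennreal (indicator {R<..} (norm (p + w)) * (bump s R p * kern s w)) \<partial>lborel) \<partial>lborel)"
    by (rule nn_integral_cmult) measurable
  finally show ?thesis unfolding nn_integral_bump_crossing .
qed

text \<open>Inside the ball the second difference of the concave bump is nonnegative unless \<open>x + z\<close> or \<open>x - z\<close> leaves
  the ball, so its absolute integral is controlled by its (constant) integral and by crossing terms.\<close>

lemma sdiff_bump_L1:
  assumes s: "0 < s" "s < 1" and R: "0 < R"
  shows "(\<integral>\<^sup>+(x::'a::euclidean_space). indicator {..<R} (norm x) * (\<integral>\<^sup>+z. ennreal (\<bar>sdiff (bump s R) x z\<bar> * kern s z) \<partial>lborel) \<partial>lborel) < top"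
proof -
  define \<gamma> where "\<gamma> = (LINT z|lborel. sdiff (bump s 1) (0::'a) z * kern s z)"
  \<comment> \<open>If x + z lies outside the ball, the second difference is twice the bump at x
    minus the bump at x - z, and its modulus is at most g x z. The other point is treated by
    \<open>g x (- z)\<close>.\<close>
  define g where "g x z = indicator {R<..} (norm (x + z)) * (2 * bump s R x + bump s R (x - z))" for x z :: 'a
  have [measurable]: "(\<lambda>(x, z). g x z) \<in> borel_measurable (borel \<Otimes>\<^sub>M borel)" unfolding g_def by measurable
  have [measurable]: "g x \<in> borel_measurable borel" for x unfolding g_def by measurable
  have g0: "0 \<le> g x z" for x z by (simp add: g_def)
  have pt: "\<bar>sdiff (bump s R) x z\<bar> - sdiff (bump s R) x z \<le> 2 * (g x z + g x (- z))" if x: "norm x < R" for x z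
  proof (cases "norm (x + z) \<le> R \<and> norm (x - z) \<le> R")
    case True
    then have "0 \<le> sdiff (bump s R) x z" using sdiff_bump_estimates(1)[OF s R x] by blast
    then show ?thesis using g0[of x z] g0[of x "- z"] by simp
  next
    case False
    have "\<bar>sdiff (bump s R) x z\<bar> \<le> g x z + g x (- z)"
    proof (cases "norm (x + z) \<le> R")
      case True
      then have "R < norm (x - z)" using False by simp
      then have "bump s R (x - z) = 0" "g x (- z) = 2 * bump s R x + bump s R (x + z)"
        using bump_outside[OF R, of "x - z"] by (auto simp: g_def)
      then show ?thesis using g0[of x z] bump_nonneg[of s R x] bump_nonneg[of s R "x + z"] unfolding sdiff_def by linarith
    next
      case False
      then have "bump s R (x + z) = 0" "g x z = 2 * bump s R x + bump s R (x - z)"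
        using bump_outside[OF R, of "x + z"] by (auto simp: g_def)
      then show ?thesis using g0[of x "- z"] bump_nonneg[of s R x] bump_nonneg[of s R "x - z"] unfolding sdiff_def by linarith
    qed
    moreover have "\<bar>d\<bar> - d \<le> 2 * b" if "\<bar>d\<bar> \<le> b" for d b :: real using that by linarith
    ultimately show ?thesis by blast
  qed
  define G where "G x = (\<integral>\<^sup>+z. ennreal (g x z * kern s z) \<partial>lborel)" for x :: 'a
  have [measurable]: "G \<in> borel_measurable borel" unfolding G_def by measurable
  have [measurable]: "ball (0::'a) R \<in> sets borel" by simp
  \<comment> \<open>Write |D| = D + (|D| - D). The integral of D is the constant \<gamma>, and |D| -
    D lives on the z for which a point leaves the ball. This replaces the pointwise bound, whose
    constant degenerates at the sphere.\<close>
  have inner: "(\<integral>\<^sup>+z. ennreal (\<bar>sdiff (bump s R) x z\<bar> * kern s z) \<partial>lborel) \<le> ennreal \<bar>\<gamma>\<bar> + 4 * G x" if x: "norm x < R" for x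
  proof -
    let ?D = "\<lambda>z. sdiff (bump s R) x z * kern s z"
    have I: "integrable lborel ?D" by (rule integrable_sdiff_bump[OF s R x])
    have Ig: "integral\<^sup>L lborel ?D = \<gamma>" unfolding \<gamma>_def by (rule integral_sdiff_bump_const[OF s R x])
    have Ia: "integrable lborel (\<lambda>z. \<bar>?D z\<bar>)" using I by simp
    have Id: "integrable lborel (\<lambda>z. \<bar>?D z\<bar> - ?D z)" using Ia I by (rule Bochner_Integration.integrable_diff)
    have "(\<integral>\<^sup>+z. ennreal (\<bar>sdiff (bump s R) x z\<bar> * kern s z) \<partial>lborel) = (\<integral>\<^sup>+z. ennreal \<bar>?D z\<bar> \<partial>lborel)"
      by (intro nn_integral_cong) (simp add: abs_mult)
    also have "\<dots> = ennreal (LINT z|lborel. \<bar>?D z\<bar>)"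
      by (rule nn_integral_eq_integral[OF Ia]) simp
    also have "(LINT z|lborel. \<bar>?D z\<bar>) = \<gamma> + (LINT z|lborel. \<bar>?D z\<bar> - ?D z)"
      using Bochner_Integration.integral_diff[OF Ia I] Ig by simp
    also have "ennreal \<dots> \<le> ennreal (\<bar>\<gamma>\<bar> + (LINT z|lborel. \<bar>?D z\<bar> - ?D z))" by (intro ennreal_leI) simp
    also have "\<dots> = ennreal \<bar>\<gamma>\<bar> + ennreal (LINT z|lborel. \<bar>?D z\<bar> - ?D z)"
      by (intro ennreal_plus integral_nonneg_AE) auto
    also have "ennreal (LINT z|lborel. \<bar>?D z\<bar> - ?D z) = (\<integral>\<^sup>+z. ennreal (\<bar>?D z\<bar> - ?D z) \<partial>lborel)"
      by (rule nn_integral_eq_integral[symmetric, OF Id]) simp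
    also have "\<dots> \<le> (\<integral>\<^sup>+z. 2 * (ennreal (g x z * kern s z) + ennreal (g x (- z) * kern s (- z))) \<partial>lborel)"
    proof (rule nn_integral_mono)
      fix z :: 'a
      have "\<bar>?D z\<bar> - ?D z = (\<bar>sdiff (bump s R) x z\<bar> - sdiff (bump s R) x z) * kern s z" by (simp add: abs_mult algebra_simps)
      also have "\<dots> \<le> 2 * (g x z + g x (- z)) * kern s z" by (intro mult_right_mono pt[OF x]) simp
      also have "\<dots> = 2 * (g x z * kern s z + g x (- z) * kern s (- z))" by (simp add: algebra_simps)
      finally have "ennreal (\<bar>?D z\<bar> - ?D z) \<le> ennreal (2 * (g x z * kern s z + g x (- z) * kern s (- z)))" by (rule ennreal_leI)
      also have "\<dots> = 2 * (ennreal (g x z * kern s z) + ennreal (g x (- z) * kern s (- z)))"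
        using g0[of x z] g0[of x "- z"] by (subst ennreal_mult) auto
      finally show "ennreal (\<bar>?D z\<bar> - ?D z) \<le> 2 * (ennreal (g x z * kern s z) + ennreal (g x (- z) * kern s (- z)))" .
    qed
    also have "\<dots> = 2 * (G x + (\<integral>\<^sup>+z. ennreal (g x (- z) * kern s (- z)) \<partial>lborel))"
      unfolding G_def by (subst nn_integral_cmult, simp, subst nn_integral_add) auto
    also have "(\<integral>\<^sup>+z. ennreal (g x (- z) * kern s (- z)) \<partial>lborel) = G x"
      unfolding G_def using nn_integral_lborel_reflect[of "\<lambda>z. ennreal (g x z * kern s z)" 0] by simp
    finally show ?thesis by (simp add: mult_2[symmetric] mult.assoc[symmetric])
  qed
  have Gtot: "(\<integral>\<^sup>+x. G x \<partial>lborel) < top"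
  proof -
    have "(\<integral>\<^sup>+x. G x \<partial>lborel) = (\<integral>\<^sup>+(x::'a). 2 * (\<integral>\<^sup>+z. ennreal (indicator {R<..} (norm (x + z)) * (bump s R x * kern s z)) \<partial>lborel) +
        (\<integral>\<^sup>+z. ennreal (indicator {R<..} (norm (x + z)) * (bump s R (x - z) * kern s z)) \<partial>lborel) \<partial>lborel)"
    proof (rule nn_integral_cong)
      fix x :: 'a
      have "G x = (\<integral>\<^sup>+z. 2 * ennreal (indicator {R<..} (norm (x + z)) * (bump s R x * kern s z)) +
        ennreal (indicator {R<..} (norm (x + z)) * (bump s R (x - z) * kern s z)) \<partial>lborel)"
        unfolding G_def
      proof (rule nn_integral_cong)
        fix z :: 'a
        have "ennreal (g x z * kern s z) = ennreal (2 * (indicator {R<..} (norm (x + z)) * (bump s R x * kern s z)) + indicator {R<..} (norm (x + z)) * (bump s R (x - z) * kern s z))"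
          by (simp add: g_def algebra_simps)
        also have "\<dots> = 2 * ennreal (indicator {R<..} (norm (x + z)) * (bump s R x * kern s z)) + ennreal (indicator {R<..} (norm (x + z)) * (bump s R (x - z) * kern s z))"
          by (subst ennreal_plus) (auto simp: ennreal_mult)
        finally show "ennreal (g x z * kern s z) = \<dots>" .
      qed
      also have "\<dots> = 2 * (\<integral>\<^sup>+z. ennreal (indicator {R<..} (norm (x + z)) * (bump s R x * kern s z)) \<partial>lborel) +
        (\<integral>\<^sup>+z. ennreal (indicator {R<..} (norm (x + z)) * (bump s R (x - z) * kern s z)) \<partial>lborel)"
        by (subst nn_integral_add) (auto simp: nn_integral_cmult)
      finally show "G x = \<dots>" .
    qed
    also have "\<dots> = 2 * ext_mass TYPE('a) s R + ennreal (2 powr (2 * s)) * ext_mass TYPE('a) s R"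
      by (subst nn_integral_add) (auto simp: nn_integral_cmult nn_integral_bump_crossing nn_integral_bump_crossing_opposite)
    also have "\<dots> < top" using ext_mass_finite[OF s R, where 'a='a] by (simp add: ennreal_add_less_top ennreal_mult_less_top)
    finally show ?thesis .
  qed
  have "(\<integral>\<^sup>+(x::'a). indicator {..<R} (norm x) * (\<integral>\<^sup>+z. ennreal (\<bar>sdiff (bump s R) x z\<bar> * kern s z) \<partial>lborel) \<partial>lborel) \<le>
    (\<integral>\<^sup>+(x::'a). ennreal \<bar>\<gamma>\<bar> * indicator (ball 0 R) x + 4 * G x \<partial>lborel)"
  proof (rule nn_integral_mono)
    fix x :: 'a
    show "indicator {..<R} (norm x) * (\<integral>\<^sup>+z. ennreal (\<bar>sdiff (bump s R) x z\<bar> * kern s z) \<partial>lborel) \<le> ennreal \<bar>\<gamma>\<bar> * indicator (ball 0 R) x + 4 * G x"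
    proof (cases "norm x < R")
      case True
      then show ?thesis using inner[OF True] by simp
    qed auto
  qed
  also have "\<dots> = ennreal \<bar>\<gamma>\<bar> * emeasure lborel (ball (0::'a) R) + 4 * (\<integral>\<^sup>+x. G x \<partial>lborel)"
    by (subst nn_integral_add, measurable) (auto simp: nn_integral_cmult nn_integral_cmult_indicator)
  also have "\<dots> < top" using Gtot emeasure_lborel_ball_finite[of "0::'a" R]
    by (auto simp: ennreal_add_less_top ennreal_mult_less_top less_top)
  finally show ?thesis .
qed

text \<open>The fractional Laplacian is \<open>C_ns\<close> / 2 times this integral; second
  differences make it absolutely convergent for regular v, see
  \<open>frac_lap_eq_opL\<close>.\<close>

definition opL :: "real \<Rightarrow> ('a::euclidean_space \<Rightarrow> real) \<Rightarrow> 'a \<Rightarrow> real" where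
  "opL s v x = (LINT z|lborel. sdiff v x z * kern s z)"

text \<open>Regularity is measured on second differences, so that Hoelder functions and functions
  with Hoelder derivatives are treated alike. The exponent must exceed 2 s to beat the singularity
  of the kernel.\<close>

definition sreg :: "real \<Rightarrow> real \<Rightarrow> ('a::euclidean_space \<Rightarrow> real) \<Rightarrow> bool" where
  "sreg s R v \<longleftrightarrow> (\<exists>C \<beta>. 2 * s < \<beta> \<and> (\<forall>x z. norm x \<le> R \<longrightarrow> norm z \<le> 1 \<longrightarrow> \<bar>sdiff v x z\<bar> \<le> C * norm z powr \<beta>))"

text \<open>For |z| \<ge> 1 and |x| \<le> R the norm of x + z is at most (R + 1) |z|, so the kernel
  centred at x is dominated by the L^1_s weight with a constant that does not depend on x.\<close>

lemma tame_tail: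
  fixes v :: "'a::euclidean_space \<Rightarrow> real"
  assumes s: "0 < s" and v: "tame s v" and R: "0 < R"
  obtains B where "0 \<le> B" "\<And>x. norm x \<le> R \<Longrightarrow> (\<integral>\<^sup>+z. ennreal (indicator {1..} (norm z) * (\<bar>v (x + z)\<bar> * kern s z)) \<partial>lborel) \<le> ennreal B"
proof -
  note [measurable] = tame_measurable[OF v]
  let ?p = "real DIM('a) + 2 * s"
  let ?K = "1 + (R + 1) powr ?p"
  let ?w = "\<lambda>y. \<bar>v y\<bar> / (1 + norm y powr ?p)"
  have w0: "0 \<le> ?w y" for y by (simp add: add_nonneg_nonneg)
  have Iw: "integrable lborel ?w" using v unfolding tame_def by (elim conjE)
  show ?thesis
  proof (rule that[of "?K * integral\<^sup>L lborel ?w"])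
    show "0 \<le> ?K * integral\<^sup>L lborel ?w" using w0 by (intro mult_nonneg_nonneg integral_nonneg_AE) (auto intro: add_nonneg_nonneg)
    fix x :: 'a assume x: "norm x \<le> R"
    have "(\<integral>\<^sup>+z. ennreal (indicator {1..} (norm z) * (\<bar>v (x + z)\<bar> * kern s z)) \<partial>lborel) \<le> (\<integral>\<^sup>+z. ennreal ?K * ennreal (?w (x + z)) \<partial>lborel)"
    proof (rule nn_integral_mono)
      fix z :: 'a
      show "ennreal (indicator {1..} (norm z) * (\<bar>v (x + z)\<bar> * kern s z)) \<le> ennreal ?K * ennreal (?w (x + z))"
      proof (cases "1 \<le> norm z")
        case True
        have "norm (x + z) \<le> norm x + norm z" by (rule norm_triangle_ineq)
        also have "\<dots> \<le> R * norm z + norm z" using x R True mult_left_mono[of 1 "norm z" R] by linarith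
        finally have "norm (x + z) \<le> (R + 1) * norm z" by (simp add: algebra_simps)
        then have "kern s z \<le> ?K / (1 + norm (x + z) powr ?p)"
          unfolding kern_def using s R True by (intro weight_bound) auto
        then have "\<bar>v (x + z)\<bar> * kern s z \<le> \<bar>v (x + z)\<bar> * (?K / (1 + norm (x + z) powr ?p))"
          by (intro mult_left_mono) auto
        also have "\<dots> = ?K * ?w (x + z)" by simp
        finally have "ennreal (\<bar>v (x + z)\<bar> * kern s z) \<le> ennreal (?K * ?w (x + z))" by (rule ennreal_leI)
        also have "\<dots> = ennreal ?K * ennreal (?w (x + z))" using w0 by (intro ennreal_mult) (auto intro: add_nonneg_nonneg)
        finally show ?thesis using True by simp
      qed auto
    qed
    also have "\<dots> = ennreal ?K * (\<integral>\<^sup>+z. ennreal (?w (x + z)) \<partial>lborel)"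
      by (rule nn_integral_cmult) measurable
    also have "(\<integral>\<^sup>+z. ennreal (?w (x + z)) \<partial>lborel) = (\<integral>\<^sup>+y. ennreal (?w y) \<partial>lborel)"
      by (rule nn_integral_lborel_translate) measurable
    also have "\<dots> = ennreal (integral\<^sup>L lborel ?w)" using w0 by (intro nn_integral_eq_integral Iw) auto
    also have "ennreal ?K * ennreal (integral\<^sup>L lborel ?w) = ennreal (?K * integral\<^sup>L lborel ?w)"
      by (rule ennreal_mult'[symmetric]) (auto intro: add_nonneg_nonneg)
    finally show "(\<integral>\<^sup>+z. ennreal (indicator {1..} (norm z) * (\<bar>v (x + z)\<bar> * kern s z)) \<partial>lborel) \<le> ennreal (?K * integral\<^sup>L lborel ?w)" .
  qed
qed

lemma sreg_L1:
  fixes v :: "'a::euclidean_space \<Rightarrow> real"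
  assumes s: "0 < s" and v: "tame s v" and R: "0 < R" and reg: "sreg s R v"
  obtains B where "\<And>x. norm x \<le> R \<Longrightarrow> (\<integral>\<^sup>+z. ennreal (\<bar>sdiff v x z\<bar> * kern s z) \<partial>lborel) \<le> ennreal B"
proof -
  note [measurable] = tame_measurable[OF v]
  obtain C \<beta> where \<beta>: "2 * s < \<beta>" and C: "\<And>x z. norm x \<le> R \<Longrightarrow> norm z \<le> 1 \<Longrightarrow> \<bar>sdiff v x z\<bar> \<le> C * norm z powr \<beta>"
    using reg unfolding sreg_def by blast
  obtain M where M: "0 \<le> M" "\<And>x. norm x \<le> R \<Longrightarrow> \<bar>v x\<bar> \<le> M" using tame_bounded[OF v] by blast
  obtain B where B: "0 \<le> B" "\<And>x. norm x \<le> R \<Longrightarrow> (\<integral>\<^sup>+z. ennreal (indicator {1..} (norm z) * (\<bar>v (x + z)\<bar> * kern s z)) \<partial>lborel) \<le> ennreal B"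
    using tame_tail[OF s v R] by blast
  let ?m = "\<lambda>z::'a. min 1 (norm z powr \<beta>) * kern s z"
  define K where "K = \<bar>C\<bar> + 2 * M"
  have K: "0 \<le> K" using M by (simp add: K_def)
  have Im: "integrable lborel ?m" by (rule integrable_min_kern[OF s \<beta>])
  have m0: "0 \<le> ?m z" for z by simp
  let ?I = "integral\<^sup>L lborel ?m"
  have I0: "0 \<le> ?I" by (rule integral_nonneg_AE) simp
  have b0: "0 < \<beta>" using s \<beta> by simp
  show ?thesis
  proof (rule that[of "K * ?I + (B + B)"])
    fix x :: 'a assume x: "norm x \<le> R"
    let ?t = "\<lambda>z. indicator {1..} (norm z) * (\<bar>v (x + z)\<bar> * kern s z)"
    let ?t' = "\<lambda>z. indicator {1..} (norm z) * (\<bar>v (x - z)\<bar> * kern s z)"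
    have tr: "(\<integral>\<^sup>+z. ennreal (?t' z) \<partial>lborel) = (\<integral>\<^sup>+z. ennreal (?t z) \<partial>lborel)"
      using nn_integral_lborel_reflect[of "\<lambda>z. ennreal (?t z)" 0] by simp
    have "(\<integral>\<^sup>+z. ennreal (\<bar>sdiff v x z\<bar> * kern s z) \<partial>lborel) \<le> (\<integral>\<^sup>+z. ennreal K * ennreal (?m z) + (ennreal (?t z) + ennreal (?t' z)) \<partial>lborel)"
    proof (rule nn_integral_mono)
      fix z :: 'a
      have "\<bar>sdiff v x z\<bar> * kern s z \<le> K * ?m z + (?t z + ?t' z)"
      proof (cases "norm z < 1")
        case True
        have le1: "norm z powr \<beta> \<le> 1" using True b0 powr_mono2[of \<beta> "norm z" 1] by simp
        have "\<bar>sdiff v x z\<bar> \<le> C * norm z powr \<beta>" using C[OF x, of z] True by simp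
        also have "\<dots> \<le> K * norm z powr \<beta>" using M by (intro mult_right_mono) (auto simp: K_def)
        finally have "\<bar>sdiff v x z\<bar> * kern s z \<le> K * norm z powr \<beta> * kern s z" by (intro mult_right_mono) auto
        then show ?thesis using True le1 by (simp add: min_absorb2)
      next
        case False
        have ge1: "1 \<le> norm z powr \<beta>" using False b0 powr_mono2[of \<beta> 1 "norm z"] by simp
        have "\<bar>sdiff v x z\<bar> \<le> 2 * \<bar>v x\<bar> + (\<bar>v (x + z)\<bar> + \<bar>v (x - z)\<bar>)" unfolding sdiff_def by linarith
        also have "\<dots> \<le> K + (\<bar>v (x + z)\<bar> + \<bar>v (x - z)\<bar>)" using M(2)[OF x] by (simp add: K_def)
        finally have "\<bar>sdiff v x z\<bar> * kern s z \<le> (K + (\<bar>v (x + z)\<bar> + \<bar>v (x - z)\<bar>)) * kern s z" by (intro mult_right_mono) auto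
        then show ?thesis using False ge1 by (simp add: min_absorb1 algebra_simps)
      qed
      then have "ennreal (\<bar>sdiff v x z\<bar> * kern s z) \<le> ennreal (K * ?m z + (?t z + ?t' z))" by (rule ennreal_leI)
      also have "\<dots> = ennreal (K * ?m z) + (ennreal (?t z) + ennreal (?t' z))"
        using K by (simp add: ennreal_plus)
      also have "ennreal (K * ?m z) = ennreal K * ennreal (?m z)" by (rule ennreal_mult[OF K m0])
      finally show "ennreal (\<bar>sdiff v x z\<bar> * kern s z) \<le> ennreal K * ennreal (?m z) + (ennreal (?t z) + ennreal (?t' z))" .
    qed
    also have "\<dots> = ennreal K * (\<integral>\<^sup>+z. ennreal (?m z) \<partial>lborel) + ((\<integral>\<^sup>+z. ennreal (?t z) \<partial>lborel) + (\<integral>\<^sup>+z. ennreal (?t' z) \<partial>lborel))"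
      by (subst nn_integral_add, measurable, subst nn_integral_add, measurable, subst nn_integral_cmult, measurable)
    also have "\<dots> \<le> ennreal K * ennreal ?I + (ennreal B + ennreal B)"
      unfolding tr using B(2)[OF x] nn_integral_eq_integral[OF Im] by (intro add_mono) auto
    also have "\<dots> = ennreal (K * ?I + (B + B))"
      by (simp only: ennreal_mult[OF K I0] ennreal_plus[OF mult_nonneg_nonneg[OF K I0] add_nonneg_nonneg[OF B(1) B(1)]] ennreal_plus[OF B(1) B(1)])
    finally show "(\<integral>\<^sup>+z. ennreal (\<bar>sdiff v x z\<bar> * kern s z) \<partial>lborel) \<le> ennreal (K * ?I + (B + B))" .
  qed
qed

lemma integrable_bump_sdiff:
  fixes v :: "'a::euclidean_space \<Rightarrow> real"
  assumes s: "0 < s" and v: "tame s v" and R: "0 < R" and reg: "sreg s R v"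
  shows "integrable (lborel \<Otimes>\<^sub>M lborel) (\<lambda>(x, z). bump s R x * (sdiff v x z * kern s z))"
proof -
  note [measurable] = tame_measurable[OF v]
  obtain B where B: "\<And>x. norm x \<le> R \<Longrightarrow> (\<integral>\<^sup>+z. ennreal (\<bar>sdiff v x z\<bar> * kern s z) \<partial>lborel) \<le> ennreal B"
    using sreg_L1[OF s v R reg] by blast
  let ?P = "R powr (2 * s)"
  have [measurable]: "ball (0::'a) R \<in> sets borel" by simp
  show ?thesis
    unfolding integrable_iff_bounded
  proof (intro conjI)
    show "(\<lambda>(x, z). bump s R x * (sdiff v x z * kern s z)) \<in> borel_measurable (lborel \<Otimes>\<^sub>M lborel)" by measurable
    have "(\<integral>\<^sup>+w. ennreal (norm (case w of (x, z) \<Rightarrow> bump s R x * (sdiff v x z * kern s z))) \<partial>(lborel \<Otimes>\<^sub>M lborel)) =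
      (\<integral>\<^sup>+x. (\<integral>\<^sup>+z. ennreal (norm (bump s R x * (sdiff v x z * kern s z))) \<partial>lborel) \<partial>lborel)"
      by (subst lborel.nn_integral_fst[symmetric]) auto
    also have "\<dots> \<le> (\<integral>\<^sup>+x. (ennreal ?P * ennreal B) * indicator (ball (0::'a) R) x \<partial>lborel)"
    proof (rule nn_integral_mono)
      fix x :: 'a
      have "(\<integral>\<^sup>+z. ennreal (norm (bump s R x * (sdiff v x z * kern s z))) \<partial>lborel) = (\<integral>\<^sup>+z. ennreal (bump s R x) * ennreal (\<bar>sdiff v x z\<bar> * kern s z) \<partial>lborel)"
        by (intro nn_integral_cong) (simp add: abs_mult ennreal_mult)
      also have "\<dots> = ennreal (bump s R x) * (\<integral>\<^sup>+z. ennreal (\<bar>sdiff v x z\<bar> * kern s z) \<partial>lborel)"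
        by (rule nn_integral_cmult) measurable
      also have "\<dots> \<le> (ennreal ?P * ennreal B) * indicator (ball (0::'a) R) x"
      proof (cases "norm x < R")
        case True
        then have "ennreal (bump s R x) * (\<integral>\<^sup>+z. ennreal (\<bar>sdiff v x z\<bar> * kern s z) \<partial>lborel) \<le> ennreal ?P * ennreal B"
          by (intro mult_mono ennreal_leI bump_le s R B) auto
        then show ?thesis using True by simp
      next
        case False
        then show ?thesis using bump_outside[OF R, of x s] by simp
      qed
      finally show "(\<integral>\<^sup>+z. ennreal (norm (bump s R x * (sdiff v x z * kern s z))) \<partial>lborel) \<le> (ennreal ?P * ennreal B) * indicator (ball (0::'a) R) x" .
    qed
    also have "\<dots> = (ennreal ?P * ennreal B) * emeasure lborel (ball (0::'a) R)" by (rule nn_integral_cmult_indicator) simp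
    also have "\<dots> < \<infinity>" using emeasure_lborel_ball_finite[of "0::'a" R] by (auto simp: ennreal_mult_less_top less_top)
    finally show "(\<integral>\<^sup>+w. ennreal (norm (case w of (x, z) \<Rightarrow> bump s R x * (sdiff v x z * kern s z))) \<partial>(lborel \<Otimes>\<^sub>M lborel)) < \<infinity>" .
  qed
qed

lemma nn_integral_sdiff_bump_exterior:
  fixes x :: "'a::euclidean_space"
  assumes R: "0 < R" and x: "R < norm x"
  shows "(\<integral>\<^sup>+z. ennreal (\<bar>sdiff (bump s R) x z\<bar> * kern s z) \<partial>lborel) = 2 * ext_pot s s R x"
proof -
  have b: "bump s R x = 0" by (rule bump_outside[OF R]) (use x in simp)
  have "(\<integral>\<^sup>+z. ennreal (\<bar>sdiff (bump s R) x z\<bar> * kern s z) \<partial>lborel) =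
    (\<integral>\<^sup>+z. ennreal (bump s R (x + z) * kern s z) + ennreal (bump s R (x - z) * kern s z) \<partial>lborel)"
  proof (rule nn_integral_cong)
    fix z :: 'a
    have "\<bar>sdiff (bump s R) x z\<bar> = bump s R (x + z) + bump s R (x - z)"
      unfolding sdiff_def b using bump_nonneg[of s R "x + z"] bump_nonneg[of s R "x - z"] by linarith
    then show "ennreal (\<bar>sdiff (bump s R) x z\<bar> * kern s z) = ennreal (bump s R (x + z) * kern s z) + ennreal (bump s R (x - z) * kern s z)"
      by (simp add: distrib_right ennreal_plus)
  qed
  also have "\<dots> = (\<integral>\<^sup>+z. ennreal (bump s R (x + z) * kern s z) \<partial>lborel) + (\<integral>\<^sup>+z. ennreal (bump s R (x - z) * kern s z) \<partial>lborel)"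
    by (rule nn_integral_add) measurable
  also have "(\<integral>\<^sup>+z. ennreal (bump s R (x - z) * kern s z) \<partial>lborel) = (\<integral>\<^sup>+z. ennreal (bump s R (x + z) * kern s z) \<partial>lborel)"
    using nn_integral_lborel_reflect[of "\<lambda>z. ennreal (bump s R (x + z) * kern s z)" 0] by simp
  finally show ?thesis unfolding ext_pot_eq_bump by (simp add: mult_2)
qed

text \<open>Inside the ball v is bounded and \<open>sdiff_bump_L1\<close> applies. Outside, the
  second difference has one sign and integrates to twice the potential, which is integrable against
  |v|. The sphere itself is a null set.\<close>

lemma integrable_sdiff_bump_pair:
  fixes v :: "'a::euclidean_space \<Rightarrow> real"
  assumes s: "0 < s" "s < 1" and v: "tame s v" and R: "0 < R"
  shows "integrable (lborel \<Otimes>\<^sub>M lborel) (\<lambda>(x, z). v x * (sdiff (bump s R) x z * kern s z))"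
proof -
  note [measurable] = tame_measurable[OF v]
  obtain M where M: "0 \<le> M" "\<And>x. norm x \<le> R \<Longrightarrow> \<bar>v x\<bar> \<le> M" using tame_bounded[OF v] by blast
  define Z where "Z x = (\<integral>\<^sup>+z. ennreal (\<bar>sdiff (bump s R) x z\<bar> * kern s z) \<partial>lborel)" for x :: 'a
  have [measurable]: "Z \<in> borel_measurable borel" unfolding Z_def by measurable
  show ?thesis
    unfolding integrable_iff_bounded
  proof (intro conjI)
    show "(\<lambda>(x, z). v x * (sdiff (bump s R) x z * kern s z)) \<in> borel_measurable (lborel \<Otimes>\<^sub>M lborel)" by measurable
    have "(\<integral>\<^sup>+w. ennreal (norm (case w of (x, z) \<Rightarrow> v x * (sdiff (bump s R) x z * kern s z))) \<partial>(lborel \<Otimes>\<^sub>M lborel)) =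
      (\<integral>\<^sup>+x. (\<integral>\<^sup>+z. ennreal (norm (v x * (sdiff (bump s R) x z * kern s z))) \<partial>lborel) \<partial>lborel)"
      by (subst lborel.nn_integral_fst[symmetric]) auto
    also have "\<dots> = (\<integral>\<^sup>+x. ennreal \<bar>v x\<bar> * Z x \<partial>lborel)"
    proof (rule nn_integral_cong)
      fix x :: 'a
      have "(\<integral>\<^sup>+z. ennreal (norm (v x * (sdiff (bump s R) x z * kern s z))) \<partial>lborel) = (\<integral>\<^sup>+z. ennreal \<bar>v x\<bar> * ennreal (\<bar>sdiff (bump s R) x z\<bar> * kern s z) \<partial>lborel)"
        by (intro nn_integral_cong) (simp add: abs_mult ennreal_mult)
      also have "\<dots> = ennreal \<bar>v x\<bar> * Z x" unfolding Z_def by (rule nn_integral_cmult) measurable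
      finally show "(\<integral>\<^sup>+z. ennreal (norm (v x * (sdiff (bump s R) x z * kern s z))) \<partial>lborel) = ennreal \<bar>v x\<bar> * Z x" .
    qed
    also have "\<dots> \<le> (\<integral>\<^sup>+x. ennreal M * (indicator {..<R} (norm x) * Z x) + 2 * (indicator {R<..} (norm x) * (ennreal \<bar>v x\<bar> * ext_pot s s R x)) \<partial>lborel)"
    proof (rule nn_integral_mono_AE)
      show "AE x in lborel. ennreal \<bar>v x\<bar> * Z x \<le> ennreal M * (indicator {..<R} (norm x) * Z x) + 2 * (indicator {R<..} (norm x) * (ennreal \<bar>v x\<bar> * ext_pot s s R x))"
        using AE_norm_neq[of R, where 'a='a]
      proof eventually_elim
        case (elim x)
        show ?case
        proof (cases "norm x < R")
          case True
          then have "ennreal \<bar>v x\<bar> * Z x \<le> ennreal M * Z x" using M(2)[of x] by (intro mult_right_mono ennreal_leI) auto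
          then show ?thesis using True by simp
        next
          case False
          then have x: "R < norm x" using elim by simp
          show ?thesis using x unfolding Z_def nn_integral_sdiff_bump_exterior[OF R x] by (simp add: mult.left_commute)
        qed
      qed
    qed
    also have "\<dots> = ennreal M * (\<integral>\<^sup>+x. indicator {..<R} (norm x) * Z x \<partial>lborel) + 2 * (\<integral>\<^sup>+x. indicator {R<..} (norm x) * (ennreal \<bar>v x\<bar> * ext_pot s s R x) \<partial>lborel)"
      by (subst nn_integral_add) (auto simp: nn_integral_cmult)
    also have "\<dots> < \<infinity>" using sdiff_bump_L1[OF s R, where 'a='a] ext_pot_tame_finite[OF s v R]
      by (simp add: ennreal_add_less_top ennreal_mult_less_top Z_def)
    finally show "(\<integral>\<^sup>+w. ennreal (norm (case w of (x, z) \<Rightarrow> v x * (sdiff (bump s R) x z * kern s z))) \<partial>(lborel \<Otimes>\<^sub>M lborel)) < \<infinity>" .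
  qed
qed

section \<open>Self-adjointness of second differences and of the operator\<close>

lemma integral_lborel_translate:
  fixes f :: "'a::euclidean_space \<Rightarrow> real"
  assumes [measurable]: "f \<in> borel_measurable borel"
  shows "(LINT x|lborel. f (t + x)) = (LINT x|lborel. f x)"
proof -
  have "(LINT x|lborel. f x) = (LINT x|density (distr lborel borel (\<lambda>x::'a. t + 1 *\<^sub>R x)) (\<lambda>_. ennreal (\<bar>1\<bar> ^ DIM('a))). f x)"
    using lborel_affine[of 1 t] by simp
  also have "\<dots> = (LINT x|lborel. f (t + x))"
    by (subst integral_density) (auto simp: integral_distr)
  finally show ?thesis by simp
qed

lemma integrable_bump_mult:
  fixes g :: "'a::euclidean_space \<Rightarrow> real"
  assumes s: "0 < s" and R: "0 < R" and g: "continuous_on UNIV g"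
  shows "integrable lborel (\<lambda>x. bump s R x * g x)"
proof -
  have "integrable lborel (\<lambda>x. indicator (cball 0 R) x *\<^sub>R (bump s R x * g x))"
  proof (rule borel_integrable_compact)
    show "continuous_on (cball 0 R) (\<lambda>x. bump s R x * g x)"
      using continuous_on_subset[OF continuous_bump[OF s]] continuous_on_subset[OF g] by (intro continuous_on_mult) auto
  qed simp
  also have "(\<lambda>x. indicator (cball 0 R) x *\<^sub>R (bump s R x * g x)) = (\<lambda>x. bump s R x * g x)"
  proof (rule ext)
    fix x :: 'a
    show "indicator (cball 0 R) x *\<^sub>R (bump s R x * g x) = bump s R x * g x"
      using bump_outside[OF R, of x s] by (cases "norm x \<le> R") auto
  qed
  finally show ?thesis .
qed

text \<open>For fixed z a translation by z or - z moves the difference from one factor to the other.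
  The bounded support of the bump makes the three terms integrable one by one.\<close>

lemma sdiff_bump_symmetric:
  fixes v :: "'a::euclidean_space \<Rightarrow> real"
  assumes s: "0 < s" and R: "0 < R" and v: "continuous_on UNIV v"
  shows "(LINT x|lborel. bump s R x * sdiff v x z) = (LINT x|lborel. v x * sdiff (bump s R) x z)"
proof -
  have [measurable]: "v \<in> borel_measurable borel" by (rule borel_measurable_continuous_onI[OF v])
  let ?b = "bump s R :: 'a \<Rightarrow> real"
  have c: "continuous_on UNIV (\<lambda>x. v (x + t))" for t
    by (rule continuous_on_compose2[OF v]) (auto intro!: continuous_intros)
  have i: "integrable lborel (\<lambda>x. ?b x * v (x + t))" for t by (rule integrable_bump_mult[OF s R c])
  have j: "integrable lborel (\<lambda>x. ?b (x - t) * v x) \<and> (LINT x|lborel. ?b (x - t) * v x) = (LINT x|lborel. ?b x * v (x + t))" for t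
  proof
    have "has_bochner_integral lborel (\<lambda>x. ?b (- t + x) * v (- t + x + t)) (LINT x|lborel. ?b x * v (x + t))"
    proof (rule has_bochner_integral_iff[THEN iffD2], intro conjI)
      show "(LINT x|lborel. ?b (- t + x) * v (- t + x + t)) = (LINT x|lborel. ?b x * v (x + t))"
        by (rule integral_lborel_translate[of "\<lambda>x. ?b x * v (x + t)" "- t"]) measurable
      have "(\<integral>\<^sup>+x. ennreal (norm (?b (- t + x) * v (- t + x + t))) \<partial>lborel) = (\<integral>\<^sup>+x. ennreal (norm (?b x * v (x + t))) \<partial>lborel)"
        by (rule nn_integral_lborel_translate[of "\<lambda>x. ennreal (norm (?b x * v (x + t)))"]) measurable
      then show "integrable lborel (\<lambda>x. ?b (- t + x) * v (- t + x + t))"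
        using i[of t] unfolding integrable_iff_bounded by simp
    qed
    then have h: "has_bochner_integral lborel (\<lambda>x. ?b (x - t) * v x) (LINT x|lborel. ?b x * v (x + t))" by simp
    show "integrable lborel (\<lambda>x. ?b (x - t) * v x)" "(LINT x|lborel. ?b (x - t) * v x) = (LINT x|lborel. ?b x * v (x + t))"
      using h by (auto simp: has_bochner_integral_iff)
  qed
  have "(LINT x|lborel. ?b x * sdiff v x z) = (LINT x|lborel. 2 * (?b x * v (x + 0)) - ?b x * v (x + z) - ?b x * v (x + (- z)))"
    by (rule Bochner_Integration.integral_cong) (auto simp: sdiff_def algebra_simps)
  also have "\<dots> = 2 * (LINT x|lborel. ?b x * v (x + 0)) - (LINT x|lborel. ?b x * v (x + z)) - (LINT x|lborel. ?b x * v (x + (- z)))"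
    using i[of 0] i[of z] i[of "- z"] by simp
  also have "\<dots> = 2 * (LINT x|lborel. ?b (x - 0) * v x) - (LINT x|lborel. ?b (x - z) * v x) - (LINT x|lborel. ?b (x - (- z)) * v x)"
    using j[of 0] j[of z] j[of "- z"] by (simp only:)
  also have "\<dots> = (LINT x|lborel. 2 * (?b (x - 0) * v x) - ?b (x - z) * v x - ?b (x - (- z)) * v x)"
    using j[of 0] j[of z] j[of "- z"] by simp
  also have "\<dots> = (LINT x|lborel. v x * sdiff ?b x z)"
    by (rule Bochner_Integration.integral_cong) (auto simp: sdiff_def algebra_simps)
  finally show ?thesis .
qed

text \<open>Fubini brings the integration over z outside, where the symmetry at fixed z applies, and
  then takes it back inside. The first exchange rests on the regularity of v, the second on the
  integrability of the second differences of the bump up to the sphere.\<close>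

lemma bump_duality:
  fixes v :: "'a::euclidean_space \<Rightarrow> real"
  assumes s: "0 < s" "s < 1" and v: "tame s v" and R: "0 < R" and reg: "sreg s R v"
  shows "integrable lborel (\<lambda>x. bump s R x * opL s v x)"
    and "integrable lborel (\<lambda>x. v x * opL s (bump s R) x)"
    and "(LINT x|lborel. bump s R x * opL s v x) = (LINT x|lborel. v x * opL s (bump s R) x)"
proof -
  have vc: "continuous_on UNIV v" using v unfolding tame_def by (elim conjE)
  note i1 = integrable_bump_sdiff[OF s(1) v R reg] and i2 = integrable_sdiff_bump_pair[OF s v R]
  have e1: "(\<lambda>x. LINT z|lborel. bump s R x * (sdiff v x z * kern s z)) = (\<lambda>x. bump s R x * opL s v x)"
    by (simp add: opL_def fun_eq_iff)
  have e2: "(\<lambda>x. LINT z|lborel. v x * (sdiff (bump s R) x z * kern s z)) = (\<lambda>x. v x * opL s (bump s R) x)"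
    by (simp add: opL_def fun_eq_iff)
  show "integrable lborel (\<lambda>x. bump s R x * opL s v x)"
    using lborel_pair.integrable_fst[OF i1] unfolding e1 .
  show "integrable lborel (\<lambda>x. v x * opL s (bump s R) x)"
    using lborel_pair.integrable_fst[OF i2] unfolding e2 .
  have "(LINT x|lborel. bump s R x * opL s v x) = (LINT x|lborel. (LINT z|lborel. bump s R x * (sdiff v x z * kern s z)))"
    unfolding e1 ..
  also have "\<dots> = (LINT z|lborel. (LINT x|lborel. bump s R x * (sdiff v x z * kern s z)))"
    by (rule lborel_pair.Fubini_integral[symmetric, OF i1])
  also have "\<dots> = (LINT z|lborel. (LINT x|lborel. v x * (sdiff (bump s R) x z * kern s z)))"
    unfolding mult.assoc[symmetric] by (simp add: sdiff_bump_symmetric[OF s(1) R vc])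
  also have "\<dots> = (LINT x|lborel. (LINT z|lborel. v x * (sdiff (bump s R) x z * kern s z)))"
    by (rule lborel_pair.Fubini_integral[OF i2])
  also have "\<dots> = (LINT x|lborel. v x * opL s (bump s R) x)" unfolding e2 ..
  finally show "(LINT x|lborel. bump s R x * opL s v x) = (LINT x|lborel. v x * opL s (bump s R) x)" .
qed

lemma opL_bump_exterior:
  fixes x :: "'a::euclidean_space"
  assumes R: "0 < R" and x: "R < norm x"
  shows "opL s (bump s R) x = - 2 * enn2real (ext_pot s s R x)"
proof -
  have b: "bump s R x = 0" by (rule bump_outside[OF R]) (use x in simp)
  have "opL s (bump s R) x = - (LINT z|lborel. \<bar>sdiff (bump s R) x z\<bar> * kern s z)"
    unfolding opL_def Bochner_Integration.integral_minus[symmetric]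
  proof (rule Bochner_Integration.integral_cong)
    fix z :: 'a
    have "sdiff (bump s R) x z = - \<bar>sdiff (bump s R) x z\<bar>"
      unfolding sdiff_def b using bump_nonneg[of s R "x + z"] bump_nonneg[of s R "x - z"] by linarith
    then show "sdiff (bump s R) x z * kern s z = - (\<bar>sdiff (bump s R) x z\<bar> * kern s z)" by (metis minus_mult_left)
  qed simp
  also have "(LINT z|lborel. \<bar>sdiff (bump s R) x z\<bar> * kern s z) = enn2real (2 * ext_pot s s R x)"
    by (subst integral_eq_nn_integral) (auto simp: nn_integral_sdiff_bump_exterior[OF R x])
  finally show ?thesis by (simp add: enn2real_mult)
qed

section \<open>Comparison with the Poisson kernel\<close>

definition kap_cum :: "real \<Rightarrow> real \<Rightarrow> 'a::euclidean_space \<Rightarrow> real" where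
  "kap_cum s R x = (LINT r|lborel. indicator {0..R} r * (real DIM('a) * r ^ (DIM('a) - 1) * kap s r x))"

lemma ext_pot_real:
  assumes s: "0 < s" "s < 1"
  shows "\<exists>c>0. \<forall>R>0. \<forall>x::'a::euclidean_space. R < norm x \<longrightarrow>
    enn2real (ext_pot s s R x) = c * (R ^ DIM('a) * kap s R x - kap_cum s R x)"
proof -
  let ?n = "DIM('a)"
  obtain c where c: "0 < c" and W: "\<And>R x::'a. 0 < R \<Longrightarrow> R < norm x \<Longrightarrow>
    ext_pot s s R x + (\<integral>\<^sup>+r. ennreal (c * real ?n * r ^ (?n - 1) * indicator {0..R} r * kap s r x) \<partial>lborel) =
      ennreal (c * R ^ ?n * kap s R x)" using ext_pot_kap[OF s, where 'a='a] by blast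
  show ?thesis
  proof (intro exI[of _ c] conjI allI impI c)
    fix R :: real and x :: 'a assume R: "0 < R" and x: "R < norm x"
    let ?I = "\<integral>\<^sup>+r. ennreal (c * real ?n * r ^ (?n - 1) * indicator {0..R} r * kap s r x) \<partial>lborel"
    have [measurable]: "(\<lambda>r. kap s r x) \<in> borel_measurable borel" unfolding kap_def by measurable
    have "ext_pot s s R x \<le> ennreal (c * R ^ ?n * kap s R x)" "?I \<le> ennreal (c * R ^ ?n * kap s R x)"
      unfolding W[OF R x, symmetric] by auto
    then have "ext_pot s s R x < top" "?I < top" by (auto intro: le_less_trans)
    then obtain e i where e: "0 \<le> e" "ext_pot s s R x = ennreal e" and i: "0 \<le> i" "?I = ennreal i"
      by (cases "ext_pot s s R x"; cases "?I") auto
    have "ennreal (e + i) = ennreal (c * R ^ ?n * kap s R x)" using W[OF R x] e i by simp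
    then have ei: "e + i = c * R ^ ?n * kap s R x" using e i c R by (simp del: ennreal_plus)
    have "c * kap_cum s R x = (LINT r|lborel. c * real ?n * r ^ (?n - 1) * indicator {0..R} r * kap s r x)"
      unfolding kap_cum_def integral_mult_right_zero[symmetric]
      by (rule Bochner_Integration.integral_cong) auto
    also have "\<dots> = enn2real ?I"
      using c by (intro integral_eq_nn_integral) (auto simp: indicator_def)
    finally have "c * kap_cum s R x = i" using i by simp
    then show "enn2real (ext_pot s s R x) = c * (R ^ ?n * kap s R x - kap_cum s R x)"
      using e ei by (simp add: algebra_simps)
  qed
qed

text \<open>Radii r \<ge> |x| contribute 0, and r = |x| t scales |x| out of the rest. So the
  cumulative kernel is constant in the punctured ball, the counterpart of the constancy of
  \<open>opL s (bump s R)\<close> there.\<close>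

lemma kap_cum_interior:
  fixes x :: "'a::euclidean_space"
  assumes x: "x \<noteq> 0" "norm x < R"
  shows "kap_cum s R x = (LINT t|lborel. indicator {0..<1} t * (real DIM('a) * t ^ (DIM('a) - 1) * (t\<^sup>2 / (1 - t\<^sup>2)) powr s))"
proof -
  let ?n = "DIM('a)" and ?\<rho> = "norm x"
  have \<rho>: "0 < ?\<rho>" using x by simp
  have n: "?\<rho> * ?\<rho> ^ (?n - 1) = ?\<rho> ^ ?n"
    using DIM_positive[where 'a='a] by (simp flip: power_Suc)
  have "kap_cum s R x = ?\<rho> * (LINT t|lborel. indicator {0..R} (0 + ?\<rho> * t) * (real ?n * (0 + ?\<rho> * t) ^ (?n - 1) * kap s (0 + ?\<rho> * t) x))"
    unfolding kap_cum_def using lborel_integral_real_affine[of ?\<rho> "\<lambda>r. indicator {0..R} r * (real ?n * r ^ (?n - 1) * kap s r x)" 0] x by simp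
  also have "\<dots> = (LINT t|lborel. ?\<rho> * (indicator {0..R} (0 + ?\<rho> * t) * (real ?n * (0 + ?\<rho> * t) ^ (?n - 1) * kap s (0 + ?\<rho> * t) x)))"
    by simp
  also have "\<dots> = (LINT t|lborel. indicator {0..<1} t * (real ?n * t ^ (?n - 1) * (t\<^sup>2 / (1 - t\<^sup>2)) powr s))"
  proof (rule Bochner_Integration.integral_cong)
    fix t :: real
    show "?\<rho> * (indicator {0..R} (0 + ?\<rho> * t) * (real ?n * (0 + ?\<rho> * t) ^ (?n - 1) * kap s (0 + ?\<rho> * t) x)) =
      indicator {0..<1} t * (real ?n * t ^ (?n - 1) * (t\<^sup>2 / (1 - t\<^sup>2)) powr s)"
    proof (cases "0 \<le> t \<and> t < 1")
      case True
      have "?\<rho> * t < ?\<rho> * 1" using True \<rho> by (intro mult_strict_left_mono) auto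
      then have lt: "?\<rho> * t < ?\<rho>" by simp
      then have "?\<rho> * t \<le> R" using x(2) by linarith
      then have in1: "0 + ?\<rho> * t \<in> {0..R}" using True by simp
      have "(?\<rho> * t)\<^sup>2 / (?\<rho>\<^sup>2 - (?\<rho> * t)\<^sup>2) = t\<^sup>2 / (1 - t\<^sup>2)"
      proof -
        have "?\<rho>\<^sup>2 - (?\<rho> * t)\<^sup>2 = ?\<rho>\<^sup>2 * (1 - t\<^sup>2)" by (simp add: power_mult_distrib algebra_simps)
        then show ?thesis using \<rho> by (simp add: power_mult_distrib)
      qed
      then have k: "kap s (?\<rho> * t) x = (t\<^sup>2 / (1 - t\<^sup>2)) powr s / ?\<rho> ^ ?n"
        using lt unfolding kap_def by simp
      have "?\<rho> * (real ?n * (0 + ?\<rho> * t) ^ (?n - 1) * kap s (0 + ?\<rho> * t) x) = (?\<rho> * ?\<rho> ^ (?n - 1)) / ?\<rho> ^ ?n * (real ?n * t ^ (?n - 1) * (t\<^sup>2 / (1 - t\<^sup>2)) powr s)"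
        unfolding k add_0 by (simp add: power_mult_distrib)
      also have "\<dots> = real ?n * t ^ (?n - 1) * (t\<^sup>2 / (1 - t\<^sup>2)) powr s" unfolding n using \<rho> by simp
      finally show ?thesis using in1 True by simp
    next
      case False
      show ?thesis
      proof (cases "0 \<le> t")
        case T: True
        then have "?\<rho> * 1 \<le> ?\<rho> * t" using False by (intro mult_left_mono) auto
        then have "kap s (0 + ?\<rho> * t) x = 0" by (simp add: kap_def)
        then show ?thesis using False T by simp
      next
        case F: False
        then have "?\<rho> * t < 0" using \<rho> by (simp add: mult_pos_neg)
        then show ?thesis using F by simp
      qed
    qed
  qed simp
  finally show ?thesis .
qed

definition Mfun :: "real \<Rightarrow> ('a::euclidean_space \<Rightarrow> real) \<Rightarrow> real \<Rightarrow> real" where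
  "Mfun s v R = R ^ DIM('a) * pavg s v R - (LINT r|lborel. indicator {0..R} r * (real DIM('a) * r ^ (DIM('a) - 1) * pavg s v r))"

lemma kap_zero [simp]: "kap s 0 y = 0"
  by (simp add: kap_def)

text \<open>The bound uniform in r permits Fubini in radius and point. It rewrites M(R) through a
  single kernel, which outside the ball is a multiple of the potential by
  \<open>ext_pot_real\<close>.\<close>

lemma Mfun_kernel:
  fixes v :: "'a::euclidean_space \<Rightarrow> real"
  assumes s: "0 < s" "s < 1" and v: "tame s v" and R: "0 < R"
  shows "integrable lborel (\<lambda>y. v y * (R ^ DIM('a) * kap s R y - kap_cum s R y))"
    and "Mfun s v R = (LINT y|lborel. v y * (R ^ DIM('a) * kap s R y - kap_cum s R y))"
    and "integrable lborel (\<lambda>r. indicator {0..R} r * (real DIM('a) * r ^ (DIM('a) - 1) * pavg s v r))"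
proof -
  let ?n = "DIM('a)"
  note [measurable] = tame_measurable[OF v]
  obtain B where B: "0 \<le> B" "\<And>r. 0 < r \<Longrightarrow> r \<le> R \<Longrightarrow> (\<integral>\<^sup>+y. ennreal (kap s r y * \<bar>v y\<bar>) \<partial>lborel) \<le> ennreal B"
    using tame_kap_bound[OF s v R] by blast
  define h where "h = (\<lambda>(r::real, y). (indicator {0..R} r * (real ?n * r ^ (?n - 1))) * (kap s r y * v y))"
  have [measurable]: "h \<in> borel_measurable (borel \<Otimes>\<^sub>M borel)"
    unfolding h_def by measurable
  have I: "integrable (lborel \<Otimes>\<^sub>M lborel) h"
    unfolding integrable_iff_bounded
  proof (intro conjI)
    show "h \<in> borel_measurable (lborel \<Otimes>\<^sub>M lborel)" by measurable
    have "(\<integral>\<^sup>+w. ennreal (norm (h w)) \<partial>(lborel \<Otimes>\<^sub>M lborel)) = (\<integral>\<^sup>+r. (\<integral>\<^sup>+y. ennreal (norm (h (r, y))) \<partial>lborel) \<partial>lborel)"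
      by (subst lborel.nn_integral_fst[symmetric]) auto
    also have "\<dots> \<le> (\<integral>\<^sup>+r. ennreal (real ?n * R ^ (?n - 1)) * ennreal B * indicator {0..R} r \<partial>lborel)"
    proof (rule nn_integral_mono)
      fix r :: real
      have "(\<integral>\<^sup>+y. ennreal (norm (h (r, y))) \<partial>lborel) = (\<integral>\<^sup>+y. ennreal (indicator {0..R} r * (real ?n * r ^ (?n - 1))) * ennreal (kap s r y * \<bar>v y\<bar>) \<partial>lborel)"
        by (intro nn_integral_cong) (auto simp: h_def abs_mult indicator_def ennreal_mult)
      also have "\<dots> = ennreal (indicator {0..R} r * (real ?n * r ^ (?n - 1))) * (\<integral>\<^sup>+y. ennreal (kap s r y * \<bar>v y\<bar>) \<partial>lborel)"
        by (rule nn_integral_cmult) measurable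
      also have "\<dots> \<le> ennreal (real ?n * R ^ (?n - 1)) * ennreal B * indicator {0..R} r"
      proof (cases "0 < r \<and> r \<le> R")
        case True
        have "ennreal (real ?n * r ^ (?n - 1)) * (\<integral>\<^sup>+y. ennreal (kap s r y * \<bar>v y\<bar>) \<partial>lborel) \<le> ennreal (real ?n * R ^ (?n - 1)) * ennreal B"
          using True by (intro mult_mono ennreal_leI B mult_left_mono power_mono) auto
        then show ?thesis using True by simp
      next
        case False
        then show ?thesis by (cases "r = 0") auto
      qed
      finally show "(\<integral>\<^sup>+y. ennreal (norm (h (r, y))) \<partial>lborel) \<le> ennreal (real ?n * R ^ (?n - 1)) * ennreal B * indicator {0..R} r" .
    qed
    also have "\<dots> = ennreal (real ?n * R ^ (?n - 1)) * ennreal B * emeasure lborel {0..R}"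
      by (rule nn_integral_cmult_indicator) simp
    also have "\<dots> < \<infinity>" using R by (simp add: ennreal_mult_less_top)
    finally show "(\<integral>\<^sup>+w. ennreal (norm (h w)) \<partial>(lborel \<Otimes>\<^sub>M lborel)) < \<infinity>" .
  qed
  have I': "integrable (lborel \<Otimes>\<^sub>M lborel) (\<lambda>(r, y). h (r, y))" using I by simp
  have e1: "(LINT y|lborel. h (r, y)) = indicator {0..R} r * (real ?n * r ^ (?n - 1) * pavg s v r)" for r
    unfolding h_def pavg_def by (simp add: mult.assoc)
  have e2: "(LINT r|lborel. h (r, y)) = v y * kap_cum s R y" for y
    unfolding h_def kap_cum_def integral_mult_right_zero[symmetric] by (simp add: mult_ac)
  show "integrable lborel (\<lambda>r. indicator {0..R} r * (real ?n * r ^ (?n - 1) * pavg s v r))"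
    using lborel_pair.integrable_fst[OF I'] unfolding e1 .
  have iJ: "integrable lborel (\<lambda>y. v y * kap_cum s R y)"
    using lborel_pair.integrable_snd[OF I'] unfolding e2 .
  have iK: "integrable lborel (\<lambda>y. v y * (R ^ ?n * kap s R y))"
    using integrable_mult_right[OF integrable_kap[OF s v R], of "R ^ ?n"] by (simp add: mult_ac)
  have "(LINT y|lborel. (LINT r|lborel. h (r, y))) = (LINT r|lborel. (LINT y|lborel. h (r, y)))"
    by (rule lborel_pair.Fubini_integral[OF I'])
  then have F: "(LINT y|lborel. v y * kap_cum s R y) = (LINT r|lborel. indicator {0..R} r * (real ?n * r ^ (?n - 1) * pavg s v r))"
    unfolding e1 e2 .
  have eq: "(\<lambda>y. v y * (R ^ ?n * kap s R y - kap_cum s R y)) = (\<lambda>y. v y * (R ^ ?n * kap s R y) - v y * kap_cum s R y)"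
    by (simp add: algebra_simps)
  show "integrable lborel (\<lambda>y. v y * (R ^ ?n * kap s R y - kap_cum s R y))"
    unfolding eq using iK iJ by (rule Bochner_Integration.integrable_diff)
  have "R ^ ?n * pavg s v R = (LINT y|lborel. v y * (R ^ ?n * kap s R y))"
    unfolding pavg_def integral_mult_right_zero[symmetric] by (simp add: mult_ac)
  then show "Mfun s v R = (LINT y|lborel. v y * (R ^ ?n * kap s R y - kap_cum s R y))"
    unfolding Mfun_def eq Bochner_Integration.integral_diff[OF iK iJ] F by simp
qed

text \<open>For constant v the average is constant in r by scaling, and n r^(n - 1) integrates to
  R^n.\<close>

lemma Mfun_const:
  assumes s: "0 < s" "s < 1" and R: "0 < R"
  shows "Mfun s (\<lambda>_::'a::euclidean_space. 1) R = 0"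
proof -
  let ?n = "DIM('a)"
  define p where "p = (LINT y::'a|lborel. kap s 1 y)"
  have p: "pavg s (\<lambda>_::'a. 1) r = p" if "0 < r" for r
    unfolding pavg_def p_def using pavg_near_scale[OF that, of "\<lambda>_::'a. 1" s] by simp
  have "((\<lambda>r. real ?n * r ^ (?n - 1)) has_integral (R ^ ?n - 0 ^ ?n)) {0..R}"
    using R by (intro fundamental_theorem_of_calculus)
      (auto intro!: derivative_eq_intros simp: has_real_derivative_iff_has_vector_derivative[symmetric])
  then have "(\<integral>\<^sup>+r. ennreal (real ?n * r ^ (?n - 1)) * indicator {0..R} r \<partial>lborel) = ennreal (R ^ ?n - 0 ^ ?n)"
    by (intro nn_integral_has_integral_lebesgue') auto
  moreover have "(\<integral>\<^sup>+r. ennreal (real ?n * r ^ (?n - 1)) * indicator {0..R} r \<partial>lborel) = (\<integral>\<^sup>+r. ennreal (indicator {0..R} r * (real ?n * r ^ (?n - 1))) \<partial>lborel)"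
    by (intro nn_integral_cong) (auto simp: indicator_def)
  ultimately have nn: "(\<integral>\<^sup>+r. ennreal (indicator {0..R} r * (real ?n * r ^ (?n - 1))) \<partial>lborel) = ennreal (R ^ ?n)"
    using DIM_positive[where 'a='a] by (simp add: zero_power)
  have I1: "(LINT r|lborel. indicator {0..R} r * (real ?n * r ^ (?n - 1))) = R ^ ?n"
  proof -
    have "(LINT r|lborel. indicator {0..R} r * (real ?n * r ^ (?n - 1))) = enn2real (\<integral>\<^sup>+r. ennreal (indicator {0..R} r * (real ?n * r ^ (?n - 1))) \<partial>lborel)"
      by (rule integral_eq_nn_integral) (auto simp: indicator_def)
    then show ?thesis unfolding nn using R by simp
  qed
  have "(LINT r|lborel. indicator {0..R} r * (real ?n * r ^ (?n - 1) * pavg s (\<lambda>_::'a. 1) r)) =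
     (LINT r|lborel. (indicator {0..R} r * (real ?n * r ^ (?n - 1))) * p)"
  proof (rule integral_cong_AE)
    have [measurable]: "(\<lambda>r. pavg s (\<lambda>_::'a. 1) r) \<in> borel_measurable borel" unfolding pavg_def kap_def by measurable
    show "(\<lambda>r. indicator {0..R} r * (real ?n * r ^ (?n - 1) * pavg s (\<lambda>_::'a. 1) r)) \<in> borel_measurable lborel" by measurable
    have "AE r::real in lborel. r \<noteq> 0" by (rule AE_lborel_singleton)
    then show "AE r in lborel. indicator {0..R} r * (real ?n * r ^ (?n - 1) * pavg s (\<lambda>_::'a. 1) r) = (indicator {0..R} r * (real ?n * r ^ (?n - 1))) * p"
    proof eventually_elim
      case (elim r)
      then show ?case using p[of r] by (cases "0 < r") (auto simp: indicator_def)
    qed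
  qed measurable
  also have "\<dots> = R ^ ?n * p" using I1 by simp
  finally show ?thesis unfolding Mfun_def p[OF R] by simp
qed

text \<open>Outside the ball the kernels of the two quantities cancel, so their sum is \<gamma> - 2
  c j times the integral of v over the ball. Neither \<gamma> nor j depends on R or v; therefore the
  single instance R = 1 and v = 1, for which M and \<open>opL\<close> both vanish, settles all
  others.\<close>

lemma Mfun_eq_bump:
  assumes s: "0 < s" "s < 1"
  shows "\<exists>c>0. \<forall>R>0. \<forall>v::'a::euclidean_space \<Rightarrow> real. tame s v \<longrightarrow> sreg s R v \<longrightarrow>
    c * Mfun s v R = - (LINT x|lborel. bump s R x * opL s v x)"
proof -
  let ?n = "DIM('a)"
  obtain c where c: "0 < c" and E: "\<And>R x::'a. 0 < R \<Longrightarrow> R < norm x \<Longrightarrow>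
     enn2real (ext_pot s s R x) = c * (R ^ ?n * kap s R x - kap_cum s R x)"
    using ext_pot_real[OF s, where 'a='a] by blast
  define \<gamma> where "\<gamma> = (LINT z|lborel. sdiff (bump s 1) (0::'a) z * kern s z)"
  define j where "j = (LINT t|lborel. indicator {0..<1} t * (real ?n * t ^ (?n - 1) * (t\<^sup>2 / (1 - t\<^sup>2)) powr s))"
  have diff: "2 * c * Mfun s v R + (LINT x|lborel. bump s R x * opL s v x) = (\<gamma> - 2 * c * j) * (LINT x|lborel. indicator (ball 0 R) x * v x)"
    if R: "0 < R" and v: "tame s v" and reg: "sreg s R v" for R and v :: "'a \<Rightarrow> real"
  proof -
    note [measurable] = tame_measurable[OF v]
    have [measurable]: "ball (0::'a) R \<in> sets borel" by simp
    note dual = bump_duality[OF s v R reg] and ker = Mfun_kernel[OF s v R]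
    let ?f = "\<lambda>y. v y * (R ^ ?n * kap s R y - kap_cum s R y)" and ?g = "\<lambda>x. v x * opL s (bump s R) x"
    have "2 * c * Mfun s v R + (LINT x|lborel. bump s R x * opL s v x) = (LINT x|lborel. 2 * c * ?f x + ?g x)"
      unfolding dual(3) ker(2) using ker(1) dual(2) by simp
    also have "\<dots> = (LINT x|lborel. (\<gamma> - 2 * c * j) * (indicator (ball 0 R) x * v x))"
    proof (rule integral_cong_AE)
      show "(\<lambda>x. 2 * c * ?f x + ?g x) \<in> borel_measurable lborel"
        using borel_measurable_integrable[OF ker(1)] borel_measurable_integrable[OF dual(2)] by measurable
      have "AE x::'a in lborel. x \<noteq> 0" by (rule AE_lborel_singleton)
      with AE_norm_neq[of R, where 'a='a]
      show "AE x in lborel. 2 * c * ?f x + ?g x = (\<gamma> - 2 * c * j) * (indicator (ball 0 R) x * v x)"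
      proof eventually_elim
        case (elim x)
        show ?case
        proof (cases "norm x < R")
          case True
          have k0: "kap s R x = 0" using True by (simp add: kap_def)
          have "opL s (bump s R) x = \<gamma>" unfolding opL_def \<gamma>_def by (rule integral_sdiff_bump_const[OF s R True])
          moreover have "kap_cum s R x = j" unfolding j_def by (rule kap_cum_interior[OF elim(2) True])
          ultimately show ?thesis using True k0 by (simp add: algebra_simps)
        next
          case False
          then have x: "R < norm x" using elim by simp
          show ?thesis unfolding opL_bump_exterior[OF R x] E[OF R x] using x by simp
        qed
      qed
    qed measurable
    also have "\<dots> = (\<gamma> - 2 * c * j) * (LINT x|lborel. indicator (ball 0 R) x * v x)" by simp
    finally show ?thesis .
  qed
  have "(\<gamma> - 2 * c * j) * (LINT x|lborel. indicator (ball 0 1) x * (\<lambda>_::'a. 1) x) = 0"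
  proof -
    have "sreg s 1 (\<lambda>_::'a. 1)" unfolding sreg_def by (intro exI[of _ 0] exI[of _ "2 * s + 1"]) (simp add: sdiff_def)
    then have "2 * c * Mfun s (\<lambda>_::'a. 1) 1 + (LINT x|lborel. bump s 1 x * opL s (\<lambda>_::'a. 1) x) = (\<gamma> - 2 * c * j) * (LINT x|lborel. indicator (ball 0 1) x * (\<lambda>_::'a. 1) x)"
      by (intro diff tame_const s) auto
    moreover have "opL s (\<lambda>_::'a. 1) x = 0" for x by (simp add: opL_def sdiff_def)
    ultimately show ?thesis using Mfun_const[OF s zero_less_one, where 'a='a] by simp
  qed
  moreover have "(LINT x|lborel. indicator (ball 0 1) x * (\<lambda>_::'a. 1) x) \<noteq> (0::real)"
    using content_ball_pos[of 1 "0::'a"] by simp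
  ultimately have "\<gamma> - 2 * c * j = 0" by (metis mult_eq_0_iff)
  then have "2 * c * Mfun s v R = - (LINT x|lborel. bump s R x * opL s v x)" if "0 < R" "tame s v" "sreg s R v" for R and v :: "'a \<Rightarrow> real"
    using diff[OF that] by simp
  then show ?thesis using c by (intro exI[of _ "2 * c"]) auto
qed

lemma Mfun_mono:
  fixes v :: "'a::euclidean_space \<Rightarrow> real"
  assumes s: "0 < s" "s < 1" and v: "tame s v" and reg: "\<And>R. 0 < R \<Longrightarrow> R < \<rho> \<Longrightarrow> sreg s R v"
    and sub: "\<And>x. norm x < \<rho> \<Longrightarrow> opL s v x \<le> 0"
    and R: "0 < R" "R \<le> R'" "R' < \<rho>"
  shows "Mfun s v R \<le> Mfun s v R'"
proof -
  obtain c where c: "0 < c" and E: "\<And>R. 0 < R \<Longrightarrow> sreg s R v \<Longrightarrow> c * Mfun s v R = - (LINT x|lborel. bump s R x * opL s v x)"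
    using Mfun_eq_bump[OF s, where 'a='a] v by blast
  have r: "sreg s R v" "sreg s R' v" using R reg by auto
  have R': "0 < R'" using R by simp
  have "(LINT x|lborel. bump s R' x * opL s v x) \<le> (LINT x|lborel. bump s R x * opL s v x)"
  proof (rule integral_mono[OF bump_duality(1)[OF s v R' r(2)] bump_duality(1)[OF s v R(1) r(1)]])
    fix x :: 'a
    have le: "bump s R x \<le> bump s R' x" unfolding bump_def using s R by (intro tpow_mono) (auto simp: power_mono)
    show "bump s R' x * opL s v x \<le> bump s R x * opL s v x"
    proof (cases "norm x < R'")
      case True
      then show ?thesis using le sub[of x] R by (intro mult_right_mono_neg) auto
    next
      case False
      then show ?thesis using bump_outside[OF R', of x s] bump_outside[OF R(1), of x s] R by simp
    qed
  qed
  then have "c * Mfun s v R \<le> c * Mfun s v R'" using E[OF R(1) r(1)] E[OF R' r(2)] by simp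
  then show ?thesis using c by simp
qed

section \<open>Monotonicity of the averages\<close>

text \<open>No integrable function dominates the kernels with moving singularity directly. The part
  of v in the ball of radius 2 b is therefore rescaled, so that the kernel is fixed and v moves,
  while the far part keeps the original variable, where the kernels have a common majorant.\<close>

lemma pavg_continuous_on:
  fixes v :: "'a::euclidean_space \<Rightarrow> real"
  assumes s: "0 < s" "s < 1" and v: "tame s v" and ab: "0 < a" "a < b"
  shows "continuous_on {a<..<b} (pavg s v)"
  unfolding continuous_on_sequentially comp_def
proof (intro allI ballI impI, elim conjE)
  fix X :: "nat \<Rightarrow> real" and r :: real
  assume r: "r \<in> {a<..<b}" and X: "\<forall>n. X n \<in> {a<..<b}" and lim: "X \<longlonglongrightarrow> r"
  note [measurable] = tame_measurable[OF v]
  have [measurable]: "ball (0::'a) (2 * b) \<in> sets borel" by simp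
  have vc: "continuous_on UNIV v" using v unfolding tame_def by (elim conjE)
  let ?p = "real DIM('a) + 2 * s"
  let ?near = "\<lambda>y. indicator (ball 0 (2 * b)) y * v y" and ?far = "\<lambda>y. indicator (- ball 0 (2 * b)) y * v y"
  obtain M where M: "0 \<le> M" "\<And>x. norm x \<le> 2 * b \<Longrightarrow> \<bar>v x\<bar> \<le> M" using tame_bounded[OF v] by blast
  have split: "pavg s v t = (LINT w|lborel. kap s 1 w * ?near (t *\<^sub>R w)) + (LINT y|lborel. kap s t y * ?far y)" if t: "0 < t" for t
  proof -
    have I: "integrable lborel (\<lambda>y. kap s t y * v y)" by (rule integrable_kap[OF s v t])
    have i1: "integrable lborel (\<lambda>y. kap s t y * ?near y)"
      by (rule Bochner_Integration.integrable_bound[OF I]) (auto simp: indicator_def)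
    have i2: "integrable lborel (\<lambda>y. kap s t y * ?far y)"
      by (rule Bochner_Integration.integrable_bound[OF I]) (auto simp: indicator_def)
    have "pavg s v t = (LINT y|lborel. kap s t y * ?near y + kap s t y * ?far y)"
      unfolding pavg_def by (rule Bochner_Integration.integral_cong) (auto simp: indicator_def)
    also have "\<dots> = (LINT y|lborel. kap s t y * ?near y) + (LINT y|lborel. kap s t y * ?far y)"
      by (rule Bochner_Integration.integral_add[OF i1 i2])
    also have "(LINT y|lborel. kap s t y * ?near y) = (LINT w|lborel. kap s 1 w * ?near (t *\<^sub>R w))"
      by (rule pavg_near_scale[OF t]) measurable
    finally show ?thesis .
  qed
  have near: "(\<lambda>n. LINT w|lborel. kap s 1 w * ?near (X n *\<^sub>R w)) \<longlonglongrightarrow> (LINT w|lborel. kap s 1 w * ?near (r *\<^sub>R w))"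
  proof (rule integral_dominated_convergence[where w="\<lambda>w. M * kap s 1 w"])
    have "integrable lborel (\<lambda>w::'a. kap s 1 w * 1)" by (rule integrable_kap[OF s tame_const]) (use s in auto)
    then show "integrable lborel (\<lambda>w::'a. M * kap s 1 w)" by simp
    \<comment> \<open>The cutoff is discontinuous where r |w| = 2 b, which is a null set in
      w.\<close>
    show "AE w in lborel. (\<lambda>n. kap s 1 w * ?near (X n *\<^sub>R w)) \<longlonglongrightarrow> kap s 1 w * ?near (r *\<^sub>R w)"
      using AE_norm_neq[of "2 * b / r", where 'a='a]
    proof eventually_elim
      case (elim w)
      have l: "(\<lambda>n. norm (X n *\<^sub>R w)) \<longlonglongrightarrow> norm (r *\<^sub>R w)" by (intro tendsto_intros lim)
      have ne: "norm (r *\<^sub>R w) \<noteq> 2 * b" using elim r ab by (auto simp: field_simps)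
      have "eventually (\<lambda>n. indicator (ball (0::'a) (2 * b)) (X n *\<^sub>R w) = (indicator (ball 0 (2 * b)) (r *\<^sub>R w) :: real)) sequentially"
      proof (cases "norm (r *\<^sub>R w) < 2 * b")
        case True
        have "eventually (\<lambda>n. norm (X n *\<^sub>R w) < 2 * b) sequentially" by (rule order_tendstoD(2)[OF l True])
        then show ?thesis by eventually_elim (use True in auto)
      next
        case False
        then have "2 * b < norm (r *\<^sub>R w)" using ne by simp
        from order_tendstoD(1)[OF l this] show ?thesis by eventually_elim (use False in auto)
      qed
      then have t1: "(\<lambda>n. indicator (ball (0::'a) (2 * b)) (X n *\<^sub>R w)) \<longlonglongrightarrow> (indicator (ball 0 (2 * b)) (r *\<^sub>R w) :: real)"
        by (rule tendsto_eventually)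
      have "isCont v (r *\<^sub>R w)" using vc by (simp add: continuous_on_eq_continuous_at)
      then have t2: "(\<lambda>n. v (X n *\<^sub>R w)) \<longlonglongrightarrow> v (r *\<^sub>R w)"
        by (rule isCont_tendsto_compose) (intro tendsto_intros lim)
      show ?case by (intro tendsto_mult tendsto_const t1 t2)
    qed
    show "AE w in lborel. norm (kap s 1 w * ?near (X n *\<^sub>R w)) \<le> M * kap s 1 w" for n
    proof (rule AE_I2)
      fix w :: 'a
      have "\<bar>?near (X n *\<^sub>R w)\<bar> \<le> M" using M by (auto simp: indicator_def)
      then have "kap s 1 w * \<bar>?near (X n *\<^sub>R w)\<bar> \<le> kap s 1 w * M" by (rule mult_left_mono) simp
      then show "norm (kap s 1 w * ?near (X n *\<^sub>R w)) \<le> M * kap s 1 w" by (simp add: abs_mult mult.commute)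
    qed
  qed measurable
  define K where "K = (4/3) powr s * b powr (2 * s) * ((2 * b) powr - ?p * (1 + (2 * b) powr ?p))"
  have far: "(\<lambda>n. LINT y|lborel. kap s (X n) y * ?far y) \<longlonglongrightarrow> (LINT y|lborel. kap s r y * ?far y)"
  proof (rule integral_dominated_convergence[where w="\<lambda>y. K * (\<bar>v y\<bar> / (1 + norm y powr ?p))"])
    show "integrable lborel (\<lambda>y. K * (\<bar>v y\<bar> / (1 + norm y powr ?p)))"
      using v unfolding tame_def by (elim conjE) (rule integrable_mult_right)
    show "AE y in lborel. (\<lambda>n. kap s (X n) y * ?far y) \<longlonglongrightarrow> kap s r y * ?far y"
    proof (rule AE_I2)
      fix y :: 'a
      show "(\<lambda>n. kap s (X n) y * ?far y) \<longlonglongrightarrow> kap s r y * ?far y"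
      proof (cases "2 * b \<le> norm y")
        case True
        have lt: "t < norm y" if "t \<in> {a<..<b}" for t using that True ab by auto
        have k: "kap s t y = (t\<^sup>2 / ((norm y)\<^sup>2 - t\<^sup>2)) powr s / norm y ^ DIM('a)" if "t \<in> {a<..<b}" for t
          using lt[OF that] by (simp add: kap_def)
        have Q: "0 < (norm y)\<^sup>2 - r\<^sup>2" using lt[OF r] r ab by (simp add: power_strict_mono)
        have y0: "norm y ^ DIM('a) \<noteq> 0" using True ab by auto
        have "(\<lambda>n. ((X n)\<^sup>2 / ((norm y)\<^sup>2 - (X n)\<^sup>2)) powr s / norm y ^ DIM('a)) \<longlonglongrightarrow> (r\<^sup>2 / ((norm y)\<^sup>2 - r\<^sup>2)) powr s / norm y ^ DIM('a)"
          by (intro tendsto_intros lim) (use Q y0 r ab in auto)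
        then have "(\<lambda>n. kap s (X n) y) \<longlonglongrightarrow> kap s r y" using k X r by simp
        then show ?thesis by (intro tendsto_mult tendsto_const)
      qed simp
    qed
    show "AE y in lborel. norm (kap s (X n) y * ?far y) \<le> K * (\<bar>v y\<bar> / (1 + norm y powr ?p))" for n
    proof (rule AE_I2)
      fix y :: 'a
      have Xn: "0 < X n" "X n \<le> b" using X[rule_format, of n] ab by auto
      show "norm (kap s (X n) y * ?far y) \<le> K * (\<bar>v y\<bar> / (1 + norm y powr ?p))"
      proof (cases "2 * b \<le> norm y")
        case True
        have "kap s (X n) y \<le> K / (1 + norm y powr ?p)"
          unfolding K_def using True Xn s by (intro kap_tame_far) auto
        then have "kap s (X n) y * \<bar>v y\<bar> \<le> K / (1 + norm y powr ?p) * \<bar>v y\<bar>" by (intro mult_right_mono) auto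
        then show ?thesis using True by (simp add: abs_mult)
      next
        case False
        have "0 \<le> K" unfolding K_def by (intro mult_nonneg_nonneg add_nonneg_nonneg) auto
        then show ?thesis using False by (auto intro!: mult_nonneg_nonneg divide_nonneg_nonneg add_nonneg_nonneg)
      qed
    qed
  qed measurable
  have "(\<lambda>n. (LINT w|lborel. kap s 1 w * ?near (X n *\<^sub>R w)) + (LINT y|lborel. kap s (X n) y * ?far y)) \<longlonglongrightarrow>
    (LINT w|lborel. kap s 1 w * ?near (r *\<^sub>R w)) + (LINT y|lborel. kap s r y * ?far y)"
    by (rule tendsto_add[OF near far])
  moreover have "0 < r" "\<And>n. 0 < X n" using r X ab by (auto intro: less_trans)
  ultimately show "(\<lambda>n. pavg s v (X n)) \<longlonglongrightarrow> pavg s v r" by (simp only: split)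
qed

lemma pavg_mono:
  fixes v :: "'a::euclidean_space \<Rightarrow> real"
  assumes s: "0 < s" "s < 1" and v: "tame s v"
    and M: "\<And>R R'. 0 < R \<Longrightarrow> R \<le> R' \<Longrightarrow> R' < \<rho> \<Longrightarrow> Mfun s v R \<le> Mfun s v R'"
    and r: "0 < r" "r \<le> r'" "r' < \<rho>"
  shows "pavg s v r \<le> pavg s v r'"
proof -
  let ?n = "DIM('a)"
  have n: "0 < ?n" by simp
  define f where "f t = real ?n * t ^ (?n - 1) * pavg s v t" for t
  define Q where "Q t = (LINT u|lborel. indicator {0..t} u * f u)" for t
  have Mf: "Mfun s v t = t ^ ?n * pavg s v t - Q t" for t
    unfolding Mfun_def Q_def f_def ..
  have fi: "integrable lborel (\<lambda>u. indicator {0..t} u * f u)" if "0 < t" for t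
    unfolding f_def by (rule Mfun_kernel(3)[OF s v that])
  have fc: "continuous_on {a<..<b} f" if "0 < a" "a < b" for a b
    unfolding f_def by (intro continuous_intros pavg_continuous_on s v that)
  \<comment> \<open>The base point a > 0 keeps the argument on an interval where continuity of P has
    been proved; the integral over {0..a} is a constant.\<close>
  have dQ: "(Q has_real_derivative f t) (at t)" if t: "0 < t" for t
  proof -
    define a where "a = t / 2"
    define b where "b = 2 * t"
    have ab: "0 < a" "a < t" "t < b" using t by (auto simp: a_def b_def)
    have c: "continuous_on {a..b} f"
      by (rule continuous_on_subset[OF fc[of "a / 2" "2 * b"]]) (use ab in auto)
    have Qa: "Q u = Q a + integral {a..u} f" if u: "u \<in> {a<..<b}" for u
    proof -
      have s1: "set_integrable lborel {a..u} f"
        by (rule borel_integrable_atLeastAtMost') (rule continuous_on_subset[OF c], use u in auto)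
      have "Q u - Q a = (LINT x|lborel. indicator {0..u} x * f x - indicator {0..a} x * f x)"
        unfolding Q_def using fi[of u] fi[of a] ab u by simp
      also have "\<dots> = (LINT x|lborel. indicator {a..u} x *\<^sub>R f x)"
      proof (rule integral_cong_AE)
        have ne: "AE x::real in lborel. x \<noteq> a" by (rule AE_lborel_singleton)
        show "AE x in lborel. indicator {0..u} x * f x - indicator {0..a} x * f x = indicator {a..u} x *\<^sub>R f x"
          using ne by eventually_elim (use ab u in \<open>auto simp: indicator_def\<close>)
        show "(\<lambda>x. indicator {0..u} x * f x - indicator {0..a} x * f x) \<in> borel_measurable lborel"
          using borel_measurable_integrable[OF fi[of u]] borel_measurable_integrable[OF fi[of a]] ab u by (intro borel_measurable_diff) auto
        show "(\<lambda>x. indicator {a..u} x *\<^sub>R f x) \<in> borel_measurable lborel"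
          using s1 unfolding set_integrable_def by (rule borel_measurable_integrable)
      qed
      also have "\<dots> = integral {a..u} f"
        using set_borel_integral_eq_integral(2)[OF s1] unfolding set_lebesgue_integral_def .
      finally show ?thesis by simp
    qed
    have "((\<lambda>u. integral {a..u} f) has_real_derivative f t) (at t within {a..b})"
      by (rule integral_has_real_derivative[OF c]) (use ab in auto)
    then have "((\<lambda>u. integral {a..u} f) has_real_derivative f t) (at t)"
      using ab at_within_interior[of t "{a..b}"] by simp
    then have "((\<lambda>u. Q a + integral {a..u} f) has_real_derivative f t) (at t)"
      by (auto intro!: derivative_eq_intros)
    then show ?thesis
      by (rule has_field_derivative_transform_within_open[of _ _ _ "{a<..<b}"]) (use ab Qa in auto)
  qed
  \<comment> \<open>If M kept the value M(r) from r on, P would equal g. In general the derivative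
    of g is n t^(n - 1) (M(t) - M(r)) / t^(2 n), which is nonnegative; moreover g agrees with P at r
    and lies below P at r'.\<close>
  define g where "g t = (Q t + Mfun s v r) / t ^ ?n" for t
  have "g r \<le> g r'"
  proof (rule DERIV_nonneg_imp_nondecreasing[OF r(2)])
    fix t assume t: "r \<le> t" "t \<le> r'"
    then have t0: "0 < t" using r by simp
    have D: "(g has_real_derivative (f t * t ^ ?n - (Q t + Mfun s v r) * (real ?n * t ^ (?n - 1))) / (t ^ ?n * t ^ ?n)) (at t)"
      unfolding g_def using t0 by (auto intro!: derivative_eq_intros dQ)
    have "f t * t ^ ?n - (Q t + Mfun s v r) * (real ?n * t ^ (?n - 1)) = real ?n * t ^ (?n - 1) * (Mfun s v t - Mfun s v r)"
      unfolding Mf[of t] f_def by (simp add: algebra_simps)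
    also have "\<dots> \<ge> 0" using M[of r t] t r t0 by (intro mult_nonneg_nonneg) auto
    finally have "0 \<le> (f t * t ^ ?n - (Q t + Mfun s v r) * (real ?n * t ^ (?n - 1))) / (t ^ ?n * t ^ ?n)"
      using t0 by (intro divide_nonneg_nonneg) auto
    then show "\<exists>y. (g has_real_derivative y) (at t) \<and> 0 \<le> y" using D by blast
  qed
  moreover have "g r = pavg s v r" unfolding g_def Mf using r by simp
  moreover have "g r' \<le> pavg s v r'"
  proof -
    have "Q r' + Mfun s v r \<le> r' ^ ?n * pavg s v r'" using M[of r r'] r Mf[of r'] by simp
    then have "g r' \<le> (r' ^ ?n * pavg s v r') / r' ^ ?n" unfolding g_def using r by (intro divide_right_mono) auto
    then show ?thesis using r by simp
  qed
  ultimately show ?thesis by linarith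
qed

section \<open>From Poisson averages to the functional\<close>

lemma a_ns_nonneg: "0 < s \<Longrightarrow> s < 1 \<Longrightarrow> 0 \<le> a_ns TYPE('a::euclidean_space) s"
  unfolding a_ns_def by (intro mult_nonneg_nonneg sin_ge_zero) (auto intro!: less_imp_le[OF Gamma_real_pos] simp: mult_left_le)

lemma poisson_average:
  fixes v :: "'a::euclidean_space \<Rightarrow> real"
  assumes r: "0 < r"
  shows "(LINT y : - ball 0 r | lborel. poisson_kernel s r y * v y) = a_ns TYPE('a) s * pavg s v r"
  unfolding set_lebesgue_integral_def pavg_def integral_mult_right_zero[symmetric]
proof (rule Bochner_Integration.integral_cong)
  fix y :: 'a
  show "indicator (- ball 0 r) y *\<^sub>R (poisson_kernel s r y * v y) = a_ns TYPE('a) s * (kap s r y * v y)"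
  proof (cases "r < norm y")
    case True
    then show ?thesis by (simp add: poisson_kernel_def kap_def)
  next
    case False
    show ?thesis
    proof (cases "norm y = r")
      \<comment> \<open>The complement of the open ball contains the sphere. There the kernel is a
        power of r^2 / 0, which is 0 by the conventions for division and \<open>powr\<close>, and so
        agrees with \<open>kap\<close>.\<close>
      case True
      then show ?thesis by (simp add: poisson_kernel_def kap_def)
    next
      case F: False
      then show ?thesis using False by (simp add: kap_def)
    qed
  qed
qed simp

lemma weighted_average_mono:
  fixes v :: "'a::euclidean_space \<Rightarrow> real"
  assumes s: "0 < s" "s < 1" and v: "tame s v"
    and P: "\<And>r r'. 0 < r \<Longrightarrow> r \<le> r' \<Longrightarrow> r' < \<rho> \<Longrightarrow> pavg s v r \<le> pavg s v r'"
  shows "mono_on {0<..<\<rho>} (\<lambda>R. 1 / R powr (1 + s) *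
     (LINT r : {0..R} | lborel. r powr s * (LINT y : - ball 0 r | lborel. poisson_kernel s r y * v y)))"
proof (rule mono_onI)
  fix R R' :: real assume RR: "R \<in> {0<..<\<rho>}" "R' \<in> {0<..<\<rho>}" "R \<le> R'"
  note [measurable] = tame_measurable[OF v]
  let ?a = "a_ns TYPE('a) s"
  \<comment> \<open>The substitution r = R t. Its Jacobian R and the factor R^s from the weight
    cancel the prefactor, so R survives only as the radius of the average.\<close>
  define I where "I R t = indicator {0<..1} t * (t powr s * (?a * pavg s v (R * t)))" for R t :: real
  have [measurable]: "(\<lambda>r. pavg s v r) \<in> borel_measurable borel"
    unfolding pavg_def kap_def by measurable
  have eq: "1 / R powr (1 + s) * (LINT r : {0..R} | lborel. r powr s * (LINT y : - ball 0 r | lborel. poisson_kernel s r y * v y)) = (LINT t|lborel. I R t)"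
    if R: "0 < R" for R
  proof -
    have "(LINT r : {0..R} | lborel. r powr s * (LINT y : - ball 0 r | lborel. poisson_kernel s r y * v y)) =
      R * (LINT t|lborel. indicator {0..R} (0 + R * t) *\<^sub>R ((0 + R * t) powr s * (LINT y : - ball 0 (0 + R * t) | lborel. poisson_kernel s (0 + R * t) y * v y)))"
      unfolding set_lebesgue_integral_def
      using lborel_integral_real_affine[of R "\<lambda>r. indicator {0..R} r *\<^sub>R (r powr s * (LINT y|lborel. indicator (- ball 0 r) y *\<^sub>R (poisson_kernel s r y * v y)))" 0] R by simp
    also have "(LINT t|lborel. indicator {0..R} (0 + R * t) *\<^sub>R ((0 + R * t) powr s * (LINT y : - ball 0 (0 + R * t) | lborel. poisson_kernel s (0 + R * t) y * v y))) =
      (LINT t|lborel. R powr s * I R t)"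
    proof (rule Bochner_Integration.integral_cong)
      fix t :: real
      consider "t < 0" | "t = 0" | "0 < t" "t \<le> 1" | "1 < t" by linarith
      then show "indicator {0..R} (0 + R * t) *\<^sub>R ((0 + R * t) powr s * (LINT y : - ball 0 (0 + R * t) | lborel. poisson_kernel s (0 + R * t) y * v y)) = R powr s * I R t"
      proof cases
        case 1
        then have "R * t < 0" using R by (simp add: mult_pos_neg)
        then show ?thesis using 1 by (simp add: I_def)
      next
        \<comment> \<open>At t = 0 the left side vanishes because \<open>0 powr s = 0\<close>; thus
          radius 0 never enters the comparison of averages.\<close>
        case 2
        then show ?thesis by (simp add: I_def)
      next
        case 3
        have "R * t \<le> R * 1" using 3 R by (intro mult_left_mono) auto
        then have "0 + R * t \<in> {0..R}" using 3 R by simp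
        moreover have "(LINT y : - ball 0 (0 + R * t) | lborel. poisson_kernel s (0 + R * t) y * v y) = ?a * pavg s v (R * t)"
          using poisson_average[of "0 + R * t" s v] 3 R by simp
        moreover have "(0 + R * t) powr s = R powr s * t powr s" by (simp add: powr_mult)
        ultimately show ?thesis using 3 by (simp add: I_def)
      next
        case 4
        then have "R * 1 < R * t" using R by (intro mult_strict_left_mono) auto
        then show ?thesis using 4 by (simp add: I_def)
      qed
    qed simp
    also have "\<dots> = R powr s * (LINT t|lborel. I R t)" by simp
    finally show ?thesis using R by (simp add: powr_add)
  qed
  have int: "integrable lborel (I R)" if R: "0 < R" for R
  proof -
    obtain B where B: "0 \<le> B" "\<And>r. 0 < r \<Longrightarrow> r \<le> R \<Longrightarrow> (\<integral>\<^sup>+y. ennreal (kap s r y * \<bar>v y\<bar>) \<partial>lborel) \<le> ennreal B"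
      using tame_kap_bound[OF s v R] by blast
    have PB: "\<bar>pavg s v r\<bar> \<le> B" if r: "0 < r" "r \<le> R" for r
    proof -
      have "\<bar>pavg s v r\<bar> \<le> (LINT y|lborel. norm (kap s r y * v y))"
        unfolding pavg_def using integral_norm_bound[of lborel "\<lambda>y. kap s r y * v y"] by simp
      also have "\<dots> = enn2real (\<integral>\<^sup>+y. ennreal (kap s r y * \<bar>v y\<bar>) \<partial>lborel)"
        by (subst integral_eq_nn_integral) (auto simp: abs_mult)
      also have "\<dots> \<le> enn2real (ennreal B)" by (rule enn2real_mono[OF B(2)[OF r]]) simp
      finally show ?thesis using B by simp
    qed
    have "integrable lborel (\<lambda>t::real. indicator {0<..1} t *\<^sub>R (\<bar>?a\<bar> * B))"
      by (intro integrable_scaleR_left integrable_real_indicator) auto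
    then show ?thesis
    proof (rule Bochner_Integration.integrable_bound)
      show "I R \<in> borel_measurable lborel" unfolding I_def by measurable
      show "AE t in lborel. norm (I R t) \<le> norm (indicator {0<..1} t *\<^sub>R (\<bar>?a\<bar> * B))"
      proof (rule AE_I2)
        fix t :: real
        show "norm (I R t) \<le> norm (indicator {0<..1} t *\<^sub>R (\<bar>?a\<bar> * B))"
        proof (cases "0 < t \<and> t \<le> 1")
          case True
          have "R * t \<le> R * 1" using True R by (intro mult_left_mono) auto
          then have "\<bar>pavg s v (R * t)\<bar> \<le> B" using True R by (intro PB) auto
          moreover have "t powr s \<le> 1" using True s powr_mono2[of s t 1] by simp
          ultimately have "t powr s * (\<bar>?a\<bar> * \<bar>pavg s v (R * t)\<bar>) \<le> 1 * (\<bar>?a\<bar> * B)"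
            by (intro mult_mono mult_left_mono) auto
          then show ?thesis using True B by (simp add: I_def abs_mult)
        qed (auto simp: I_def)
      qed
    qed
  qed
  have "(LINT t|lborel. I R t) \<le> (LINT t|lborel. I R' t)"
  proof (rule integral_mono[OF int int])
    fix t :: real
    show "I R t \<le> I R' t"
    proof (cases "0 < t \<and> t \<le> 1")
      case True
      have "R' * t \<le> R' * 1" using True RR by (intro mult_left_mono) auto
      moreover have "R' < \<rho>" using RR by simp
      ultimately have "R' * t < \<rho>" by linarith
      then have "pavg s v (R * t) \<le> pavg s v (R' * t)" using True RR by (intro P mult_right_mono) auto
      then show ?thesis using True a_ns_nonneg[OF s, where 'a='a] unfolding I_def by (intro mult_left_mono) auto
    qed (auto simp: I_def)
  qed (use RR in auto)
  then show "1 / R powr (1 + s) * (LINT r : {0..R} | lborel. r powr s * (LINT y : - ball 0 r | lborel. poisson_kernel s r y * v y)) \<le>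
    1 / R' powr (1 + s) * (LINT r : {0..R'} | lborel. r powr s * (LINT y : - ball 0 r | lborel. poisson_kernel s r y * v y))"
    using eq[of R] eq[of R'] RR by simp
qed

section \<open>Regularity and the fractional Laplacian\<close>

lemma holder_loc_continuous: "holder_loc k \<alpha> f \<Longrightarrow> continuous_on UNIV f"
  by (cases k) (auto intro: has_derivative_continuous simp: continuous_on_eq_continuous_at)

text \<open>The partial derivatives are continuous, hence bounded on a ball, and the ball is convex,
  so the mean value inequality applies. It is used on first derivatives that are themselves
  differentiable.\<close>

lemma holder_loc_Suc_lipschitz:
  fixes f :: "'a::euclidean_space \<Rightarrow> real"
  assumes "holder_loc (Suc k) \<alpha> f"
  shows "\<exists>C. \<forall>x y. norm x \<le> R \<longrightarrow> norm y \<le> R \<longrightarrow> \<bar>f x - f y\<bar> \<le> C * dist x y"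
proof -
  obtain Df :: "'a \<Rightarrow> 'a \<Rightarrow> real" where D: "\<And>x. (f has_derivative (\<lambda>h. \<Sum>b\<in>Basis. (h \<bullet> b) * Df b x)) (at x)"
    and H: "\<And>b. b \<in> Basis \<Longrightarrow> holder_loc k \<alpha> (Df b)" using assms by auto
  have "\<exists>M. \<forall>b\<in>Basis. \<forall>x. norm x \<le> R \<longrightarrow> \<bar>Df b x\<bar> \<le> M b"
  proof (rule bchoice[of Basis "\<lambda>b m. \<forall>x. norm x \<le> R \<longrightarrow> \<bar>Df b x\<bar> \<le> m", THEN exE], intro ballI)
    fix b :: 'a assume "b \<in> Basis"
    then show "\<exists>m. \<forall>x. norm x \<le> R \<longrightarrow> \<bar>Df b x\<bar> \<le> m"
      using continuous_bounded_cball[OF holder_loc_continuous[OF H]] by metis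
  qed blast
  then obtain M where M: "\<And>b x. b \<in> Basis \<Longrightarrow> norm x \<le> R \<Longrightarrow> \<bar>Df b x\<bar> \<le> M b" by blast
  have "norm (f x - f y) \<le> (\<Sum>b\<in>Basis. M b) * norm (x - y)" if x: "norm x \<le> R" "norm y \<le> R" for x y
  proof (rule differentiable_bound[of "cball 0 R" f "\<lambda>x h. \<Sum>b\<in>Basis. (h \<bullet> b) * Df b x"])
    show "(f has_derivative (\<lambda>h. \<Sum>b\<in>Basis. (h \<bullet> b) * Df b w)) (at w within cball 0 R)" for w
      by (rule has_derivative_at_withinI[OF D])
    fix w :: 'a assume w: "w \<in> cball 0 R"
    show "onorm (\<lambda>h. \<Sum>b\<in>Basis. (h \<bullet> b) * Df b w) \<le> (\<Sum>b\<in>Basis. M b)"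
    proof (rule onorm_le)
      fix h :: 'a
      have "\<bar>\<Sum>b\<in>Basis. (h \<bullet> b) * Df b w\<bar> \<le> (\<Sum>b\<in>Basis. M b * norm h)"
      proof (rule order.trans[OF sum_abs], rule sum_mono)
        fix b :: 'a assume b: "b \<in> Basis"
        have "\<bar>h \<bullet> b\<bar> \<le> norm h" by (rule Basis_le_norm[OF b])
        then have "\<bar>h \<bullet> b\<bar> * \<bar>Df b w\<bar> \<le> norm h * M b" using M[OF b, of w] w by (intro mult_mono) auto
        then show "\<bar>(h \<bullet> b) * Df b w\<bar> \<le> M b * norm h" by (simp add: abs_mult mult.commute)
      qed
      then show "norm (\<Sum>b\<in>Basis. (h \<bullet> b) * Df b w) \<le> (\<Sum>b\<in>Basis. M b) * norm h" by (simp add: sum_distrib_right)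
    qed
  qed (use x in auto)
  then show ?thesis by (auto simp: dist_norm)
qed

text \<open>Applying the mean value theorem to \<open>t \<mapsto> f (x + t z) + f (x - t z)\<close> turns the second difference into
  first differences of the partial derivatives.\<close>

lemma sdiff_derivative_bound:
  fixes f :: "'a::euclidean_space \<Rightarrow> real"
  assumes D: "\<And>x. (f has_derivative (\<lambda>h. \<Sum>b\<in>Basis. (h \<bullet> b) * Df b x)) (at x)"
    and a: "0 \<le> a"
    and H: "\<And>b. b \<in> Basis \<Longrightarrow> \<exists>C. \<forall>x y. norm x \<le> R + 1 \<longrightarrow> norm y \<le> R + 1 \<longrightarrow> \<bar>Df b x - Df b y\<bar> \<le> C * dist x y powr a"
  shows "\<exists>C. \<forall>x z. norm x \<le> R \<longrightarrow> norm z \<le> 1 \<longrightarrow> \<bar>sdiff f x z\<bar> \<le> C * norm z powr (1 + a)"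
proof -
  have "\<exists>K. \<forall>b\<in>Basis. \<forall>x y. norm x \<le> R + 1 \<longrightarrow> norm y \<le> R + 1 \<longrightarrow> \<bar>Df b x - Df b y\<bar> \<le> K b * dist x y powr a"
    by (rule bchoice) (use H in blast)
  then obtain K where K: "\<And>b x y. b \<in> Basis \<Longrightarrow> norm x \<le> R + 1 \<Longrightarrow> norm y \<le> R + 1 \<Longrightarrow> \<bar>Df b x - Df b y\<bar> \<le> K b * dist x y powr a"
    by blast
  define C where "C = (\<Sum>b\<in>(Basis::'a set). \<bar>K b\<bar> * 2 powr a)"
  have "\<bar>sdiff f x z\<bar> \<le> C * norm z powr (1 + a)" if x: "norm x \<le> R" and z: "norm z \<le> 1" for x z
  proof -
    define \<phi> where "\<phi> t = f (x + t *\<^sub>R z) + f (x - t *\<^sub>R z)" for t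
    define \<phi>' where "\<phi>' t = (\<Sum>b\<in>Basis. (z \<bullet> b) * (Df b (x + t *\<^sub>R z) - Df b (x - t *\<^sub>R z)))" for t
    have d: "(\<phi> has_real_derivative \<phi>' t) (at t)" for t
    proof -
      have d1: "((\<lambda>t. f (x + t *\<^sub>R z)) has_derivative (\<lambda>h. \<Sum>b\<in>Basis. ((h *\<^sub>R z) \<bullet> b) * Df b (x + t *\<^sub>R z))) (at t)"
        by (rule has_derivative_compose[OF _ D, of "\<lambda>t. x + t *\<^sub>R z" "\<lambda>h. h *\<^sub>R z"]) (auto intro!: derivative_eq_intros)
      have d2: "((\<lambda>t. f (x - t *\<^sub>R z)) has_derivative (\<lambda>h. \<Sum>b\<in>Basis. ((- (h *\<^sub>R z)) \<bullet> b) * Df b (x - t *\<^sub>R z))) (at t)"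
        by (rule has_derivative_compose[OF _ D, of "\<lambda>t. x - t *\<^sub>R z" "\<lambda>h. - (h *\<^sub>R z)"]) (auto intro!: derivative_eq_intros)
      have "(\<lambda>h. (\<Sum>b\<in>Basis. ((h *\<^sub>R z) \<bullet> b) * Df b (x + t *\<^sub>R z)) + (\<Sum>b\<in>Basis. ((- (h *\<^sub>R z)) \<bullet> b) * Df b (x - t *\<^sub>R z))) = (\<lambda>h. \<phi>' t * h)"
        unfolding \<phi>'_def sum.distrib[symmetric] sum_distrib_right by (rule ext, rule sum.cong) (auto simp: algebra_simps)
      then show ?thesis unfolding has_field_derivative_def \<phi>_def using has_derivative_add[OF d1 d2] by simp
    qed
    obtain t where t: "0 < t" "t < 1" "\<phi> 1 - \<phi> 0 = (1 - 0) * \<phi>' t"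
      using MVT2[of 0 1 \<phi> \<phi>'] d by auto
    have "sdiff f x z = - (\<phi> 1 - \<phi> 0)" by (simp add: sdiff_def \<phi>_def)
    then have "\<bar>sdiff f x z\<bar> = \<bar>\<phi>' t\<bar>" using t by simp
    also have "\<dots> \<le> (\<Sum>b\<in>(Basis::'a set). \<bar>K b\<bar> * 2 powr a * norm z powr (1 + a))"
      unfolding \<phi>'_def
    proof (rule order.trans[OF sum_abs], rule sum_mono)
      fix b :: 'a assume b: "b \<in> Basis"
      have tz: "norm (t *\<^sub>R z) \<le> 1 * 1" unfolding norm_scaleR using t z by (intro mult_mono) auto
      have n: "norm (x + t *\<^sub>R z) \<le> R + 1" "norm (x - t *\<^sub>R z) \<le> R + 1"
        using norm_triangle_ineq[of x "t *\<^sub>R z"] norm_triangle_ineq4[of x "t *\<^sub>R z"] x tz by linarith+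
      have "dist (x + t *\<^sub>R z) (x - t *\<^sub>R z) = norm (2 *\<^sub>R (t *\<^sub>R z))"
        unfolding dist_norm by (rule arg_cong[where f=norm]) (simp only: scaleR_2, simp)
      also have "\<dots> = 2 * (t * norm z)" using t by simp
      also have "\<dots> \<le> 2 * norm z" using t by (simp add: mult_left_le_one_le)
      finally have "dist (x + t *\<^sub>R z) (x - t *\<^sub>R z) powr a \<le> (2 * norm z) powr a"
        using a by (intro powr_mono2) auto
      then have "\<bar>K b\<bar> * dist (x + t *\<^sub>R z) (x - t *\<^sub>R z) powr a \<le> \<bar>K b\<bar> * (2 powr a * norm z powr a)"
        by (intro mult_left_mono) (auto simp: powr_mult)
      moreover have "K b * dist (x + t *\<^sub>R z) (x - t *\<^sub>R z) powr a \<le> \<bar>K b\<bar> * dist (x + t *\<^sub>R z) (x - t *\<^sub>R z) powr a"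
        by (intro mult_right_mono) auto
      ultimately have "\<bar>Df b (x + t *\<^sub>R z) - Df b (x - t *\<^sub>R z)\<bar> \<le> \<bar>K b\<bar> * (2 powr a * norm z powr a)"
        using K[OF b n] by linarith
      then have "\<bar>z \<bullet> b\<bar> * \<bar>Df b (x + t *\<^sub>R z) - Df b (x - t *\<^sub>R z)\<bar> \<le> norm z * (\<bar>K b\<bar> * (2 powr a * norm z powr a))"
        using Basis_le_norm[OF b, of z] by (intro mult_mono) auto
      also have "norm z * (\<bar>K b\<bar> * (2 powr a * norm z powr a)) = \<bar>K b\<bar> * 2 powr a * norm z powr (1 + a)"
        by (cases "z = 0") (auto simp: powr_add)
      finally show "\<bar>(z \<bullet> b) * (Df b (x + t *\<^sub>R z) - Df b (x - t *\<^sub>R z))\<bar> \<le> \<bar>K b\<bar> * 2 powr a * norm z powr (1 + a)"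
        by (simp add: abs_mult)
    qed
    also have "\<dots> = C * norm z powr (1 + a)" by (simp add: C_def sum_distrib_right)
    finally show ?thesis .
  qed
  then show ?thesis by blast
qed

text \<open>The exponent depends on the integer part of \<gamma> = 2 s + \<delta>. If it is 0, the
  function itself gives \<gamma>; if it is 1, the first derivatives give 1 + \<alpha> = \<gamma>;
  from 2 on, locally Lipschitz first derivatives give 2, which exceeds 2 s because s < 1. Integer
  values of \<gamma> are included through \<alpha> = 0.\<close>

lemma C_loc_sreg:
  fixes v :: "'a::euclidean_space \<Rightarrow> real"
  assumes s: "0 < s" "s < 1" and \<delta>: "0 < \<delta>" and v: "C_loc (2 * s + \<delta>) v"
  shows "sreg s R v"
proof -
  define \<gamma> where "\<gamma> = 2 * s + \<delta>"
  define \<alpha> where "\<alpha> = \<gamma> - of_int \<lfloor>\<gamma>\<rfloor>"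
  have \<gamma>: "0 < \<gamma>" using s \<delta> by (simp add: \<gamma>_def)
  have \<alpha>: "0 \<le> \<alpha>" unfolding \<alpha>_def by linarith
  have h: "holder_loc (nat \<lfloor>\<gamma>\<rfloor>) \<alpha> v" using v unfolding C_loc_def \<gamma>_def[symmetric] \<alpha>_def .
  show ?thesis
  proof (cases "nat \<lfloor>\<gamma>\<rfloor>")
    case 0
    then have "\<lfloor>\<gamma>\<rfloor> = 0" using \<gamma> by linarith
    then have ag: "\<alpha> = \<gamma>" by (simp add: \<alpha>_def)
    have "\<exists>C. \<forall>x\<in>cball 0 (R + 1). \<forall>y\<in>cball 0 (R + 1). \<bar>v x - v y\<bar> \<le> C * dist x y powr \<alpha>"
      using h unfolding 0 by (simp add: compact_cball)
    then obtain C where "\<forall>x\<in>cball 0 (R + 1). \<forall>y\<in>cball 0 (R + 1). \<bar>v x - v y\<bar> \<le> C * dist x y powr \<alpha>" by blast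
    then have C: "\<bar>v x - v y\<bar> \<le> C * dist x y powr \<alpha>" if "norm x \<le> R + 1" "norm y \<le> R + 1" for x y
      using that by simp
    have "\<bar>sdiff v x z\<bar> \<le> (2 * C) * norm z powr \<gamma>" if x: "norm x \<le> R" and z: "norm z \<le> 1" for x z
    proof -
      have n: "norm (x + z) \<le> R + 1" "norm (x - z) \<le> R + 1" "norm x \<le> R + 1"
        using norm_triangle_ineq[of x z] norm_triangle_ineq4[of x z] x z by linarith+
      have "\<bar>v x - v (x + z)\<bar> \<le> C * norm z powr \<gamma>" "\<bar>v x - v (x - z)\<bar> \<le> C * norm z powr \<gamma>"
        using C[OF n(3) n(1)] C[OF n(3) n(2)] by (simp_all add: ag dist_norm)
      then show ?thesis unfolding sdiff_def by linarith
    qed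
    moreover have "2 * s < \<gamma>" using \<delta> by (simp add: \<gamma>_def)
    ultimately show ?thesis unfolding sreg_def by blast
  next
    case (Suc k)
    obtain Df :: "'a \<Rightarrow> 'a \<Rightarrow> real" where D: "\<And>x. (v has_derivative (\<lambda>h. \<Sum>b\<in>Basis. (h \<bullet> b) * Df b x)) (at x)"
      and H: "\<And>b. b \<in> Basis \<Longrightarrow> holder_loc k \<alpha> (Df b)" using h unfolding Suc by auto
    show ?thesis
    proof (cases k)
      case 0
      then have "\<lfloor>\<gamma>\<rfloor> = 1" using Suc by linarith
      then have ag: "1 + \<alpha> = \<gamma>" by (simp add: \<alpha>_def)
      have "\<exists>C. \<forall>x z. norm x \<le> R \<longrightarrow> norm z \<le> 1 \<longrightarrow> \<bar>sdiff v x z\<bar> \<le> C * norm z powr (1 + \<alpha>)"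
      proof (rule sdiff_derivative_bound[OF D \<alpha>])
        fix b :: 'a assume "b \<in> Basis"
        then have "\<exists>C. \<forall>x\<in>cball 0 (R + 1). \<forall>y\<in>cball 0 (R + 1). \<bar>Df b x - Df b y\<bar> \<le> C * dist x y powr \<alpha>"
          using H[of b] unfolding 0 by (simp add: compact_cball)
        then show "\<exists>C. \<forall>x y. norm x \<le> R + 1 \<longrightarrow> norm y \<le> R + 1 \<longrightarrow> \<bar>Df b x - Df b y\<bar> \<le> C * dist x y powr \<alpha>"
          unfolding Ball_def mem_cball_0 by blast
      qed
      moreover have "2 * s < 1 + \<alpha>" using \<delta> by (simp add: ag \<gamma>_def)
      ultimately show ?thesis unfolding sreg_def by blast
    next
      case (Suc k')
      have "\<exists>C. \<forall>x z. norm x \<le> R \<longrightarrow> norm z \<le> 1 \<longrightarrow> \<bar>sdiff v x z\<bar> \<le> C * norm z powr (1 + 1)"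
      proof (rule sdiff_derivative_bound[OF D])
        fix b :: 'a assume "b \<in> Basis"
        then show "\<exists>C. \<forall>x y. norm x \<le> R + 1 \<longrightarrow> norm y \<le> R + 1 \<longrightarrow> \<bar>Df b x - Df b y\<bar> \<le> C * dist x y powr 1"
          using holder_loc_Suc_lipschitz[of k' \<alpha> "Df b" "R + 1"] H[of b] unfolding Suc by simp
      qed simp
      moreover have "2 * s < 1 + 1" using s by simp
      ultimately show ?thesis unfolding sreg_def by blast
    qed
  qed
qed

lemma Lps_tame:
  fixes v :: "'a::euclidean_space \<Rightarrow> real"
  assumes "continuous_on UNIV v" "Lps 1 s v"
  shows "tame s v"
  using assms unfolding tame_def Lps_def by simp

text \<open>Averaging the truncated integral with its image under z \<mapsto> - z produces one half
  of the second difference. That one is absolutely integrable, so dominated convergence removes the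
  truncation, and the \<open>Lim\<close> in the definition is an actual limit.\<close>

lemma frac_lap_eq_opL:
  fixes v :: "'a::euclidean_space \<Rightarrow> real"
  assumes s: "0 < s" and v: "tame s v" and R: "0 < R" and reg: "sreg s R v" and x: "norm x \<le> R"
  shows "frac_lap s v x = C_ns TYPE('a) s * (opL s v x / 2)"
proof -
  note [measurable] = tame_measurable[OF v]
  let ?p = "real DIM('a) + 2 * s"
  define tr where "tr \<epsilon> = (LINT y : - ball x \<epsilon> | lborel. (v x - v y) / norm (x - y) powr ?p)" for \<epsilon>
  obtain B1 where B1: "\<And>x. norm x \<le> R \<Longrightarrow> (\<integral>\<^sup>+z. ennreal (\<bar>sdiff v x z\<bar> * kern s z) \<partial>lborel) \<le> ennreal B1"
    using sreg_L1[OF s v R reg] by blast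
  have iD: "integrable lborel (\<lambda>z. sdiff v x z * kern s z)"
    unfolding integrable_iff_bounded
  proof
    show "(\<integral>\<^sup>+z. ennreal (norm (sdiff v x z * kern s z)) \<partial>lborel) < \<infinity>"
      using B1[OF x] by (auto simp: abs_mult intro: le_less_trans)
  qed measurable
  have tr: "tr \<epsilon> = (LINT z|lborel. indicator {\<epsilon>..} (norm z) * (sdiff v x z * kern s z)) / 2" if \<epsilon>: "0 < \<epsilon>" for \<epsilon>
  proof -
    define F where "F z = indicator {\<epsilon>..} (norm z) * ((v x - v (x + z)) * kern s z)" for z :: 'a
    have [measurable]: "F \<in> borel_measurable borel" unfolding F_def by measurable
    have "tr \<epsilon> = (LINT y|lborel. indicator (- ball x \<epsilon>) y * ((v x - v y) / norm (x - y) powr ?p))"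
      unfolding tr_def set_lebesgue_integral_def by simp
    also have "\<dots> = (LINT z|lborel. indicator (- ball x \<epsilon>) (x + z) * ((v x - v (x + z)) / norm (x - (x + z)) powr ?p))"
    proof (rule integral_lborel_translate[symmetric])
      have [measurable]: "- ball x \<epsilon> \<in> sets borel" by simp
      show "(\<lambda>y. indicator (- ball x \<epsilon>) y * ((v x - v y) / norm (x - y) powr ?p)) \<in> borel_measurable borel" by measurable
    qed
    also have "\<dots> = (LINT z|lborel. F z)"
      by (rule Bochner_Integration.integral_cong)
        (auto simp: F_def kern_def powr_minus[of "norm z" ?p for z] indicator_def dist_norm divide_inverse simp del: minus_add_distrib)
    finally have trF: "tr \<epsilon> = (LINT z|lborel. F z)" .
    obtain B where B: "0 \<le> B" "\<And>x. norm x \<le> R \<Longrightarrow> (\<integral>\<^sup>+z. ennreal (indicator {1..} (norm z) * (\<bar>v (x + z)\<bar> * kern s z)) \<partial>lborel) \<le> ennreal B"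
      using tame_tail[OF s v R] by blast
    obtain M where M: "0 \<le> M" "\<And>x. norm x \<le> R + 1 \<Longrightarrow> \<bar>v x\<bar> \<le> M" using tame_bounded[OF v] by blast
    \<comment> \<open>The choice 2 s + 1 is one exponent above 2 s. On |z| \<ge> \<epsilon> the
      number \<mu> is a lower bound of \<open>min 1 (norm z powr \<beta>)\<close>, so dividing by it
      majorises a constant multiple of the kernel there.\<close>
    define \<beta> where "\<beta> = 2 * s + 1"
    define \<mu> where "\<mu> = min 1 (\<epsilon> powr \<beta>)"
    have \<beta>: "0 < \<beta>" "2 * s < \<beta>" using s by (auto simp: \<beta>_def)
    have \<mu>: "0 < \<mu>" using \<epsilon> by (simp add: \<mu>_def)
    let ?m = "\<lambda>z::'a. min 1 (norm z powr \<beta>) * kern s z"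
    let ?t = "\<lambda>z. indicator {1..} (norm z) * (\<bar>v (x + z)\<bar> * kern s z)"
    have iF: "integrable lborel F"
    proof (rule Bochner_Integration.integrable_bound)
      have i1: "integrable lborel (\<lambda>z. (2 * M / \<mu>) * ?m z)" by (intro integrable_mult_right integrable_min_kern s \<beta>)
      have i2: "integrable lborel ?t"
        unfolding integrable_iff_bounded
      proof
        show "(\<integral>\<^sup>+z. ennreal (norm (?t z)) \<partial>lborel) < \<infinity>"
          using B(2)[OF x] by (auto simp: abs_mult intro: le_less_trans)
      qed measurable
      show "integrable lborel (\<lambda>z. (2 * M / \<mu>) * ?m z + ?t z)" by (rule Bochner_Integration.integrable_add[OF i1 i2])
      show "AE z in lborel. norm (F z) \<le> norm ((2 * M / \<mu>) * ?m z + ?t z)"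
      proof (rule AE_I2)
        fix z :: 'a
        have pos: "0 \<le> (2 * M / \<mu>) * ?m z" "0 \<le> ?t z" using M \<mu> by auto
        have "\<bar>F z\<bar> \<le> (2 * M / \<mu>) * ?m z + ?t z"
        proof (cases "\<epsilon> \<le> norm z")
          case True
          have "\<epsilon> powr \<beta> \<le> norm z powr \<beta>" using True \<epsilon> \<beta> by (intro powr_mono2) auto
          then have "\<mu> \<le> min 1 (norm z powr \<beta>)" by (auto simp: \<mu>_def)
          then have "1 \<le> min 1 (norm z powr \<beta>) / \<mu>" using \<mu> by simp
          then have "2 * M * 1 \<le> 2 * M * (min 1 (norm z powr \<beta>) / \<mu>)" using M by (intro mult_left_mono) auto
          then have m: "2 * M * kern s z \<le> (2 * M / \<mu>) * ?m z"
            using mult_right_mono[of "2 * M * 1" "2 * M * (min 1 (norm z powr \<beta>) / \<mu>)" "kern s z"] by simp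
          have vx: "\<bar>v x\<bar> \<le> M" using M(2)[of x] x by simp
          have F: "\<bar>F z\<bar> = \<bar>v x - v (x + z)\<bar> * kern s z" using True by (simp add: F_def abs_mult)
          show ?thesis
          proof (cases "norm z < 1")
            case T: True
            have "norm (x + z) \<le> R + 1" using norm_triangle_ineq[of x z] x T by linarith
            then have "\<bar>v x - v (x + z)\<bar> \<le> 2 * M" using M(2)[of "x + z"] vx by linarith
            then have "\<bar>F z\<bar> \<le> 2 * M * kern s z" unfolding F by (intro mult_right_mono) auto
            then show ?thesis using m pos(2) by linarith
          next
            case F1: False
            have "\<bar>v x - v (x + z)\<bar> \<le> 2 * M + \<bar>v (x + z)\<bar>" using vx M(1) by linarith
            then have "\<bar>F z\<bar> \<le> (2 * M + \<bar>v (x + z)\<bar>) * kern s z" unfolding F by (intro mult_right_mono) auto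
            then have "\<bar>F z\<bar> \<le> 2 * M * kern s z + ?t z" using F1 by (simp add: distrib_right)
            then show ?thesis using m by linarith
          qed
        next
          case False
          then have "F z = 0" by (simp add: F_def)
          then show ?thesis using pos by simp
        qed
        then show "norm (F z) \<le> norm ((2 * M / \<mu>) * ?m z + ?t z)" using pos by simp
      qed
    qed measurable
    have iF': "integrable lborel (\<lambda>z. F (- z))" and eF': "(LINT z|lborel. F (- z)) = (LINT z|lborel. F z)"
    proof -
      have e: "distr lborel borel (\<lambda>x::'a. 0 + (-1) *\<^sub>R x) = lborel"
        using lborel_affine[of "-1" "0::'a"] by (simp add: density_1)
      have "(LINT z|distr lborel borel (\<lambda>x::'a. 0 + (-1) *\<^sub>R x). F z) = (LINT z|lborel. F (0 + (-1) *\<^sub>R z))"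
        by (rule integral_distr) auto
      then show "(LINT z|lborel. F (- z)) = (LINT z|lborel. F z)" unfolding e by simp
      have "integrable (distr lborel borel (\<lambda>x::'a. 0 + (-1) *\<^sub>R x)) F \<longleftrightarrow> integrable lborel (\<lambda>z. F (0 + (-1) *\<^sub>R z))"
        by (rule integrable_distr_eq) auto
      then show "integrable lborel (\<lambda>z. F (- z))" unfolding e using iF by simp
    qed
    have "2 * (LINT z|lborel. F z) = (LINT z|lborel. F z + F (- z))"
      using Bochner_Integration.integral_add[OF iF iF'] eF' by simp
    also have "\<dots> = (LINT z|lborel. indicator {\<epsilon>..} (norm z) * (sdiff v x z * kern s z))"
      by (rule Bochner_Integration.integral_cong) (auto simp: F_def sdiff_def algebra_simps)
    finally show ?thesis unfolding trF by simp
  qed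
  have "(tr \<longlongrightarrow> opL s v x / 2) (at_right 0)"
  proof (rule tendsto_at_right_sequentially[of 0 1])
    fix S :: "nat \<Rightarrow> real" assume S: "\<And>n. 0 < S n" "S \<longlonglongrightarrow> 0"
    have "(\<lambda>n. LINT z|lborel. indicator {S n..} (norm z) * (sdiff v x z * kern s z)) \<longlonglongrightarrow> (LINT z|lborel. sdiff v x z * kern s z)"
    proof (rule integral_dominated_convergence[where w="\<lambda>z. norm (sdiff v x z * kern s z)"])
      show "integrable lborel (\<lambda>z. norm (sdiff v x z * kern s z))" by (rule integrable_norm[OF iD])
      have "AE z::'a in lborel. z \<noteq> 0" by (rule AE_lborel_singleton)
      then show "AE z in lborel. (\<lambda>n. indicator {S n..} (norm z) * (sdiff v x z * kern s z)) \<longlonglongrightarrow> sdiff v x z * kern s z"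
      proof eventually_elim
        case (elim z)
        have "eventually (\<lambda>n. S n < norm z) sequentially" using elim by (intro order_tendstoD(2)[OF S(2)]) simp
        then have "eventually (\<lambda>n. indicator {S n..} (norm z) * (sdiff v x z * kern s z) = sdiff v x z * kern s z) sequentially"
          by eventually_elim simp
        then show ?case by (rule tendsto_eventually)
      qed
    qed (auto simp: indicator_def)
    then have "(\<lambda>n. (LINT z|lborel. indicator {S n..} (norm z) * (sdiff v x z * kern s z)) / 2) \<longlonglongrightarrow> opL s v x / 2"
      unfolding opL_def by (intro tendsto_intros) auto
    then show "(\<lambda>n. tr (S n)) \<longlonglongrightarrow> opL s v x / 2" by (simp only: tr[OF S(1)])
  qed simp
  then have "Lim (at_right 0) tr = opL s v x / 2" by (intro tendsto_Lim) auto
  then show ?thesis unfolding frac_lap_def tr_def by simp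
qed

lemma C_ns_nonneg: "0 \<le> C_ns TYPE('a::euclidean_space) s"
  unfolding C_ns_def by (auto intro!: integral_nonneg_AE divide_nonneg_nonneg)

theorem theorem1p1:
  fixes u :: "'a::euclidean_space \<Rightarrow> real" and s \<epsilon> \<delta> :: real
  assumes "0 < s" and "s < 1" and "0 < \<epsilon>" and "0 < \<delta>"
    and "C_loc (s + \<epsilon>) u" and "Lps 2 s u"
    and "C_loc (2 * s + \<delta>) (G_fun s u)" and "Lps 1 s (G_fun s u)"
    and "\<exists>\<rho>>0. \<forall>x\<in>ball 0 \<rho>. frac_lap s (G_fun s u) x \<le> 0"
  shows "\<exists>R0>0. mono_on {0<..<R0} (J_ACF s u)"
proof (cases "C_ns TYPE('a) s = 0")
  \<comment> \<open>The constant is the inverse of a Bochner integral and would be 0 if that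
    integral had the value 0, which is also its default value. In that case G_u vanishes identically
    and J is constant. Otherwise the constant is positive, and the sign of the fractional Laplacian
    passes to \<open>opL\<close>.\<close>
  case True
  then have "G_fun s u y = 0" for y by (simp add: G_fun_def)
  then have "J_ACF s u = (\<lambda>_. 0)" by (simp add: J_ACF_def set_lebesgue_integral_def fun_eq_iff)
  then show ?thesis by (intro exI[of _ 1]) (simp add: mono_on_def)
next
  case False
  then have C: "0 < C_ns TYPE('a) s" using C_ns_nonneg[of s, where 'a='a] by simp
  note s = assms(1,2)
  let ?v = "G_fun s u"
  obtain \<rho> where \<rho>: "0 < \<rho>" "\<And>x. norm x < \<rho> \<Longrightarrow> frac_lap s ?v x \<le> 0" using assms(9) by auto
  have v: "tame s ?v"
    using assms(7,8) holder_loc_continuous unfolding C_loc_def by (intro Lps_tame) blast+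
  have reg: "sreg s R ?v" for R by (rule C_loc_sreg[OF s assms(4,7)])
  have sub: "opL s ?v x \<le> 0" if "norm x < \<rho>" for x
  proof -
    have "C_ns TYPE('a) s * (opL s ?v x / 2) \<le> 0"
      using \<rho>(2)[OF that] frac_lap_eq_opL[OF s(1) v \<rho>(1) reg, of x] that by simp
    then show ?thesis using C by (simp add: mult_le_0_iff)
  qed
  have "pavg s ?v r \<le> pavg s ?v r'" if "0 < r" "r \<le> r'" "r' < \<rho>" for r r'
    by (rule pavg_mono[OF s v Mfun_mono[OF s v reg sub] that])
  then have "mono_on {0<..<\<rho>} (J_ACF s u)"
    using weighted_average_mono[OF s v, of \<rho>] unfolding J_ACF_def[abs_def] by blast
  then show ?thesis using \<rho>(1) by blast
qed

end
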